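(* Let $\mathcal H$ be a vector sublattice of $L^\Phi(\mathfrak P)$ that contains $\mathbf 1_\Omega$ and generates $\mathcal F$, let $\mathcal C=\mathrm{cl}(\mathcal H)$ be its norm closure in $L^\Phi(\mathfrak P)$, and assume $L^\infty(\mathfrak P)\subset L^\Phi(\mathfrak P)$. Suppose that the Banach lattice $(\mathcal C,\preceq,\|\cdot\|_{L^\Phi(\mathfrak P)})$ is separable, and let $\mathbb P^*\in\mathbf{ca}_+^1(L^\Phi(\mathfrak P))$ be a probability measure such that the canonical projection $J_{\mathbb P^*}$ is injective on $\mathcal C$ (so that $\mathbb P^*$ is a strictly positive functional on $\mathcal C$ and the $\mathfrak P$-q.s. and $\mathbb P^*$-a.s. orders coincide on $\mathcal C$). Then the following statements are equivalent: (1) $\mathcal C$ is Dedekind $\sigma$-complete. (2) $\mathcal C$ is super Dedekind complete. (3) $\mathcal C=\mathrm{cl}(L^\infty(\mathfrak P))$. (4) $\mathcal C$ is an ideal in $L^\Phi(\mathfrak P)$. (5) $\mathcal C^*=\mathbf{ca}(\mathcal C)=\mathbf{ca}(L^\Phi(\mathfrak P))\approx\mathbb P^*$ and the unit ball therein is weakly compact in $L^1(\mathbb P^* )$. Moreover, they imply both of the following assertions: (6) $\mathfrak P\approx\mathbb P^*$. (7) If, additionally, $\inf_{\mathbb P\in\mathfrak P}\phi_{\mathbb P}(x_0)\in(0,\infty]$ for some $x_0\in(0,\infty)$, then the set $\{\frac{d\mathbb P}{d\mathbb P^*}:\mathbb P\in\mathfrak P\}$ of densities of priors in $\mathfrak P$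 is uniformly $\mathbb P^*$-integrable.
   Context: $(\Omega,\mathcal F)$ is a measurable space, $\mathfrak P$ a nonempty set of probability measures on it. $L^0(\mathfrak P)$ is the space of equivalence classes $[f]$ of measurable $f\colon\Omega\to\mathbb R$ under $f\sim g\iff \mathbb P(f=g)=1$ for all $\mathbb P\in\mathfrak P$, with the $\mathfrak P$-q.s. order $X\preceq Y$ iff $\mathbb P(f\le g)=1$ for all $\mathbb P\in\mathfrak P$, $f\in X$, $g\in Y$; it is a vector lattice. $L^\infty(\mathfrak P)\subset L^0(\mathfrak P)$ is the space of classes of bounded random variables. An Orlicz function is a lower semicontinuous, nondecreasing, convex $\phi\colon[0,\infty)\to[0,\infty]$ with $\phi(0)=0$ such that there are $x_0,x_1>0$ with $\phi(x_0)<\infty$, $\phi(x_1)>0$. $\Phi=(\phi_{\mathbb P})_{\mathbb P\in\mathfrak P}$ is a family of Orlicz functions; for $X\in L^0(\mathfrak P)$, $\|X\|_{L^\Phi(\mathfrak P)}=\inf\{\lambda>0:\sup_{\mathbb P\in\mathfrak P}\mathbb E_{\mathbb P}[\phi_{\mathbb P}(\lambda^{-1}|X|)]\le1\}$, and $L^\Phi(\mathfrak P)=\{X: \|X\|_{L^\Phi(\mathfrak P)}<\infty\}$; this is a Banach lattice. Closures cl are in this norm. Standing assumption: $L^\infty(\mathfrak P)\subset L^\Phi(\mathfrak P)$ (equivalently, $\sup_{\mathbb P}\phi_{\mathbb P}(x_0)<\infty$ for some $x_0>0$). $\mathcal H$ generates $\mathcal F$ if the $\sigma$-algebra generated by $\mathcal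 L=\{f\colon\Omega\to\mathbb R\text{ measurable}: [f]\in\mathcal H\}$ equals $\mathcal F$. $\mathbf{ca}$: signed measures on $(\Omega,\mathcal F)$ of finite total variation. For nonempty sets $\mathfrak Q,\mathfrak R\subset\mathbf{ca}$, $\mathfrak Q\ll\mathfrak R$ means $\sup_{\nu\in\mathfrak R}|\nu|(N)=0$ implies $\sup_{\mu\in\mathfrak Q}|\mu|(N)=0$ for $N\in\mathcal F$; $\mathfrak Q\approx\mathfrak R$ means both $\mathfrak Q\ll\mathfrak R$ and $\mathfrak R\ll\mathfrak Q$; singletons are written without braces. $\mathbf{ca}(\mathfrak P)=\{\mu\in\mathbf{ca}:\mu\ll\mathfrak P\}$. For a normed sublattice $\mathcal X$ of $L^\Phi(\mathfrak P)$ (here $\mathcal X=\mathcal C$ or $L^\Phi(\mathfrak P)$), $\mathbf{ca}(\mathcal X)$ is the set of $\mu\in\mathbf{ca}(\mathfrak P)$ such that every $X\in\mathcal X$ is $|\mu|$-integrable and $X\mapsto\int X\,d|\mu|$ is norm continuous on $\mathcal X$; such $\mu$ is identified with the continuous functional $X\mapsto\int X\,d\mu$ on $\mathcal X$, so that equality with the norm dual $\mathcal C^*$ means that every element of $\mathcal C^*$ is of this form. $\mathbf{ca}_+^1(L^\Phi(\mathfrak P))$ is the set of probability measures in $\mathbf{ca}(L^\Phi(\mathfrak P))$. The unit ball in (5) is $\{\mu\in\mathbf{ca}(\mathcal C):\|\mu\|_{\mathcal C^*}\le1\}$, regarded as a subset of $L^1(\mathbb P^* )$ via Radon–Nikodym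 densities $\frac{d\mu}{d\mathbb P^*}$. For $\mathbb Q\in\mathbf{ca}_+^1(L^\Phi(\mathfrak P))$, $J_{\mathbb Q}\colon L^\Phi(\mathfrak P)\to L^1(\mathbb Q)$ maps $X$ to the $\mathbb Q$-a.s. equivalence class of any representative of $X$. For every separable subspace of $L^\Phi(\mathfrak P)$ a $\mathbb P^*$ with $J_{\mathbb P^*}$ injective on it exists. A vector lattice is Dedekind $\sigma$-complete (Dedekind complete) if every countable subset (every subset) with an upper bound has a least upper bound; it is super Dedekind complete if it is Dedekind complete and suprema are attained by countable subsets. An ideal $I$ in a vector lattice is a vector subspace such that $|X|\preceq|Y|$, $Y\in I$ imply $X\in I$. *)

theory Defs
  imports "HOL-Analysis.Analysis" "HOL-Probability.Probability"
begin

text \<open>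
  Throughout, \<open>M\<close> only serves as the measurable space \<open>(space M, sets M)\<close>; priors are measures
  with the same sigma-algebra. Elements of \<open>L\<^sup>0\<close> are genuine equivalence classes, i.e. sets of
  measurable functions; operations on classes go through an arbitrary representative.
\<close>

definition priors :: "'a measure \<Rightarrow> 'a measure set \<Rightarrow> bool" where
  "priors M PP \<longleftrightarrow> PP \<noteq> {} \<and> (\<forall>P\<in>PP. prob_space P \<and> sets P = sets M)"


subsection \<open>The quasi-sure space \<open>L\<^sup>0\<close>\<close>

definition qs_rel :: "'a measure \<Rightarrow> 'a measure set \<Rightarrow> (('a \<Rightarrow> real) \<times> ('a \<Rightarrow> real)) set" where
  "qs_rel M PP = {(f, g). f \<in> borel_measurable M \<and> g \<in> borel_measurable M \<and>
     (\<forall>P\<in>PP. AE x in P. f x = g x)}"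

definition qs_class :: "'a measure \<Rightarrow> 'a measure set \<Rightarrow> ('a \<Rightarrow> real) \<Rightarrow> ('a \<Rightarrow> real) set" where
  "qs_class M PP f = qs_rel M PP `` {f}"

definition L0 :: "'a measure \<Rightarrow> 'a measure set \<Rightarrow> ('a \<Rightarrow> real) set set" where
  "L0 M PP = borel_measurable M // qs_rel M PP"

definition rep :: "('a \<Rightarrow> real) set \<Rightarrow> 'a \<Rightarrow> real" where
  "rep X = (SOME f. f \<in> X)"

definition qs_le :: "'a measure set \<Rightarrow> ('a \<Rightarrow> real) set \<Rightarrow> ('a \<Rightarrow> real) set \<Rightarrow> bool" where
  "qs_le PP X Y \<longleftrightarrow> (\<forall>f\<in>X. \<forall>g\<in>Y. \<forall>P\<in>PP. AE x in P. f x \<le> g x)"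

definition qs_add :: "'a measure \<Rightarrow> 'a measure set \<Rightarrow> ('a \<Rightarrow> real) set \<Rightarrow> ('a \<Rightarrow> real) set \<Rightarrow> ('a \<Rightarrow> real) set" where
  "qs_add M PP X Y = qs_class M PP (\<lambda>x. rep X x + rep Y x)"

definition qs_diff :: "'a measure \<Rightarrow> 'a measure set \<Rightarrow> ('a \<Rightarrow> real) set \<Rightarrow> ('a \<Rightarrow> real) set \<Rightarrow> ('a \<Rightarrow> real) set" where
  "qs_diff M PP X Y = qs_class M PP (\<lambda>x. rep X x - rep Y x)"

definition qs_scale :: "'a measure \<Rightarrow> 'a measure set \<Rightarrow> real \<Rightarrow> ('a \<Rightarrow> real) set \<Rightarrow> ('a \<Rightarrow> real) set" where
  "qs_scale M PP c X = qs_class M PP (\<lambda>x. c * rep X x)"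

definition qs_sup :: "'a measure \<Rightarrow> 'a measure set \<Rightarrow> ('a \<Rightarrow> real) set \<Rightarrow> ('a \<Rightarrow> real) set \<Rightarrow> ('a \<Rightarrow> real) set" where
  "qs_sup M PP X Y = qs_class M PP (\<lambda>x. max (rep X x) (rep Y x))"

definition qs_inf :: "'a measure \<Rightarrow> 'a measure set \<Rightarrow> ('a \<Rightarrow> real) set \<Rightarrow> ('a \<Rightarrow> real) set \<Rightarrow> ('a \<Rightarrow> real) set" where
  "qs_inf M PP X Y = qs_class M PP (\<lambda>x. min (rep X x) (rep Y x))"

definition qs_abs :: "'a measure \<Rightarrow> 'a measure set \<Rightarrow> ('a \<Rightarrow> real) set \<Rightarrow> ('a \<Rightarrow> real) set" where
  "qs_abs M PP X = qs_class M PP (\<lambda>x. \<bar>rep X x\<bar>)"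

definition Linf :: "'a measure \<Rightarrow> 'a measure set \<Rightarrow> ('a \<Rightarrow> real) set set" where
  "Linf M PP = {X \<in> L0 M PP. \<exists>f\<in>X. \<exists>c. \<forall>x\<in>space M. \<bar>f x\<bar> \<le> c}"

definition qs_subspace :: "'a measure \<Rightarrow> 'a measure set \<Rightarrow> ('a \<Rightarrow> real) set set \<Rightarrow> ('a \<Rightarrow> real) set set \<Rightarrow> bool" where
  "qs_subspace M PP V W \<longleftrightarrow> W \<subseteq> V \<and> qs_class M PP (\<lambda>_. 0) \<in> W \<and>
     (\<forall>X\<in>W. \<forall>Y\<in>W. qs_add M PP X Y \<in> W) \<and> (\<forall>c. \<forall>X\<in>W. qs_scale M PP c X \<in> W)"

definition qs_sublattice :: "'a measure \<Rightarrow> 'a measure set \<Rightarrow> ('a \<Rightarrow> real) set set \<Rightarrow> ('a \<Rightarrow> real) set set \<Rightarrow> bool" where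
  "qs_sublattice M PP V W \<longleftrightarrow> qs_subspace M PP V W \<and>
     (\<forall>X\<in>W. \<forall>Y\<in>W. qs_sup M PP X Y \<in> W \<and> qs_inf M PP X Y \<in> W)"

definition qs_ideal :: "'a measure \<Rightarrow> 'a measure set \<Rightarrow> ('a \<Rightarrow> real) set set \<Rightarrow> ('a \<Rightarrow> real) set set \<Rightarrow> bool" where
  "qs_ideal M PP V I \<longleftrightarrow> qs_subspace M PP V I \<and>
     (\<forall>X\<in>V. \<forall>Y\<in>I. qs_le PP (qs_abs M PP X) (qs_abs M PP Y) \<longrightarrow> X \<in> I)"

definition generates_sigma :: "'a measure \<Rightarrow> 'a measure set \<Rightarrow> ('a \<Rightarrow> real) set set \<Rightarrow> bool" where
  "generates_sigma M PP H \<longleftrightarrow>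
     sigma_sets (space M) {f -` B \<inter> space M | f B.
       f \<in> borel_measurable M \<and> qs_class M PP f \<in> H \<and> B \<in> sets borel} = sets M"


subsection \<open>Order completeness of a set \<open>V\<close> ordered by \<open>le\<close>\<close>

definition is_lub_in :: "'b set \<Rightarrow> ('b \<Rightarrow> 'b \<Rightarrow> bool) \<Rightarrow> 'b set \<Rightarrow> 'b \<Rightarrow> bool" where
  "is_lub_in V le A s \<longleftrightarrow> s \<in> V \<and> (\<forall>a\<in>A. le a s) \<and> (\<forall>u\<in>V. (\<forall>a\<in>A. le a u) \<longrightarrow> le s u)"

text \<open>
  As usual for vector lattices, only nonempty sets are considered: a supremum of the empty set
  would be a least element.
\<close>

definition dedekind_sigma_complete :: "'b set \<Rightarrow> ('b \<Rightarrow> 'b \<Rightarrow> bool) \<Rightarrow> bool" where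
  "dedekind_sigma_complete V le \<longleftrightarrow>
     (\<forall>A. A \<subseteq> V \<and> A \<noteq> {} \<and> countable A \<and> (\<exists>u\<in>V. \<forall>a\<in>A. le a u) \<longrightarrow> (\<exists>s. is_lub_in V le A s))"

definition dedekind_complete :: "'b set \<Rightarrow> ('b \<Rightarrow> 'b \<Rightarrow> bool) \<Rightarrow> bool" where
  "dedekind_complete V le \<longleftrightarrow>
     (\<forall>A. A \<subseteq> V \<and> A \<noteq> {} \<and> (\<exists>u\<in>V. \<forall>a\<in>A. le a u) \<longrightarrow> (\<exists>s. is_lub_in V le A s))"

definition super_dedekind_complete :: "'b set \<Rightarrow> ('b \<Rightarrow> 'b \<Rightarrow> bool) \<Rightarrow> bool" where
  "super_dedekind_complete V le \<longleftrightarrow> dedekind_complete V le \<and>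
     (\<forall>A s. A \<subseteq> V \<and> A \<noteq> {} \<and> is_lub_in V le A s \<longrightarrow>
        (\<exists>B\<subseteq>A. B \<noteq> {} \<and> countable B \<and> is_lub_in V le B s))"


subsection \<open>Normed spaces of classes, their duals and weak topologies\<close>

definition norm_topology :: "'a measure \<Rightarrow> 'a measure set \<Rightarrow> ('a \<Rightarrow> real) set set \<Rightarrow>
    (('a \<Rightarrow> real) set \<Rightarrow> ennreal) \<Rightarrow> ('a \<Rightarrow> real) set topology" where
  "norm_topology M PP V nrm = Metric_space.mtopology V (\<lambda>X Y. enn2real (nrm (qs_diff M PP X Y)))"

text \<open>Functionals are normalised to be extensional, so that equality is equality on \<open>V\<close>.\<close>

definition norm_dual :: "'a measure \<Rightarrow> 'a measure set \<Rightarrow> ('a \<Rightarrow> real) set set \<Rightarrow>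
    (('a \<Rightarrow> real) set \<Rightarrow> ennreal) \<Rightarrow> (('a \<Rightarrow> real) set \<Rightarrow> real) set" where
  "norm_dual M PP V nrm = {l \<in> extensional V.
     (\<forall>X\<in>V. \<forall>Y\<in>V. l (qs_add M PP X Y) = l X + l Y) \<and>
     (\<forall>c. \<forall>X\<in>V. l (qs_scale M PP c X) = c * l X) \<and>
     continuous_map (norm_topology M PP V nrm) euclideanreal l}"

definition dual_norm :: "('a \<Rightarrow> real) set set \<Rightarrow> (('a \<Rightarrow> real) set \<Rightarrow> ennreal) \<Rightarrow>
    (('a \<Rightarrow> real) set \<Rightarrow> real) \<Rightarrow> ennreal" where
  "dual_norm V nrm l = (SUP X\<in>{X \<in> V. nrm X \<le> 1}. ennreal \<bar>l X\<bar>)"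

definition weak_topology :: "'a measure \<Rightarrow> 'a measure set \<Rightarrow> ('a \<Rightarrow> real) set set \<Rightarrow>
    (('a \<Rightarrow> real) set \<Rightarrow> ennreal) \<Rightarrow> ('a \<Rightarrow> real) set topology" where
  "weak_topology M PP V nrm =
     topology_generated_by {{X \<in> V. l X \<in> U} | l U. l \<in> norm_dual M PP V nrm \<and> open U}"


subsection \<open>The space \<open>L\<^sup>1(Q)\<close>\<close>

definition L1_norm :: "'a measure \<Rightarrow> ('a \<Rightarrow> real) set \<Rightarrow> ennreal" where
  "L1_norm Q X = (\<integral>\<^sup>+x. ennreal \<bar>rep X x\<bar> \<partial>Q)"

definition L1 :: "'a measure \<Rightarrow> 'a measure \<Rightarrow> ('a \<Rightarrow> real) set set" where
  "L1 M Q = {X \<in> L0 M {Q}. L1_norm Q X < \<infinity>}"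

definition weakly_compact_L1 :: "'a measure \<Rightarrow> 'a measure \<Rightarrow> ('a \<Rightarrow> real) set set \<Rightarrow> bool" where
  "weakly_compact_L1 M Q S \<longleftrightarrow> compactin (weak_topology M {Q} (L1 M Q) (L1_norm Q)) S"

definition uniformly_integrable :: "'a measure \<Rightarrow> 'a measure \<Rightarrow> ('a \<Rightarrow> real) set set \<Rightarrow> bool" where
  "uniformly_integrable M Q S \<longleftrightarrow> S \<subseteq> L1 M Q \<and>
     ((\<lambda>c. SUP X\<in>S. \<integral>\<^sup>+x. ennreal (\<bar>rep X x\<bar> * indicat_real {c<..} \<bar>rep X x\<bar>) \<partial>Q) \<longlongrightarrow> 0) at_top"


subsection \<open>Robust Orlicz spaces\<close>

definition orlicz_function :: "(real \<Rightarrow> ennreal) \<Rightarrow> bool" where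
  "orlicz_function \<phi> \<longleftrightarrow>
     (\<forall>x\<ge>0. \<phi> x \<le> Liminf (at x within {0..}) \<phi>) \<and>
     mono_on {0..} \<phi> \<and>
     (\<forall>x\<ge>0. \<forall>y\<ge>0. \<forall>u\<ge>0. \<forall>v\<ge>0. u + v = 1 \<longrightarrow>
        \<phi> (u * x + v * y) \<le> ennreal u * \<phi> x + ennreal v * \<phi> y) \<and>
     \<phi> 0 = 0 \<and> (\<exists>x>0. \<phi> x < \<infinity>) \<and> (\<exists>x>0. \<phi> x > 0)"

definition Phi_norm :: "'a measure set \<Rightarrow> ('a measure \<Rightarrow> real \<Rightarrow> ennreal) \<Rightarrow> ('a \<Rightarrow> real) set \<Rightarrow> ennreal" where
  "Phi_norm PP \<phi> X =
     Inf {ennreal r | r. r > 0 \<and> (SUP P\<in>PP. \<integral>\<^sup>+x. \<phi> P (\<bar>rep X x\<bar> / r) \<partial>P) \<le> 1}"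

definition L_Phi :: "'a measure \<Rightarrow> 'a measure set \<Rightarrow> ('a measure \<Rightarrow> real \<Rightarrow> ennreal) \<Rightarrow> ('a \<Rightarrow> real) set set" where
  "L_Phi M PP \<phi> = {X \<in> L0 M PP. Phi_norm PP \<phi> X < \<infinity>}"

definition Phi_topology :: "'a measure \<Rightarrow> 'a measure set \<Rightarrow> ('a measure \<Rightarrow> real \<Rightarrow> ennreal) \<Rightarrow> ('a \<Rightarrow> real) set topology" where
  "Phi_topology M PP \<phi> = norm_topology M PP (L_Phi M PP \<phi>) (Phi_norm PP \<phi>)"


subsection \<open>Signed measures\<close>

definition total_variation :: "'a measure \<Rightarrow> ('a set \<Rightarrow> real) \<Rightarrow> 'a set \<Rightarrow> ennreal" where
  "total_variation M \<mu> A =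
     (SUP D\<in>{D. finite D \<and> partition_on A D \<and> D \<subseteq> sets M}. \<Sum>B\<in>D. ennreal \<bar>\<mu> B\<bar>)"

text \<open>
  A signed measure is a set function normalised to vanish outside \<open>sets M\<close>, the convention of
  the library for \<^const>\<open>measure\<close>; so a finite measure \<open>P\<close> with \<open>sets P = sets M\<close>,
  viewed as a signed measure, is \<open>measure P\<close>.
\<close>

definition ca :: "'a measure \<Rightarrow> ('a set \<Rightarrow> real) set" where
  "ca M = {\<mu>. \<mu> {} = 0 \<and>
     (\<forall>A::nat \<Rightarrow> 'a set. range A \<subseteq> sets M \<and> disjoint_family A \<longrightarrow>
        (\<lambda>n. \<mu> (A n)) sums \<mu> (\<Union>n. A n)) \<and>
     (\<forall>A. A \<notin> sets M \<longrightarrow> \<mu> A = 0) \<and>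
     total_variation M \<mu> (space M) < \<infinity>}"

definition variation_measure :: "'a measure \<Rightarrow> ('a set \<Rightarrow> real) \<Rightarrow> 'a measure" where
  "variation_measure M \<mu> = measure_of (space M) (sets M) (total_variation M \<mu>)"

text \<open>
  Positive part in the Jordan decomposition, \<open>\<mu>\<^sup>+(A) = sup {\<mu>(B) | B \<subseteq> A}\<close>; negative values are
  cut off by \<^const>\<open>ennreal\<close>, harmlessly since \<open>B = {}\<close> is allowed.
\<close>

definition pos_part :: "'a measure \<Rightarrow> ('a set \<Rightarrow> real) \<Rightarrow> 'a measure" where
  "pos_part M \<mu> = measure_of (space M) (sets M)
     (\<lambda>A. SUP B\<in>{B \<in> sets M. B \<subseteq> A}. ennreal (\<mu> B))"

definition neg_part :: "'a measure \<Rightarrow> ('a set \<Rightarrow> real) \<Rightarrow> 'a measure" where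
  "neg_part M \<mu> = pos_part M (\<lambda>A. - \<mu> A)"

definition signed_integral :: "'a measure \<Rightarrow> ('a set \<Rightarrow> real) \<Rightarrow> ('a \<Rightarrow> real) set \<Rightarrow> real" where
  "signed_integral M \<mu> X = (\<integral>x. rep X x \<partial>pos_part M \<mu>) - (\<integral>x. rep X x \<partial>neg_part M \<mu>)"

definition abs_cont :: "'a measure \<Rightarrow> ('a set \<Rightarrow> real) set \<Rightarrow> ('a set \<Rightarrow> real) set \<Rightarrow> bool" where
  "abs_cont M QQ RR \<longleftrightarrow> (\<forall>N\<in>sets M.
     (SUP \<nu>\<in>RR. total_variation M \<nu> N) = 0 \<longrightarrow> (SUP \<mu>\<in>QQ. total_variation M \<mu> N) = 0)"

definition equiv_meas :: "'a measure \<Rightarrow> ('a set \<Rightarrow> real) set \<Rightarrow> ('a set \<Rightarrow> real) set \<Rightarrow> bool" where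
  "equiv_meas M QQ RR \<longleftrightarrow> abs_cont M QQ RR \<and> abs_cont M RR QQ"

definition ca_qs :: "'a measure \<Rightarrow> 'a measure set \<Rightarrow> ('a set \<Rightarrow> real) set" where
  "ca_qs M PP = {\<mu> \<in> ca M. abs_cont M {\<mu>} (measure ` PP)}"

definition ca_on :: "'a measure \<Rightarrow> 'a measure set \<Rightarrow> ('a measure \<Rightarrow> real \<Rightarrow> ennreal) \<Rightarrow>
    ('a \<Rightarrow> real) set set \<Rightarrow> ('a set \<Rightarrow> real) set" where
  "ca_on M PP \<phi> V = {\<mu> \<in> ca_qs M PP.
     (\<forall>X\<in>V. integrable (variation_measure M \<mu>) (rep X)) \<and>
     continuous_map (subtopology (Phi_topology M PP \<phi>) V) euclideanreal
       (\<lambda>X. \<integral>x. rep X x \<partial>variation_measure M \<mu>)}"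

definition ca_prob :: "'a measure \<Rightarrow> 'a measure set \<Rightarrow> ('a measure \<Rightarrow> real \<Rightarrow> ennreal) \<Rightarrow> 'a measure set" where
  "ca_prob M PP \<phi> = {Q. prob_space Q \<and> sets Q = sets M \<and> measure Q \<in> ca_on M PP \<phi> (L_Phi M PP \<phi>)}"

definition qs_proj :: "'a measure \<Rightarrow> 'a measure \<Rightarrow> ('a \<Rightarrow> real) set \<Rightarrow> ('a \<Rightarrow> real) set" where
  "qs_proj M Q X = qs_class M {Q} (rep X)"

text \<open>
  The set of all versions of the Radon-Nikodym density is itself an element of \<open>L1 M Q\<close>;
  it is empty (hence not such an element) if no density exists.
\<close>

definition RN_class :: "'a measure \<Rightarrow> 'a measure \<Rightarrow> ('a set \<Rightarrow> real) \<Rightarrow> ('a \<Rightarrow> real) set" where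
  "RN_class M Q \<mu> = {h \<in> borel_measurable M. integrable Q h \<and>
     (\<forall>A\<in>sets M. \<mu> A = (LINT x:A|Q. h x))}"

definition ca_functional :: "'a measure \<Rightarrow> ('a \<Rightarrow> real) set set \<Rightarrow> ('a set \<Rightarrow> real) \<Rightarrow> ('a \<Rightarrow> real) set \<Rightarrow> real" where
  "ca_functional M V \<mu> = restrict (signed_integral M \<mu>) V"

definition ca_ball :: "'a measure \<Rightarrow> 'a measure set \<Rightarrow> ('a measure \<Rightarrow> real \<Rightarrow> ennreal) \<Rightarrow>
    ('a \<Rightarrow> real) set set \<Rightarrow> ('a set \<Rightarrow> real) set" where
  "ca_ball M PP \<phi> V = {\<mu> \<in> ca_on M PP \<phi> V. dual_norm V (Phi_norm PP \<phi>) (ca_functional M V \<mu>) \<le> 1}"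

end

theory Submission
  imports Defs
begin

text \<open>
  If \<open>C\<close> is \<open>\<sigma>\<close>-complete and separable, then increasing order bounded sequences in \<open>C\<close> are norm
  Cauchy, since otherwise the suprema of partial sums of increments over a chain of subsets of the
  naturals of the size of the continuum would be uniformly separated. By the Fatou property of the
  norm they converge to their pointwise limits. Hence the sets whose indicator lies in \<open>C\<close> form a
  \<open>\<sigma>\<close>-algebra, which contains all \<open>{f > a}\<close> with \<open>f\<close> in \<open>H\<close>, because their indicators are the limits of
  \<open>min 1 (n (f - a)\<^sup>+)\<close>; so \<open>C\<close> is the closure of \<open>L\<^sup>\<infinity>\<close>. That closure is an ideal, by truncation,
  and ideals are \<open>\<sigma>\<close>-complete. The norm on \<open>C\<close> being order continuous, functionals on \<open>C\<close> are
  signed measures. The map from functionals to densities is continuous from the pointwise topology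
  to the weak topology of \<open>L\<^sup>1(P\<^sup>*)\<close>, as bounded functions belong to \<open>C\<close>, so it maps the dual unit
  ball, which is compact, onto a weakly compact set.

  Conversely, if the dual consists of measures whose densities in the unit ball form a weakly compact
  set, Dini's theorem on this set and the Hahn-Banach theorem show that bounded increasing sequences
  in \<open>C\<close> are norm Cauchy, so that \<open>C\<close> contains \<open>L\<^sup>\<infinity>\<close> as before; a functional that vanishes on
  \<open>L\<^sup>\<infinity>\<close> is given by the zero measure, so \<open>L\<^sup>\<infinity>\<close> is dense in \<open>C\<close>.

  For (7), convexity gives \<open>P(A) \<le> \<kappa> \<parallel>1\<^sub>A\<parallel>\<close> uniformly in \<open>P\<close>, and the norms of indicators of sets
  decreasing to the empty set tend to zero.
\<close>

section \<open>Signed measures\<close>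

lemma ennreal_sum_le: "ennreal (\<Sum>i\<in>I. f i) \<le> (\<Sum>i\<in>I. ennreal (f i))"
proof (induction I rule: infinite_finite_induct)
  case (insert i I)
  have "ennreal (f i + sum f I) \<le> ennreal (f i) + ennreal (sum f I)"
    by (metis ennreal_leI ennreal_neg ennreal_plus linorder_le_cases add.right_neutral add.left_neutral
        add_mono_thms_linordered_semiring(1) order_refl ennreal_0 zero_le)
  with insert show ?case
    by (simp add: add_left_mono order_trans)
qed auto

locale signed_measure =
  fixes M :: "'a measure" and \<mu> :: "'a set \<Rightarrow> real"
  assumes in_ca: "\<mu> \<in> ca M"
begin

lemma empty [simp]: "\<mu> {} = 0"
  using in_ca by (simp add: ca_def)

lemma outside: "A \<notin> sets M \<Longrightarrow> \<mu> A = 0"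
  using in_ca by (simp add: ca_def)

lemma sums_Union: "range A \<subseteq> sets M \<Longrightarrow> disjoint_family A \<Longrightarrow> (\<lambda>n. \<mu> (A n)) sums \<mu> (\<Union>n. A n)"
  for A :: "nat \<Rightarrow> 'a set"
  using in_ca by (simp add: ca_def)

lemma TV_finite: "total_variation M \<mu> (space M) < \<infinity>"
  using in_ca by (simp add: ca_def)

lemma Un_disjoint:
  assumes "A \<in> sets M" "B \<in> sets M" "A \<inter> B = {}"
  shows "\<mu> (A \<union> B) = \<mu> A + \<mu> B"
proof -
  have "(\<lambda>n. \<mu> (binaryset A B n)) sums \<mu> (\<Union>n. binaryset A B n)"
    using assms by (intro sums_Union) (auto simp: range_binaryset_eq disjoint_family_on_def binaryset_def)
  moreover have "(\<lambda>n. \<mu> (binaryset A B n)) sums (\<mu> A + \<mu> B)"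
    by (rule binaryset_sums) simp
  ultimately show ?thesis
    by (simp add: UN_binaryset_eq sums_unique2)
qed

lemma Diff_eq: "A \<in> sets M \<Longrightarrow> B \<in> sets M \<Longrightarrow> B \<subseteq> A \<Longrightarrow> \<mu> (A - B) = \<mu> A - \<mu> B"
  using Un_disjoint[of B "A - B"] by (simp add: Un_absorb1 sets.Diff)

lemma abs_le_TV_space:
  assumes A: "A \<in> sets M"
  shows "ennreal \<bar>\<mu> A\<bar> \<le> total_variation M \<mu> (space M)"
proof -
  define D where "D = {A, space M - A} - {{}}"
  have D: "finite D \<and> partition_on (space M) D \<and> D \<subseteq> sets M"
    using A sets.sets_into_space[OF A] by (auto simp: D_def partition_on_def disjoint_def)
  have "ennreal \<bar>\<mu> A\<bar> \<le> (\<Sum>B\<in>D. ennreal \<bar>\<mu> B\<bar>)"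
  proof (cases "A = {}")
    case False
    then show ?thesis
      using D by (intro member_le_sum) (auto simp: D_def)
  qed simp
  also have "\<dots> \<le> total_variation M \<mu> (space M)"
    unfolding total_variation_def by (rule SUP_upper) (use D in auto)
  finally show ?thesis .
qed

lemma abs_le: "\<bar>\<mu> A\<bar> \<le> enn2real (total_variation M \<mu> (space M))"
proof (cases "A \<in> sets M")
  case True
  show ?thesis
    using enn2real_mono[OF abs_le_TV_space[OF True]] TV_finite by simp
qed (simp add: outside)

definition pos :: "'a set \<Rightarrow> real" where
  "pos A = (SUP B\<in>{B \<in> sets M. B \<subseteq> A}. \<mu> B)"

lemma pos_upper: "B \<in> sets M \<Longrightarrow> B \<subseteq> A \<Longrightarrow> \<mu> B \<le> pos A"
  unfolding pos_def using abs_le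
  by (intro cSUP_upper) (auto intro!: bdd_aboveI[where M = "enn2real (total_variation M \<mu> (space M))"] dest: abs_le_D1)

lemma pos_least: "(\<And>B. B \<in> sets M \<Longrightarrow> B \<subseteq> A \<Longrightarrow> \<mu> B \<le> c) \<Longrightarrow> pos A \<le> c"
  unfolding pos_def by (rule cSUP_least) auto

lemma pos_nonneg [simp]: "0 \<le> pos A"
  using pos_upper[of "{}" A] by simp

lemma pos_empty [simp]: "pos {} = 0"
  by (intro antisym pos_least) auto

lemma pos_mono: "A \<subseteq> B \<Longrightarrow> pos A \<le> pos B"
  by (rule pos_least) (auto intro: pos_upper)

lemma ennreal_pos: "(SUP B\<in>{B \<in> sets M. B \<subseteq> A}. ennreal (\<mu> B)) = ennreal (pos A)" (is "?S = _")
proof (rule antisym)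
  show "?S \<le> ennreal (pos A)"
    by (rule SUP_least) (auto intro: ennreal_leI pos_upper)
  show "ennreal (pos A) \<le> ?S"
  proof (cases "?S = \<top>")
    case False
    then have lt: "?S < \<top>"
      using top.not_eq_extremum by blast
    have "pos A \<le> enn2real ?S"
    proof (rule pos_least)
      fix B assume "B \<in> sets M" "B \<subseteq> A"
      then have "ennreal (\<mu> B) \<le> ?S"
        by (intro SUP_upper) auto
      then have "enn2real (ennreal (\<mu> B)) \<le> enn2real ?S"
        using lt by (rule enn2real_mono)
      moreover have "\<mu> B \<le> enn2real (ennreal (\<mu> B))"
        by (cases "0 \<le> \<mu> B") (auto simp: ennreal_neg)
      ultimately show "\<mu> B \<le> enn2real ?S" by linarith
    qed
    then have "ennreal (pos A) \<le> ennreal (enn2real ?S)" by (rule ennreal_leI)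
    then show ?thesis
      using lt by (simp only: ennreal_enn2real)
  qed (simp only: top_greatest)
qed

lemma pos_superadd:
  assumes "A \<in> sets M" "B \<in> sets M" "A \<inter> B = {}"
  shows "pos A + pos B \<le> pos (A \<union> B)"
proof -
  have "pos A \<le> pos (A \<union> B) - \<mu> D" if D: "D \<in> sets M" "D \<subseteq> B" for D
  proof (rule pos_least)
    fix C assume C: "C \<in> sets M" "C \<subseteq> A"
    have "\<mu> (C \<union> D) \<le> pos (A \<union> B)"
      using C D by (intro pos_upper) auto
    moreover have "\<mu> (C \<union> D) = \<mu> C + \<mu> D"
      using C D assms by (intro Un_disjoint) auto
    ultimately show "\<mu> C \<le> pos (A \<union> B) - \<mu> D" by simp
  qed
  then have "pos B \<le> pos (A \<union> B) - pos A"
    by (intro pos_least) (simp add: le_diff_eq add.commute)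
  then show ?thesis by simp
qed

lemma pos_countably_additive: "countably_additive (sets M) (\<lambda>A. ennreal (pos A))"
proof (rule countably_additiveI)
  fix A :: "nat \<Rightarrow> 'a set"
  assume A: "range A \<subseteq> sets M" "disjoint_family A"
  then have [measurable]: "A i \<in> sets M" for i by auto
  show "(\<Sum>i. ennreal (pos (A i))) = ennreal (pos (\<Union>i. A i))"
  proof (rule antisym)
    have le: "(\<Sum>i<n. pos (A i)) \<le> pos (\<Union>i<n. A i)" for n
    proof (induction n)
      case (Suc n)
      have "(\<Union>i<n. A i) \<inter> A n = {}"
        using A by (auto simp: disjoint_family_on_def) (metis disjoint_iff less_irrefl)
      then have "pos (\<Union>i<n. A i) + pos (A n) \<le> pos ((\<Union>i<n. A i) \<union> A n)"
        by (intro pos_superadd) auto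
      then show ?case using Suc by (simp add: lessThan_Suc Un_commute)
    qed simp
    show "(\<Sum>i. ennreal (pos (A i))) \<le> ennreal (pos (\<Union>i. A i))"
      unfolding suminf_eq_SUP
    proof (rule SUP_least)
      fix n
      have "(\<Sum>i<n. pos (A i)) \<le> pos (\<Union>i. A i)"
        by (rule order_trans[OF le pos_mono]) auto
      then show "(\<Sum>i<n. ennreal (pos (A i))) \<le> ennreal (pos (\<Union>i. A i))"
        by (simp add: ennreal_leI)
    qed
    show "ennreal (pos (\<Union>i. A i)) \<le> (\<Sum>i. ennreal (pos (A i)))"
      unfolding ennreal_pos[symmetric, of "\<Union>i. A i"]
    proof (rule SUP_least)
      fix B assume "B \<in> {B \<in> sets M. B \<subseteq> (\<Union>i. A i)}"
      then have [measurable]: "B \<in> sets M" and B: "B = (\<Union>i. B \<inter> A i)" by auto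
      have "(\<lambda>i. \<mu> (B \<inter> A i)) sums \<mu> (\<Union>i. B \<inter> A i)"
        using A by (intro sums_Union) (auto simp: disjoint_family_on_def)
      then have lim: "(\<lambda>n. ennreal (\<Sum>i<n. \<mu> (B \<inter> A i))) \<longlonglongrightarrow> ennreal (\<mu> B)"
        using B by (simp add: sums_def tendsto_ennrealI)
      show "ennreal (\<mu> B) \<le> (\<Sum>i. ennreal (pos (A i)))"
      proof (rule LIMSEQ_le_const2[OF lim], intro exI allI impI)
        fix n
        have "ennreal (\<Sum>i<n. \<mu> (B \<inter> A i)) \<le> (\<Sum>i<n. ennreal (\<mu> (B \<inter> A i)))"
          by (rule ennreal_sum_le)
        also have "\<dots> \<le> (\<Sum>i<n. ennreal (pos (A i)))"
          by (intro sum_mono ennreal_leI pos_upper) auto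
        also have "\<dots> \<le> (\<Sum>i. ennreal (pos (A i)))"
          unfolding suminf_eq_SUP by (rule SUP_upper) simp
        finally show "ennreal (\<Sum>i<n. \<mu> (B \<inter> A i)) \<le> (\<Sum>i. ennreal (pos (A i)))" .
      qed
    qed
  qed
qed

lemma sets_pos_part [simp, measurable_cong]: "sets (pos_part M \<mu>) = sets M"
  by (simp add: pos_part_def)

lemma space_pos_part [simp]: "space (pos_part M \<mu>) = space M"
  by (simp add: pos_part_def space_measure_of_conv)

lemma emeasure_pos_part: "A \<in> sets M \<Longrightarrow> emeasure (pos_part M \<mu>) A = ennreal (pos A)"
  unfolding pos_part_def ennreal_pos
  by (rule emeasure_measure_of_sigma)
    (auto intro: pos_countably_additive sets.sigma_algebra_axioms simp: positive_def)

lemma finite_pos_part: "finite_measure (pos_part M \<mu>)"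
  by (rule finite_measureI) (simp add: emeasure_pos_part)

lemma measure_pos_part: "A \<in> sets M \<Longrightarrow> measure (pos_part M \<mu>) A = pos A"
  by (simp add: measure_def emeasure_pos_part)

lemma neg_in_ca: "(\<lambda>A. - \<mu> A) \<in> ca M"
  using in_ca by (auto simp: ca_def total_variation_def intro: sums_minus)

end

context signed_measure
begin

interpretation minus: signed_measure M "\<lambda>A. - \<mu> A"
  by unfold_locales (rule neg_in_ca)

lemma minus_pos: "A \<in> sets M \<Longrightarrow> minus.pos A = pos A - \<mu> A"
proof (rule antisym)
  assume A: "A \<in> sets M"
  show "minus.pos A \<le> pos A - \<mu> A"
  proof (rule minus.pos_least)
    fix B assume B: "B \<in> sets M" "B \<subseteq> A"
    then show "- \<mu> B \<le> pos A - \<mu> A"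
      using pos_upper[of "A - B" A] A by (simp add: Diff_eq)
  qed
  have "pos A \<le> minus.pos A + \<mu> A"
  proof (rule pos_least)
    fix B assume B: "B \<in> sets M" "B \<subseteq> A"
    then show "\<mu> B \<le> minus.pos A + \<mu> A"
      using minus.pos_upper[of "A - B" A] A by (simp add: Diff_eq)
  qed
  then show "pos A - \<mu> A \<le> minus.pos A" by simp
qed

lemma Hahn:
  obtains D where "D \<in> sets M" "\<And>A. A \<in> sets M \<Longrightarrow> pos A = \<mu> (A \<inter> D)"
    "\<And>A. A \<in> sets M \<Longrightarrow> minus.pos A = - \<mu> (A - D)"
proof -
  obtain D where D: "D \<in> sets M"
    and 1: "\<And>X. X \<in> sets M \<Longrightarrow> X \<subseteq> D \<Longrightarrow> emeasure (neg_part M \<mu>) X \<le> emeasure (pos_part M \<mu>) X"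
    and 2: "\<And>X. X \<in> sets M \<Longrightarrow> X \<inter> D = {} \<Longrightarrow> emeasure (pos_part M \<mu>) X \<le> emeasure (neg_part M \<mu>) X"
    using finite_unsigned_Hahn_decomposition[OF finite_pos_part minus.finite_pos_part]
    by (auto simp: neg_part_def)
  have ge: "0 \<le> \<mu> X" if "X \<in> sets M" "X \<subseteq> D" for X
    using 1[OF that] that
    by (simp add: neg_part_def emeasure_pos_part minus.emeasure_pos_part minus_pos)
  have le: "\<mu> X \<le> 0" if "X \<in> sets M" "X \<inter> D = {}" for X
    using 2[OF that] that minus.pos_nonneg[of X]
    by (simp add: neg_part_def emeasure_pos_part minus.emeasure_pos_part minus_pos ennreal_le_iff
      del: minus.pos_nonneg)
  have pos: "pos A = \<mu> (A \<inter> D)" if A: "A \<in> sets M" for A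
  proof (rule antisym[OF pos_least])
    fix B assume B: "B \<in> sets M" "B \<subseteq> A"
    have "\<mu> B = \<mu> (B \<inter> D) + \<mu> (B - D)"
      using B D Un_disjoint[of "B \<inter> D" "B - D"] by (auto simp: Int_Diff_Un)
    moreover have "\<mu> (B - D) \<le> 0" using B D by (intro le) auto
    moreover have "0 \<le> \<mu> (A \<inter> D - B \<inter> D)" using A B D by (intro ge) auto
    moreover have "\<mu> (A \<inter> D - B \<inter> D) = \<mu> (A \<inter> D) - \<mu> (B \<inter> D)"
      using A B D by (intro Diff_eq) auto
    ultimately show "\<mu> B \<le> \<mu> (A \<inter> D)" by linarith
  next
    show "\<mu> (A \<inter> D) \<le> pos A" using A D by (intro pos_upper) auto
  qed
  have "minus.pos A = - \<mu> (A - D)" if A: "A \<in> sets M" for A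
    using A D pos[OF A] Un_disjoint[of "A \<inter> D" "A - D"] by (simp add: minus_pos Int_Diff_Un Int_Diff_disjoint)
  with D pos show thesis by (rule that)
qed

lemma total_variation_eq:
  assumes A: "A \<in> sets M"
  shows "total_variation M \<mu> A = ennreal (pos A + minus.pos A)"
proof (rule antisym)
  interpret p: finite_measure "pos_part M \<mu>" by (rule finite_pos_part)
  interpret n: finite_measure "pos_part M (\<lambda>A. - \<mu> A)" by (rule minus.finite_pos_part)
  show "total_variation M \<mu> A \<le> ennreal (pos A + minus.pos A)"
    unfolding total_variation_def
  proof (rule SUP_least)
    fix D assume "D \<in> {D. finite D \<and> partition_on A D \<and> D \<subseteq> sets M}"
    then have D: "finite D" "\<Union>D = A" "disjoint D" "D \<subseteq> sets M"
      by (auto simp: partition_on_def)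
    have dj: "disjoint_family_on (\<lambda>x. x) D"
      using D(3) by (auto simp: disjoint_def disjoint_family_on_def)
    have "(\<Sum>B\<in>D. ennreal \<bar>\<mu> B\<bar>) \<le> (\<Sum>B\<in>D. ennreal (pos B + minus.pos B))"
    proof (intro sum_mono ennreal_leI)
      fix B assume "B \<in> D"
      then have "\<mu> B = pos B - minus.pos B" using D by (auto simp: minus_pos)
      then show "\<bar>\<mu> B\<bar> \<le> pos B + minus.pos B"
        using pos_nonneg[of B] minus.pos_nonneg[of B] by linarith
    qed
    also have "\<dots> = ennreal ((\<Sum>B\<in>D. pos B) + (\<Sum>B\<in>D. minus.pos B))"
      by (subst sum_ennreal) (auto simp: sum.distrib intro: add_nonneg_nonneg)
    also have "(\<Sum>B\<in>D. pos B) = pos A"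
      using p.finite_measure_finite_Union[OF D(1) _ dj] D A
      by (auto simp: measure_pos_part subset_eq intro: sum.cong)
    also have "(\<Sum>B\<in>D. minus.pos B) = minus.pos A"
      using n.finite_measure_finite_Union[OF D(1) _ dj] D A
      by (auto simp: minus.measure_pos_part subset_eq intro: sum.cong)
    finally show "(\<Sum>B\<in>D. ennreal \<bar>\<mu> B\<bar>) \<le> ennreal (pos A + minus.pos A)" .
  qed
  obtain E where E: "E \<in> sets M" "pos A = \<mu> (A \<inter> E)" "minus.pos A = - \<mu> (A - E)"
    using Hahn A by metis
  define D where "D = {A \<inter> E, A - E} - {{}}"
  have D: "finite D \<and> partition_on A D \<and> D \<subseteq> sets M"
    using A E by (auto simp: D_def partition_on_def disjoint_def)
  have "pos A + minus.pos A \<le> (\<Sum>B\<in>D. \<bar>\<mu> B\<bar>)"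
  proof -
    have "(\<Sum>B\<in>D. \<bar>\<mu> B\<bar>) = (\<Sum>B\<in>{A \<inter> E, A - E}. \<bar>\<mu> B\<bar>)"
      unfolding D_def by (rule sum.mono_neutral_left) auto
    also have "\<dots> = \<bar>\<mu> (A \<inter> E)\<bar> + \<bar>\<mu> (A - E)\<bar>"
    proof (cases "A \<inter> E = A - E")
      case True
      then have "A = {}" by auto
      then show ?thesis by simp
    qed simp
    finally show ?thesis using E by simp
  qed
  then have "ennreal (pos A + minus.pos A) \<le> (\<Sum>B\<in>D. ennreal \<bar>\<mu> B\<bar>)"
    by (subst sum_ennreal) (auto intro: ennreal_leI simp del: ennreal_plus)
  also have "\<dots> \<le> total_variation M \<mu> A"
    unfolding total_variation_def by (rule SUP_upper) (use D in auto)
  finally show "ennreal (pos A + minus.pos A) \<le> total_variation M \<mu> A" .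
qed

abbreviation V :: "'a measure" where "V \<equiv> variation_measure M \<mu>"

lemma sets_V [simp, measurable_cong]: "sets V = sets M"
  by (simp add: variation_measure_def)

lemma space_V [simp]: "space V = space M"
  by (simp add: variation_measure_def space_measure_of_conv)

lemma emeasure_V:
  assumes "A \<in> sets M"
  shows "emeasure V A = total_variation M \<mu> A"
  unfolding variation_measure_def
proof (rule emeasure_measure_of_sigma[OF _ _ _ assms])
  show "sigma_algebra (space M) (sets M)" by (rule sets.sigma_algebra_axioms)
  show "positive (sets M) (total_variation M \<mu>)"
    by (simp add: positive_def total_variation_eq)
  show "countably_additive (sets M) (total_variation M \<mu>)"
  proof (rule countably_additiveI)
    fix A :: "nat \<Rightarrow> 'a set"
    assume A: "range A \<subseteq> sets M" "disjoint_family A"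
    then have [simp]: "A i \<in> sets M" "(\<Union>i. A i) \<in> sets M" for i by auto
    have p: "(\<Sum>i. ennreal (pos (A i))) = ennreal (pos (\<Union>i. A i))"
      using A pos_countably_additive unfolding countably_additive_def by (metis \<open>(\<Union>i. A i) \<in> sets M\<close>)
    have n: "(\<Sum>i. ennreal (minus.pos (A i))) = ennreal (minus.pos (\<Union>i. A i))"
      using A minus.pos_countably_additive unfolding countably_additive_def by (metis \<open>(\<Union>i. A i) \<in> sets M\<close>)
    have "(\<Sum>i. total_variation M \<mu> (A i)) = (\<Sum>i. ennreal (pos (A i)) + ennreal (minus.pos (A i)))"
      by (simp add: total_variation_eq)
    also have "\<dots> = (\<Sum>i. ennreal (pos (A i))) + (\<Sum>i. ennreal (minus.pos (A i)))"
      by (rule suminf_add[symmetric]) auto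
    also have "\<dots> = ennreal (pos (\<Union>i. A i)) + ennreal (minus.pos (\<Union>i. A i))"
      by (simp only: p n)
    finally show "(\<Sum>i. total_variation M \<mu> (A i)) = total_variation M \<mu> (\<Union>i. A i)"
      by (simp add: total_variation_eq)
  qed
qed

lemma finite_V: "finite_measure V"
  using TV_finite by (intro finite_measureI) (simp add: emeasure_V)

lemma pos_part_density:
  obtains D where "D \<in> sets M" "pos_part M \<mu> = density V (indicator D)"
    "neg_part M \<mu> = density V (indicator (space M - D))"
proof -
  obtain D where D: "D \<in> sets M" "\<And>A. A \<in> sets M \<Longrightarrow> pos A = \<mu> (A \<inter> D)"
    "\<And>A. A \<in> sets M \<Longrightarrow> minus.pos A = - \<mu> (A - D)"
    by (rule Hahn) blast
  have "pos_part M \<mu> = density V (indicator D)"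
  proof (rule measure_eqI)
    fix A assume "A \<in> sets (pos_part M \<mu>)"
    then have A: "A \<in> sets M" by simp
    have [simp]: "A \<inter> D - D = {}" by auto
    have "emeasure (density V (indicator D)) A = emeasure V (D \<inter> A)"
      using A D by (intro emeasure_restricted) auto
    also have "\<dots> = ennreal (\<mu> (A \<inter> D))"
      using A D(1) D(2)[of "A \<inter> D"] D(3)[of "A \<inter> D"]
      by (simp add: emeasure_V total_variation_eq Int_commute Int_left_commute)
    finally show "emeasure (pos_part M \<mu>) A = emeasure (density V (indicator D)) A"
      using A D by (simp add: emeasure_pos_part)
  qed simp
  moreover have "neg_part M \<mu> = density V (indicator (space M - D))"
  proof (rule measure_eqI)
    fix A assume "A \<in> sets (neg_part M \<mu>)"
    then have A: "A \<in> sets M" by (simp add: neg_part_def)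
    then have [simp]: "(space M - D) \<inter> A = A - D" "(A - D) \<inter> D = {}" "A - D - D = A - D"
      using sets.sets_into_space[OF A] by auto
    have "emeasure (density V (indicator (space M - D))) A = emeasure V ((space M - D) \<inter> A)"
      using A D by (intro emeasure_restricted) auto
    also have "\<dots> = ennreal (- \<mu> (A - D))"
      using A D(1) D(2)[of "A - D"] D(3)[of "A - D"]
      by (simp add: emeasure_V total_variation_eq)
    finally show "emeasure (neg_part M \<mu>) A = emeasure (density V (indicator (space M - D))) A"
      using A D by (simp add: neg_part_def minus.emeasure_pos_part)
  qed (simp add: neg_part_def)
  ultimately show thesis using D(1) by (intro that)
qed

lemma density_obtains:
  assumes "finite_measure Q" and sets_Q [simp, measurable_cong]: "sets Q = sets M"
    and ac: "\<And>N. N \<in> sets M \<Longrightarrow> emeasure Q N = 0 \<Longrightarrow> total_variation M \<mu> N = 0"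
  obtains h where "h \<in> borel_measurable M" "integrable Q h" "\<And>A. A \<in> sets M \<Longrightarrow> \<mu> A = (LINT x:A|Q. h x)"
    "\<And>f. f \<in> borel_measurable M \<Longrightarrow> integrable V f \<Longrightarrow> integrable Q (\<lambda>x. f x * h x) \<and>
       (\<integral>x. f x \<partial>pos_part M \<mu>) - (\<integral>x. f x \<partial>neg_part M \<mu>) = (\<integral>x. f x * h x \<partial>Q)"
proof -
  interpret Q: finite_measure Q by fact
  interpret V: finite_measure V by (rule finite_V)
  have "absolutely_continuous Q V"
    using ac by (auto simp: absolutely_continuous_def null_sets_def emeasure_V)
  then obtain d where d: "d \<in> borel_measurable Q" "\<And>x. 0 \<le> d x"
    and dV: "AE x in Q. RN_deriv Q V x = ennreal (d x)"
    by (rule Q.real_RN_deriv[OF finite_V]) auto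
  have V_eq: "V = density Q (\<lambda>x. ennreal (d x))"
  proof -
    have "V = density Q (RN_deriv Q V)"
      using \<open>absolutely_continuous Q V\<close> by (simp add: Q.density_RN_deriv)
    also have "\<dots> = density Q (\<lambda>x. ennreal (d x))"
      using d dV by (intro density_cong) auto
    finally show ?thesis .
  qed
  have [measurable]: "d \<in> borel_measurable M" using d(1) by (simp add: measurable_cong_sets[OF sets_Q])
  have meas_Q: "f \<in> borel_measurable Q \<longleftrightarrow> f \<in> borel_measurable M" for f :: "'a \<Rightarrow> real"
    by (simp add: measurable_cong_sets[OF sets_Q])
  have meas_V: "f \<in> borel_measurable V \<longleftrightarrow> f \<in> borel_measurable M" for f :: "'a \<Rightarrow> real"
    by (simp add: measurable_cong_sets[OF sets_V])
  have sp: "space Q = space M" by (rule sets_eq_imp_space_eq) simp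
  obtain D where [measurable]: "D \<in> sets M" and pD: "pos_part M \<mu> = density V (indicator D)"
    and nD: "neg_part M \<mu> = density V (indicator (space M - D))"
    by (rule pos_part_density)
  define h where "h x = d x * (indicator D x - indicator (space M - D) x)" for x
  have [measurable]: "h \<in> borel_measurable M" unfolding h_def by measurable
  have integ: "integrable Q (\<lambda>x. f x * h x) \<and>
       (\<integral>x. f x \<partial>pos_part M \<mu>) - (\<integral>x. f x \<partial>neg_part M \<mu>) = (\<integral>x. f x * h x \<partial>Q)"
    if [measurable]: "f \<in> borel_measurable M" and f: "integrable V f" for f
  proof -
    have fd: "integrable Q (\<lambda>x. d x * g x)" and int_d: "(\<integral>x. g x \<partial>V) = (\<integral>x. d x * g x \<partial>Q)"
      if "g \<in> borel_measurable M" "integrable V g" for g :: "'a \<Rightarrow> real"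
    proof -
      have "integrable (density Q (\<lambda>x. ennreal (d x))) g" using that V_eq by simp
      then show "integrable Q (\<lambda>x. d x * g x)"
        using that d by (subst (asm) integrable_density) (auto simp: meas_Q)
      show "(\<integral>x. g x \<partial>V) = (\<integral>x. d x * g x \<partial>Q)"
        unfolding V_eq using that d by (subst integral_density) (auto simp: meas_Q)
    qed
    have i1: "integrable V (\<lambda>x. indicator A x * f x)" if "A \<in> sets M" for A
      using integrable_real_mult_indicator[of A V f] that f by (simp add: mult.commute)
    have part: "(\<integral>x. f x \<partial>density V (indicator A)) = (\<integral>x. d x * (indicator A x * f x) \<partial>Q)"
      if [measurable]: "A \<in> sets M" for A
    proof -
      have "(\<integral>x. f x \<partial>density V (indicator A)) = (\<integral>x. f x \<partial>density V (\<lambda>x. ennreal (indicator A x)))"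
        by (simp add: ennreal_indicator)
      also have "\<dots> = (\<integral>x. indicator A x * f x \<partial>V)"
        by (subst integral_density) (auto simp: meas_V)
      also have "\<dots> = (\<integral>x. d x * (indicator A x * f x) \<partial>Q)"
        by (rule int_d) (auto simp: i1)
      finally show ?thesis .
    qed
    have i2: "integrable Q (\<lambda>x. d x * (indicator A x * f x))" if "A \<in> sets M" for A
      using that by (intro fd i1) auto
    have eq: "f x * h x = d x * (indicator D x * f x) - d x * (indicator (space M - D) x * f x)" for x
      by (simp add: h_def algebra_simps)
    show ?thesis
      unfolding pD nD eq by (subst (1 2) part) (auto simp: i2)
  qed
  have int_h: "integrable Q h"
    using integ[THEN conjunct1, of "\<lambda>_. 1", OF _ V.integrable_const] by (simp only: mult_1_left measurable_const space_borel UNIV_I simp_thms)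
  have "\<mu> A = (LINT x:A|Q. h x)" if [measurable]: "A \<in> sets M" for A
  proof -
    have "integrable V (indicator A :: 'a \<Rightarrow> real)"
      by (intro integrable_real_indicator) (auto simp: V.emeasure_finite less_top[symmetric])
    then have "(\<integral>x. indicator A x \<partial>pos_part M \<mu>) - (\<integral>x. indicator A x \<partial>neg_part M \<mu>) = (\<integral>x. indicator A x * h x \<partial>Q)"
      using integ[of "indicator A"] by simp
    moreover have "(\<integral>x. indicator A x \<partial>pos_part M \<mu>) = pos A"
      using sets.sets_into_space[OF that] by (simp add: Int_absorb2 measure_pos_part)
    moreover have "(\<integral>x. indicator A x \<partial>neg_part M \<mu>) = minus.pos A"
      using sets.sets_into_space[OF that] by (simp add: neg_part_def Int_absorb2 minus.measure_pos_part)
    ultimately show ?thesis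
      using minus_pos[OF that] by (simp add: set_lebesgue_integral_def)
  qed
  with int_h integ show thesis
    by (intro that[of h]) auto
qed

end

lemma RN_class_eq:
  assumes sets_Q: "sets Q = sets M" and h: "h \<in> RN_class M Q \<mu>"
  shows "RN_class M Q \<mu> = qs_class M {Q} h"
proof -
  have [measurable_cong]: "sets M = sets Q" using sets_Q by simp
  have hm [measurable]: "h \<in> borel_measurable M" and hi: "integrable Q h"
    and h\<mu>: "\<And>A. A \<in> sets M \<Longrightarrow> \<mu> A = (LINT x:A|Q. h x)"
    using h by (auto simp: RN_class_def)
  have "h' \<in> RN_class M Q \<mu> \<longleftrightarrow> (AE x in Q. h x = h' x)" if [measurable]: "h' \<in> borel_measurable M" for h'
  proof
    assume "h' \<in> RN_class M Q \<mu>"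
    then have h': "integrable Q h'" "\<And>A. A \<in> sets M \<Longrightarrow> \<mu> A = (LINT x:A|Q. h' x)"
      unfolding RN_class_def by blast+
    show "AE x in Q. h x = h' x"
    proof (rule density_unique_real[OF hi h'(1)])
      fix A assume "A \<in> sets Q"
      then have "A \<in> sets M" using sets_Q by blast
      then show "(LINT x:A|Q. h x) = (LINT x:A|Q. h' x)"
        using h\<mu> h'(2) by metis
    qed
  next
    assume ae: "AE x in Q. h x = h' x"
    have "integrable Q h'"
      using hi ae by (subst integrable_cong_AE[of _ _ h]) auto
    moreover have "(LINT x:A|Q. h x) = (LINT x:A|Q. h' x)" if "A \<in> sets M" for A
      unfolding set_lebesgue_integral_def using ae that
      by (intro integral_cong_AE) auto
    ultimately show "h' \<in> RN_class M Q \<mu>"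
      using h\<mu> by (simp add: RN_class_def)
  qed
  then show ?thesis
    by (auto simp: qs_class_def qs_rel_def RN_class_def)
qed

lemma signed_integral_RN:
  assumes ca: "\<mu> \<in> ca M" and Q: "finite_measure Q" and sets_Q: "sets Q = sets M"
    and ac: "\<And>N. N \<in> sets M \<Longrightarrow> emeasure Q N = 0 \<Longrightarrow> total_variation M \<mu> N = 0"
  shows "\<exists>h. h \<in> RN_class M Q \<mu>"
    and "\<And>f h. h \<in> RN_class M Q \<mu> \<Longrightarrow> f \<in> borel_measurable M \<Longrightarrow> integrable (variation_measure M \<mu>) f \<Longrightarrow>
      integrable Q (\<lambda>x. f x * h x) \<and>
      (\<integral>x. f x \<partial>pos_part M \<mu>) - (\<integral>x. f x \<partial>neg_part M \<mu>) = (\<integral>x. f x * h x \<partial>Q)"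
proof -
  interpret signed_measure M \<mu> by unfold_locales (rule ca)
  have [measurable_cong]: "sets M = sets Q" using sets_Q by simp
  obtain h where h: "h \<in> borel_measurable M" "integrable Q h" "\<And>A. A \<in> sets M \<Longrightarrow> \<mu> A = (LINT x:A|Q. h x)"
    "\<And>f. f \<in> borel_measurable M \<Longrightarrow> integrable V f \<Longrightarrow> integrable Q (\<lambda>x. f x * h x) \<and>
       (\<integral>x. f x \<partial>pos_part M \<mu>) - (\<integral>x. f x \<partial>neg_part M \<mu>) = (\<integral>x. f x * h x \<partial>Q)"
    by (rule density_obtains[OF Q sets_Q ac]) auto
  then have hR: "h \<in> RN_class M Q \<mu>" by (auto simp: RN_class_def)
  then show "\<exists>h. h \<in> RN_class M Q \<mu>" by blast
  fix f h' :: "'a \<Rightarrow> real"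
  assume h': "h' \<in> RN_class M Q \<mu>" and f [measurable]: "f \<in> borel_measurable M"
    and i: "integrable V f"
  have [measurable]: "h \<in> borel_measurable M" "h' \<in> borel_measurable M"
    using h h' by (auto simp: RN_class_def)
  have ae: "AE x in Q. h x = h' x"
    using h' RN_class_eq[OF sets_Q hR] by (auto simp: qs_class_def qs_rel_def)
  then have ae': "AE x in Q. f x * h x = f x * h' x" by auto
  have "integrable Q (\<lambda>x. f x * h x)" "(\<integral>x. f x \<partial>pos_part M \<mu>) - (\<integral>x. f x \<partial>neg_part M \<mu>) = (\<integral>x. f x * h x \<partial>Q)"
    using h(4)[OF f i] by auto
  moreover have "integrable Q (\<lambda>x. f x * h x) = integrable Q (\<lambda>x. f x * h' x)"
    using ae' by (intro integrable_cong_AE) auto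
  moreover have "(\<integral>x. f x * h x \<partial>Q) = (\<integral>x. f x * h' x \<partial>Q)"
    using ae' by (intro integral_cong_AE) auto
  ultimately show "integrable Q (\<lambda>x. f x * h' x) \<and>
       (\<integral>x. f x \<partial>pos_part M \<mu>) - (\<integral>x. f x \<partial>neg_part M \<mu>) = (\<integral>x. f x * h' x \<partial>Q)"
    by simp
qed

context
  fixes M P :: "'a measure"
  assumes P: "finite_measure P" and sets_P: "sets P = sets M"
begin

interpretation P: finite_measure P by (rule P)

lemma measure_in_ca: "measure P \<in> ca M"
proof -
  have sp: "space P = space M" using sets_P by (rule sets_eq_imp_space_eq)
  have "total_variation M (measure P) (space M) \<le> ennreal (measure P (space M))"
    unfolding total_variation_def
  proof (rule SUP_least)
    fix D assume "D \<in> {D. finite D \<and> partition_on (space M) D \<and> D \<subseteq> sets M}"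
    then have D: "finite D" "\<Union>D = space M" "disjoint D" "D \<subseteq> sets P"
      using sets_P by (auto simp: partition_on_def)
    have "disjoint_family_on (\<lambda>x. x) D"
      using D(3) by (auto simp: disjoint_def disjoint_family_on_def)
    then have "(\<Sum>B\<in>D. measure P B) = measure P (space M)"
      using P.finite_measure_finite_Union[of D "\<lambda>x. x"] D by auto
    then show "(\<Sum>B\<in>D. ennreal \<bar>measure P B\<bar>) \<le> ennreal (measure P (space M))"
      by simp
  qed
  also have "\<dots> < \<infinity>" by simp
  finally show ?thesis
    using sets_P P.finite_measure_UNION
    by (auto simp: ca_def measure_notin_sets)
qed

lemma total_variation_measure:
  assumes A: "A \<in> sets M"
  shows "total_variation M (measure P) A = emeasure P A"
proof -
  interpret signed_measure M "measure P" by unfold_locales (rule measure_in_ca)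
  have "pos A = measure P A"
  proof (rule antisym)
    show "pos A \<le> measure P A"
      using A sets_P by (intro pos_least P.finite_measure_mono) auto
  qed (use A in \<open>auto intro: pos_upper\<close>)
  with A show ?thesis
    by (simp add: total_variation_eq minus_pos P.emeasure_eq_measure)
qed

lemma variation_measure_measure: "variation_measure M (measure P) = P"
proof -
  interpret signed_measure M "measure P" by unfold_locales (rule measure_in_ca)
  show ?thesis
    by (rule measure_eqI) (auto simp: sets_P emeasure_V total_variation_measure)
qed

end

section \<open>The Luxemburg norm on functions\<close>

lemma borel_measurable_mono_ennreal:
  fixes g :: "real \<Rightarrow> ennreal"
  assumes "mono g"
  shows "g \<in> borel_measurable borel"
proof (rule borel_measurableI_greater)
  fix y
  have "is_interval {x. y < g x}"
    unfolding is_interval_1 using assms by (auto dest: monoD less_le_trans)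
  then have "{x. y < g x} \<in> sets borel"
    by (rule real_interval_borel_measurable)
  then show "{x \<in> space borel. y < g x} \<in> sets borel" by simp
qed

locale robust_orlicz =
  fixes M :: "'a measure" and PP :: "'a measure set" and \<phi> :: "'a measure \<Rightarrow> real \<Rightarrow> ennreal"
  assumes priors: "priors M PP"
    and orlicz: "\<And>P. P \<in> PP \<Longrightarrow> orlicz_function (\<phi> P)"
begin

lemma prob_PP: "P \<in> PP \<Longrightarrow> prob_space P"
  using priors by (simp add: priors_def)

lemma sets_PP: "P \<in> PP \<Longrightarrow> sets P = sets M"
  using priors by (simp add: priors_def)

lemma space_PP: "P \<in> PP \<Longrightarrow> space P = space M"
  using sets_PP by (rule sets_eq_imp_space_eq)

lemma measurable_PP: "P \<in> PP \<Longrightarrow> borel_measurable P = borel_measurable M"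
  by (intro measurable_cong_sets sets_PP) auto

lemma AE_PP_I: "P \<in> PP \<Longrightarrow> (\<And>x. x \<in> space M \<Longrightarrow> Q x) \<Longrightarrow> AE x in P. Q x"
  by (rule AE_I2) (simp add: space_PP)

lemma phi_mono: "P \<in> PP \<Longrightarrow> 0 \<le> x \<Longrightarrow> x \<le> y \<Longrightarrow> \<phi> P x \<le> \<phi> P y"
  using orlicz[of P] by (auto simp: orlicz_function_def mono_on_def)

lemma phi_0 [simp]: "P \<in> PP \<Longrightarrow> \<phi> P 0 = 0"
  using orlicz[of P] by (auto simp: orlicz_function_def)

lemma phi_convex: "P \<in> PP \<Longrightarrow> 0 \<le> x \<Longrightarrow> 0 \<le> y \<Longrightarrow> 0 \<le> u \<Longrightarrow> 0 \<le> v \<Longrightarrow> u + v = 1 \<Longrightarrow>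
  \<phi> P (u * x + v * y) \<le> ennreal u * \<phi> P x + ennreal v * \<phi> P y"
  using orlicz[of P] by (auto simp: orlicz_function_def)

lemma phi_scale: "P \<in> PP \<Longrightarrow> 0 \<le> x \<Longrightarrow> 0 \<le> u \<Longrightarrow> u \<le> 1 \<Longrightarrow> \<phi> P (u * x) \<le> ennreal u * \<phi> P x"
  using phi_convex[of P x 0 u "1 - u"] by simp

lemma phi_lsc:
  assumes P: "P \<in> PP" and x: "0 \<le> x" and xn: "\<And>n. 0 \<le> xn n" and lim: "xn \<longlonglongrightarrow> x"
  shows "\<phi> P x \<le> liminf (\<lambda>n. \<phi> P (xn n))"
  unfolding le_Liminf_iff
proof (intro allI impI)
  fix y assume y: "y < \<phi> P x"
  have "\<phi> P x \<le> Liminf (at x within {0..}) (\<phi> P)"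
    using orlicz[OF P] x by (auto simp: orlicz_function_def)
  with y have "\<forall>\<^sub>F z in at x within {0..}. y < \<phi> P z"
    by (intro less_LiminfD) auto
  then have "\<forall>\<^sub>F z in nhds x. z \<in> {0..} \<longrightarrow> y < \<phi> P z"
    using y by (auto simp: eventually_at_filter elim: eventually_mono)
  then have "\<forall>\<^sub>F n in sequentially. xn n \<in> {0..} \<longrightarrow> y < \<phi> P (xn n)"
    using lim unfolding filterlim_iff by blast
  then show "\<forall>\<^sub>F n in sequentially. y < \<phi> P (xn n)"
    using xn by simp
qed

lemma phi_measurable:
  assumes P: "P \<in> PP" and [measurable]: "f \<in> borel_measurable M" and r: "0 \<le> r"
  shows "(\<lambda>x. \<phi> P (\<bar>f x\<bar> / r)) \<in> borel_measurable P"
proof -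
  have [measurable]: "f \<in> borel_measurable P" using measurable_PP[OF P] assms(2) by blast
  have "mono (\<lambda>y. \<phi> P (max 0 y))"
    using P by (auto intro!: monoI phi_mono)
  then have [measurable]: "(\<lambda>y. \<phi> P (max 0 y)) \<in> borel_measurable borel"
    by (rule borel_measurable_mono_ennreal)
  have "(\<lambda>x. \<phi> P (max 0 (\<bar>f x\<bar> / r))) \<in> borel_measurable P"
    by measurable
  with r show ?thesis by (simp add: max_absorb2)
qed

definition adm :: "('a \<Rightarrow> real) \<Rightarrow> real \<Rightarrow> bool" where
  "adm f r \<longleftrightarrow> 0 < r \<and> (\<forall>P\<in>PP. (\<integral>\<^sup>+x. \<phi> P (\<bar>f x\<bar> / r) \<partial>P) \<le> 1)"

definition Lux :: "('a \<Rightarrow> real) \<Rightarrow> ennreal" where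
  "Lux f = Inf {ennreal r | r. adm f r}"

definition nn :: "('a \<Rightarrow> real) \<Rightarrow> real" where
  "nn f = enn2real (Lux f)"

definition LF :: "('a \<Rightarrow> real) set" where
  "LF = {f \<in> borel_measurable M. Lux f < \<infinity>}"

definition qs :: "('a \<Rightarrow> bool) \<Rightarrow> bool" where
  "qs Q \<longleftrightarrow> (\<forall>P\<in>PP. AE x in P. Q x)"

lemma Phi_norm_eq: "Phi_norm PP \<phi> X = Lux (rep X)"
  by (simp add: Phi_norm_def Lux_def adm_def SUP_le_iff)

lemma qsI: "(\<And>x. x \<in> space M \<Longrightarrow> Q x) \<Longrightarrow> qs Q"
  by (auto simp: qs_def intro: AE_PP_I)

lemma qs_mp: "qs Q \<Longrightarrow> qs (\<lambda>x. Q x \<longrightarrow> R x) \<Longrightarrow> qs R"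
  unfolding qs_def by (blast intro: AE_mp)

lemma qs_elim: "qs Q \<Longrightarrow> (\<And>x. x \<in> space M \<Longrightarrow> Q x \<Longrightarrow> R x) \<Longrightarrow> qs R"
  by (erule qs_mp) (auto intro: qsI)

lemma qs_conj: "qs Q \<Longrightarrow> qs R \<Longrightarrow> qs (\<lambda>x. Q x \<and> R x)"
  unfolding qs_def by auto

lemma qs_all: "(\<And>n::nat. qs (Q n)) \<Longrightarrow> qs (\<lambda>x. \<forall>n. Q n x)"
  unfolding qs_def by (auto simp: AE_all_countable)

lemma adm_mono: "adm f r \<Longrightarrow> r \<le> s \<Longrightarrow> adm f s"
proof -
  assume f: "adm f r" and rs: "r \<le> s"
  have "(\<integral>\<^sup>+x. \<phi> P (\<bar>f x\<bar> / s) \<partial>P) \<le> (\<integral>\<^sup>+x. \<phi> P (\<bar>f x\<bar> / r) \<partial>P)" if "P \<in> PP" for P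
    using that f rs by (intro nn_integral_mono phi_mono) (auto simp: adm_def intro: divide_left_mono)
  with f rs show ?thesis
    unfolding adm_def by (meson less_le_trans order_trans)
qed

lemma Lux_le: "adm f r \<Longrightarrow> Lux f \<le> ennreal r"
  unfolding Lux_def by (rule Inf_lower) auto

lemma nn_nonneg [simp]: "0 \<le> nn f"
  by (simp add: nn_def)

lemma adm_Lux_less: "Lux f < ennreal c \<Longrightarrow> adm f c"
proof -
  assume "Lux f < ennreal c"
  then obtain r where r: "adm f r" "ennreal r < ennreal c"
    unfolding Lux_def by (auto simp: Inf_less_iff)
  then have "r < c" by (meson ennreal_leI linorder_not_le)
  with r show ?thesis using adm_mono by simp
qed

lemma Lux_eq_nn: "Lux f < \<infinity> \<Longrightarrow> Lux f = ennreal (nn f)"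
  by (simp add: nn_def)

lemma nn_less_adm: "Lux f < \<infinity> \<Longrightarrow> nn f < c \<Longrightarrow> adm f c"
  by (rule adm_Lux_less) (simp add: Lux_eq_nn ennreal_less_iff)

lemma adm_finite: "adm f r \<Longrightarrow> Lux f < \<infinity>"
  using Lux_le[of f r] by (simp add: le_less_trans[OF _ ennreal_less_top])

lemma adm_nn_le: "adm f r \<Longrightarrow> nn f \<le> r"
  using Lux_le[of f r] adm_finite[of f r] by (simp add: Lux_eq_nn adm_def)

lemma nn_leI:
  assumes "\<And>c. b < c \<Longrightarrow> adm f c"
  shows "Lux f < \<infinity>" "nn f \<le> b"
proof -
  show "Lux f < \<infinity>" using adm_finite[OF assms[of "b + 1"]] by simp
  show "nn f \<le> b" by (rule dense_ge) (auto intro: assms adm_nn_le)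
qed

lemma adm_le:
  assumes g: "adm g r" and le: "qs (\<lambda>x. \<bar>f x\<bar> \<le> \<bar>g x\<bar>)"
  shows "adm f r"
  unfolding adm_def
proof (intro conjI ballI)
  show "0 < r" using g by (simp add: adm_def)
  fix P assume P: "P \<in> PP"
  have "(\<integral>\<^sup>+x. \<phi> P (\<bar>f x\<bar> / r) \<partial>P) \<le> (\<integral>\<^sup>+x. \<phi> P (\<bar>g x\<bar> / r) \<partial>P)"
  proof (rule nn_integral_mono_AE)
    have "AE x in P. \<bar>f x\<bar> \<le> \<bar>g x\<bar>" using le P by (simp add: qs_def)
    then show "AE x in P. \<phi> P (\<bar>f x\<bar> / r) \<le> \<phi> P (\<bar>g x\<bar> / r)"
      using P \<open>0 < r\<close> by (auto intro!: phi_mono divide_right_mono)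
  qed
  also have "\<dots> \<le> 1" using g P by (simp add: adm_def)
  finally show "(\<integral>\<^sup>+x. \<phi> P (\<bar>f x\<bar> / r) \<partial>P) \<le> 1" .
qed

lemma Lux_mono: "qs (\<lambda>x. \<bar>f x\<bar> \<le> \<bar>g x\<bar>) \<Longrightarrow> Lux f \<le> Lux g"
  unfolding Lux_def by (rule Inf_superset_mono) (auto intro: adm_le)

lemma Lux_cong: "qs (\<lambda>x. \<bar>f x\<bar> = \<bar>g x\<bar>) \<Longrightarrow> Lux f = Lux g"
  by (intro antisym Lux_mono) (auto elim: qs_elim)

lemma LF_measurable: "f \<in> LF \<Longrightarrow> f \<in> borel_measurable M"
  by (simp add: LF_def)

lemma LF_finite: "f \<in> LF \<Longrightarrow> Lux f < \<infinity>"
  by (simp add: LF_def)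

lemma nn_adm: "f \<in> LF \<Longrightarrow> nn f < c \<Longrightarrow> adm f c"
  by (simp add: LF_def nn_less_adm)

lemma LF_solid:
  assumes "g \<in> LF" "f \<in> borel_measurable M" "qs (\<lambda>x. \<bar>f x\<bar> \<le> \<bar>g x\<bar>)"
  shows "f \<in> LF"
  using assms Lux_mono[OF assms(3)] by (auto simp: LF_def)

lemma nn_mono:
  assumes "g \<in> LF" "qs (\<lambda>x. \<bar>f x\<bar> \<le> \<bar>g x\<bar>)"
  shows "nn f \<le> nn g"
  unfolding nn_def using Lux_mono[OF assms(2)] LF_finite[OF assms(1)] by (simp add: enn2real_mono)

lemma nn_cong: "qs (\<lambda>x. \<bar>f x\<bar> = \<bar>g x\<bar>) \<Longrightarrow> nn f = nn g"
  by (simp add: nn_def Lux_cong)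

lemma nn_abs: "nn (\<lambda>x. \<bar>f x\<bar>) = nn f"
  by (rule nn_cong) (auto intro: qsI)

lemma nn_minus_commute: "nn (\<lambda>x. f x - g x) = nn (\<lambda>x. g x - f x)"
  by (rule nn_cong) (auto intro: qsI)

lemma adm_add:
  assumes f: "adm f r" "f \<in> borel_measurable M" and g: "adm g s" "g \<in> borel_measurable M"
  shows "adm (\<lambda>x. f x + g x) (r + s)"
  unfolding adm_def
proof (intro conjI ballI)
  have rs: "0 < r" "0 < s" using f g by (auto simp: adm_def)
  then show "0 < r + s" by simp
  fix P assume P: "P \<in> PP"
  define u v where "u = r / (r + s)" and "v = s / (r + s)"
  have uv: "0 \<le> u" "0 \<le> v" "u + v = 1" using rs by (auto simp: u_def v_def simp flip: add_divide_distrib)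
  have le: "\<phi> P (\<bar>f x + g x\<bar> / (r + s)) \<le> ennreal u * \<phi> P (\<bar>f x\<bar> / r) + ennreal v * \<phi> P (\<bar>g x\<bar> / s)" for x
  proof -
    have "\<bar>f x + g x\<bar> / (r + s) \<le> u * (\<bar>f x\<bar> / r) + v * (\<bar>g x\<bar> / s)"
      using rs by (simp add: u_def v_def add_divide_distrib[symmetric] divide_right_mono)
    then have "\<phi> P (\<bar>f x + g x\<bar> / (r + s)) \<le> \<phi> P (u * (\<bar>f x\<bar> / r) + v * (\<bar>g x\<bar> / s))"
      using P rs by (intro phi_mono) auto
    also have "\<dots> \<le> ennreal u * \<phi> P (\<bar>f x\<bar> / r) + ennreal v * \<phi> P (\<bar>g x\<bar> / s)"
      using P rs uv by (intro phi_convex) auto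
    finally show ?thesis .
  qed
  have m: "(\<lambda>x. \<phi> P (\<bar>f x\<bar> / r)) \<in> borel_measurable P" "(\<lambda>x. \<phi> P (\<bar>g x\<bar> / s)) \<in> borel_measurable P"
    using P f g rs by (auto intro: phi_measurable)
  have "(\<integral>\<^sup>+x. \<phi> P (\<bar>f x + g x\<bar> / (r + s)) \<partial>P) \<le>
      (\<integral>\<^sup>+x. ennreal u * \<phi> P (\<bar>f x\<bar> / r) + ennreal v * \<phi> P (\<bar>g x\<bar> / s) \<partial>P)"
    by (intro nn_integral_mono le)
  also have "\<dots> = ennreal u * (\<integral>\<^sup>+x. \<phi> P (\<bar>f x\<bar> / r) \<partial>P) + ennreal v * (\<integral>\<^sup>+x. \<phi> P (\<bar>g x\<bar> / s) \<partial>P)"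
    using m by (simp add: nn_integral_add nn_integral_cmult)
  also have "\<dots> \<le> ennreal u * 1 + ennreal v * 1"
    using f g P by (intro add_mono mult_left_mono) (auto simp: adm_def)
  also have "\<dots> = 1" using uv by (simp flip: ennreal_plus)
  finally show "(\<integral>\<^sup>+x. \<phi> P (\<bar>f x + g x\<bar> / (r + s)) \<partial>P) \<le> 1" .
qed

lemma LF_add:
  assumes f: "f \<in> LF" and g: "g \<in> LF"
  shows "(\<lambda>x. f x + g x) \<in> LF" "nn (\<lambda>x. f x + g x) \<le> nn f + nn g"
proof -
  have adm: "adm (\<lambda>x. f x + g x) c" if c: "nn f + nn g < c" for c
  proof -
    define e where "e = (c - (nn f + nn g)) / 2"
    have "adm f (nn f + e)" "adm g (nn g + e)"
      using f g c by (auto intro!: nn_adm simp: e_def)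
    then have "adm (\<lambda>x. f x + g x) ((nn f + e) + (nn g + e))"
      using f g by (intro adm_add) (auto simp: LF_def)
    moreover have "(nn f + e) + (nn g + e) = c" by (simp add: e_def field_simps)
    ultimately show ?thesis by simp
  qed
  show "(\<lambda>x. f x + g x) \<in> LF"
    using nn_leI(1)[OF adm] f g by (auto simp: LF_def)
  show "nn (\<lambda>x. f x + g x) \<le> nn f + nn g"
    by (rule nn_leI(2)[OF adm])
qed

lemma zero_LF [simp]: "(\<lambda>_. 0) \<in> LF" and nn_zero [simp]: "nn (\<lambda>_. 0) = 0"
proof -
  have "adm (\<lambda>_. 0) c" if "0 < c" for c
    using that by (simp add: adm_def)
  from nn_leI[OF this] show "(\<lambda>_. 0) \<in> LF" "nn (\<lambda>_. 0) = 0"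
    by (auto simp: LF_def intro: antisym)
qed

lemma scale_aux:
  assumes f: "f \<in> LF" and c: "c \<noteq> 0"
  shows "(\<lambda>x. c * f x) \<in> LF" "nn (\<lambda>x. c * f x) \<le> \<bar>c\<bar> * nn f"
proof -
  have adm: "adm (\<lambda>x. c * f x) b" if b: "\<bar>c\<bar> * nn f < b" for b
  proof -
    have "nn f < b / \<bar>c\<bar>" using b c by (simp add: field_simps)
    then have "adm f (b / \<bar>c\<bar>)" using f by (intro nn_adm)
    moreover have "\<bar>f x\<bar> / (b / \<bar>c\<bar>) = \<bar>c * f x\<bar> / b" for x by (simp add: abs_mult)
    ultimately show ?thesis using c by (simp add: adm_def zero_less_divide_iff)
  qed
  show "(\<lambda>x. c * f x) \<in> LF"
    using nn_leI(1)[OF adm] f by (auto simp: LF_def)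
  show "nn (\<lambda>x. c * f x) \<le> \<bar>c\<bar> * nn f"
    by (rule nn_leI(2)[OF adm])
qed

lemma LF_scale: "f \<in> LF \<Longrightarrow> (\<lambda>x. c * f x) \<in> LF"
  using scale_aux(1)[of f c] by (cases "c = 0") auto

lemma nn_scale: "f \<in> LF \<Longrightarrow> nn (\<lambda>x. c * f x) = \<bar>c\<bar> * nn f"
proof (cases "c = 0")
  case False
  assume f: "f \<in> LF"
  have "nn f = nn (\<lambda>x. (1 / c) * (c * f x))" using False by simp
  also have "\<dots> \<le> \<bar>1 / c\<bar> * nn (\<lambda>x. c * f x)"
    using f False by (intro scale_aux(2) LF_scale) auto
  finally have "\<bar>c\<bar> * nn f \<le> nn (\<lambda>x. c * f x)"
    using False by (simp add: field_simps)
  with scale_aux(2)[OF f False] show ?thesis by simp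
qed simp

lemma LF_minus: "f \<in> LF \<Longrightarrow> (\<lambda>x. - f x) \<in> LF"
  using LF_scale[of f "-1"] by simp

lemma LF_diff:
  assumes "f \<in> LF" "g \<in> LF"
  shows "(\<lambda>x. f x - g x) \<in> LF" "nn (\<lambda>x. f x - g x) \<le> nn f + nn g"
proof -
  have eq: "nn (\<lambda>x. - g x) = nn g" by (rule nn_cong) (auto intro: qsI)
  show "(\<lambda>x. f x - g x) \<in> LF" "nn (\<lambda>x. f x - g x) \<le> nn f + nn g"
    using LF_add[OF assms(1) LF_minus[OF assms(2)]] eq by auto
qed

lemma nn_triangle:
  assumes "f \<in> LF" "g \<in> LF" "h \<in> LF"
  shows "nn (\<lambda>x. f x - h x) \<le> nn (\<lambda>x. f x - g x) + nn (\<lambda>x. g x - h x)"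
  using LF_add(2)[OF LF_diff(1)[OF assms(1,2)] LF_diff(1)[OF assms(2,3)]] by simp

lemma nn_eq_0D:
  assumes f: "f \<in> LF" and 0: "nn f = 0"
  shows "qs (\<lambda>x. f x = 0)"
  unfolding qs_def
proof
  fix P assume P: "P \<in> PP"
  interpret prob_space P by (rule prob_PP[OF P])
  obtain x1 where x1: "0 < x1" "0 < \<phi> P x1"
    using orlicz[OF P] by (auto simp: orlicz_function_def)
  have int0: "(\<integral>\<^sup>+x. \<phi> P (\<bar>f x\<bar> / r) \<partial>P) = 0" if r: "0 < r" for r
  proof -
    have le: "(\<integral>\<^sup>+x. \<phi> P (\<bar>f x\<bar> / r) \<partial>P) \<le> ennreal (1 / (Suc k))" for k
    proof -
      define u :: real where "u = 1 / Suc k"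
      have u: "0 < u" "u \<le> 1" by (auto simp: u_def)
      have eq: "\<bar>f x\<bar> / r = u * (\<bar>f x\<bar> / (u * r))" for x using u by simp
      have "(\<integral>\<^sup>+x. \<phi> P (\<bar>f x\<bar> / r) \<partial>P) \<le> (\<integral>\<^sup>+x. ennreal u * \<phi> P (\<bar>f x\<bar> / (u * r)) \<partial>P)"
        using u r P by (subst eq, intro nn_integral_mono phi_scale) auto
      also have "\<dots> = ennreal u * (\<integral>\<^sup>+x. \<phi> P (\<bar>f x\<bar> / (u * r)) \<partial>P)"
        using P f u r by (intro nn_integral_cmult phi_measurable) (auto simp: LF_def)
      also have "\<dots> \<le> ennreal u * 1"
        using nn_adm[OF f, of "u * r"] 0 u r P by (intro mult_left_mono) (auto simp: adm_def)
      finally show ?thesis by (simp add: u_def)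
    qed
    have "(\<lambda>k. ennreal (1 / (Suc k))) \<longlonglongrightarrow> ennreal 0"
      using LIMSEQ_inverse_real_of_nat by (intro tendsto_ennrealI) (simp add: inverse_eq_divide)
    then have "(\<integral>\<^sup>+x. \<phi> P (\<bar>f x\<bar> / r) \<partial>P) \<le> ennreal 0"
      by (rule LIMSEQ_le_const) (use le in blast)
    then show ?thesis by simp
  qed
  have "AE x in P. \<bar>f x\<bar> * Suc n < x1" for n
  proof -
    have "AE x in P. \<phi> P (\<bar>f x\<bar> / (1 / Suc n)) = 0"
      using int0[of "1 / Suc n"] nn_integral_0_iff_AE[OF phi_measurable[OF P LF_measurable[OF f], of "1 / Suc n"]]
      by simp
    then show ?thesis
    proof (rule AE_mp, intro AE_I2 impI)
      fix x assume 0: "\<phi> P (\<bar>f x\<bar> / (1 / Suc n)) = 0"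
      show "\<bar>f x\<bar> * Suc n < x1"
      proof (rule ccontr)
        assume "\<not> \<bar>f x\<bar> * Suc n < x1"
        then have "\<phi> P x1 \<le> \<phi> P (\<bar>f x\<bar> / (1 / Suc n))"
          using P x1 by (intro phi_mono) (auto simp: field_simps)
        with 0 x1 show False by simp
      qed
    qed
  qed
  then have "AE x in P. \<forall>n. \<bar>f x\<bar> * Suc n < x1"
    by (simp add: AE_all_countable)
  then show "AE x in P. f x = 0"
  proof (rule AE_mp, intro AE_I2 impI)
    fix x assume *: "\<forall>n. \<bar>f x\<bar> * Suc n < x1"
    show "f x = 0"
    proof (rule ccontr)
      assume "f x \<noteq> 0"
      then obtain n :: nat where "x1 < real n * \<bar>f x\<bar>"
        using reals_Archimedean3[of "\<bar>f x\<bar>"] by auto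
      moreover have "\<bar>f x\<bar> * Suc n < x1" using * by blast
      ultimately show False by (simp add: algebra_simps)
    qed
  qed
qed

lemma nn_eq_0_iff: "f \<in> LF \<Longrightarrow> nn f = 0 \<longleftrightarrow> qs (\<lambda>x. f x = 0)"
  using nn_eq_0D nn_cong[of f "\<lambda>_. 0"] by auto

lemma Fatou:
  assumes fn: "\<And>n. fn n \<in> LF" and b: "\<And>n. nn (fn n) \<le> b" and f: "f \<in> borel_measurable M"
    and lim: "qs (\<lambda>x. (\<lambda>n. fn n x) \<longlonglongrightarrow> f x)"
  shows "f \<in> LF" "nn f \<le> b"
proof -
  have adm: "adm f c" if c: "b < c" for c
    unfolding adm_def
  proof (intro conjI ballI)
    have "0 \<le> b" using b[of 0] nn_nonneg[of "fn 0"] by linarith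
    with c show c0: "0 < c" by simp
    fix P assume P: "P \<in> PP"
    have "AE x in P. (\<lambda>n. fn n x) \<longlonglongrightarrow> f x" using lim P by (simp add: qs_def)
    then have "AE x in P. \<phi> P (\<bar>f x\<bar> / c) \<le> liminf (\<lambda>n. \<phi> P (\<bar>fn n x\<bar> / c))"
    proof (rule AE_mp, intro AE_I2 impI)
      fix x assume "(\<lambda>n. fn n x) \<longlonglongrightarrow> f x"
      then have "(\<lambda>n. \<bar>fn n x\<bar> / c) \<longlonglongrightarrow> \<bar>f x\<bar> / c"
        using c0 by (intro tendsto_intros) auto
      then show "\<phi> P (\<bar>f x\<bar> / c) \<le> liminf (\<lambda>n. \<phi> P (\<bar>fn n x\<bar> / c))"
        using P c0 by (intro phi_lsc) auto
    qed
    then have "(\<integral>\<^sup>+x. \<phi> P (\<bar>f x\<bar> / c) \<partial>P) \<le> (\<integral>\<^sup>+x. liminf (\<lambda>n. \<phi> P (\<bar>fn n x\<bar> / c)) \<partial>P)"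
      by (rule nn_integral_mono_AE)
    also have "\<dots> \<le> liminf (\<lambda>n. \<integral>\<^sup>+x. \<phi> P (\<bar>fn n x\<bar> / c) \<partial>P)"
      using P fn c0 by (intro nn_integral_liminf phi_measurable) (auto simp: LF_def)
    also have "\<dots> \<le> limsup (\<lambda>n. \<integral>\<^sup>+x. \<phi> P (\<bar>fn n x\<bar> / c) \<partial>P)"
      by (rule Liminf_le_Limsup) simp
    also have "\<dots> \<le> 1"
    proof (rule Limsup_bounded, rule always_eventually, rule allI)
      fix n
      have "adm (fn n) c" using b[of n] c by (intro nn_adm fn) simp
      then show "(\<integral>\<^sup>+x. \<phi> P (\<bar>fn n x\<bar> / c) \<partial>P) \<le> 1" using P by (simp add: adm_def)
    qed
    finally show "(\<integral>\<^sup>+x. \<phi> P (\<bar>f x\<bar> / c) \<partial>P) \<le> 1" .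
  qed
  show "f \<in> LF" using nn_leI(1)[OF adm] f by (simp add: LF_def)
  show "nn f \<le> b" by (rule nn_leI(2)[OF adm])
qed

end

lemma qs_class_not_measurable: "f \<notin> borel_measurable M \<Longrightarrow> qs_class M PP f = {}"
  by (auto simp: qs_class_def qs_rel_def)

context robust_orlicz
begin

abbreviation cl :: "('a \<Rightarrow> real) \<Rightarrow> ('a \<Rightarrow> real) set" where
  "cl f \<equiv> qs_class M PP f"

abbreviation "LP \<equiv> L_Phi M PP \<phi>"

definition fs :: "('a \<Rightarrow> real) set set \<Rightarrow> ('a \<Rightarrow> real) set" where
  "fs V = {f \<in> borel_measurable M. cl f \<in> V}"

lemma equiv_qs_rel: "equiv (borel_measurable M) (qs_rel M PP)"
proof (rule equivI)
  show "sym (qs_rel M PP)"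
    by (auto simp: sym_def qs_rel_def intro: AE_mp)
  show "trans (qs_rel M PP)"
  proof (rule transI)
    fix f g h assume "(f, g) \<in> qs_rel M PP" "(g, h) \<in> qs_rel M PP"
    moreover have "\<forall>P\<in>PP. AE x in P. f x = h x"
    proof
      fix P assume "P \<in> PP"
      then have "AE x in P. f x = g x" "AE x in P. g x = h x"
        using calculation by (auto simp: qs_rel_def)
      then show "AE x in P. f x = h x" by eventually_elim simp
    qed
    ultimately show "(f, h) \<in> qs_rel M PP"
      by (simp add: qs_rel_def)
  qed
qed (auto simp: refl_on_def qs_rel_def)

lemma cl_eq_iff: "f \<in> borel_measurable M \<Longrightarrow> g \<in> borel_measurable M \<Longrightarrow> cl f = cl g \<longleftrightarrow> qs (\<lambda>x. f x = g x)"
  using eq_equiv_class_iff[OF equiv_qs_rel, of f g] by (simp add: qs_class_def qs_rel_def qs_def)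

lemma mem_cl_iff: "f \<in> borel_measurable M \<Longrightarrow> g \<in> cl f \<longleftrightarrow> g \<in> borel_measurable M \<and> qs (\<lambda>x. f x = g x)"
  by (auto simp: qs_class_def qs_rel_def qs_def)

lemma L0_eq: "L0 M PP = cl ` borel_measurable M"
  by (auto simp: L0_def quotient_def qs_class_def)

lemma rep_cl:
  assumes f: "f \<in> borel_measurable M"
  shows "rep (cl f) \<in> borel_measurable M" "qs (\<lambda>x. f x = rep (cl f) x)" "cl (rep (cl f)) = cl f"
proof -
  have "f \<in> cl f" using f by (simp add: mem_cl_iff qsI)
  then have "rep (cl f) \<in> cl f" unfolding rep_def by (rule someI[of "\<lambda>g. g \<in> cl f"])
  then show *: "rep (cl f) \<in> borel_measurable M" "qs (\<lambda>x. f x = rep (cl f) x)"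
    using f by (auto simp: mem_cl_iff)
  then show "cl (rep (cl f)) = cl f" using cl_eq_iff[OF f *(1)] by simp
qed

lemma rep_L0: "X \<in> L0 M PP \<Longrightarrow> rep X \<in> borel_measurable M" "X \<in> L0 M PP \<Longrightarrow> cl (rep X) = X"
  by (auto simp: L0_eq rep_cl)

lemma rep_qs_eq: "f \<in> borel_measurable M \<Longrightarrow> qs (\<lambda>x. rep (cl f) x = f x)"
  by (rule qs_elim[OF rep_cl(2)]) auto

lemma Phi_norm_cl: "f \<in> borel_measurable M \<Longrightarrow> Phi_norm PP \<phi> (cl f) = Lux f"
  unfolding Phi_norm_eq by (rule Lux_cong) (rule qs_elim[OF rep_cl(2)], auto)

lemma cl_LP_iff: "f \<in> borel_measurable M \<Longrightarrow> cl f \<in> LP \<longleftrightarrow> f \<in> LF"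
  by (auto simp: L_Phi_def L0_eq Phi_norm_cl LF_def)

lemma fs_LP: "fs LP = LF"
  using LF_measurable by (auto simp: fs_def cl_LP_iff)

lemma LP_subset_L0: "LP \<subseteq> L0 M PP"
  by (auto simp: L_Phi_def)

lemma fs_measurable: "f \<in> fs V \<Longrightarrow> f \<in> borel_measurable M"
  by (simp add: fs_def)

lemma cl_in: "f \<in> fs V \<Longrightarrow> cl f \<in> V"
  by (simp add: fs_def)

lemma fs_LF: "V \<subseteq> LP \<Longrightarrow> f \<in> fs V \<Longrightarrow> f \<in> LF"
  by (auto simp: fs_def cl_LP_iff)

lemma rep_fs: "V \<subseteq> LP \<Longrightarrow> X \<in> V \<Longrightarrow> rep X \<in> fs V"
  using LP_subset_L0 rep_L0[of X] by (auto simp: fs_def)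

lemma cl_rep: "V \<subseteq> LP \<Longrightarrow> X \<in> V \<Longrightarrow> cl (rep X) = X"
  using LP_subset_L0 rep_L0[of X] by auto

lemma fs_obtain:
  assumes "V \<subseteq> LP" "X \<in> V"
  obtains f where "f \<in> fs V" "X = cl f"
  using rep_fs[OF assms] cl_rep[OF assms] by metis

lemma LP_obtain: "X \<in> LP \<Longrightarrow> (\<And>f. f \<in> LF \<Longrightarrow> X = cl f \<Longrightarrow> thesis) \<Longrightarrow> thesis"
  using rep_fs[of LP X] cl_rep[of LP X] unfolding fs_LP by force

lemma fs_cong: "f \<in> fs V \<Longrightarrow> g \<in> borel_measurable M \<Longrightarrow> qs (\<lambda>x. f x = g x) \<Longrightarrow> g \<in> fs V"
  using cl_eq_iff[of f g] by (auto simp: fs_def)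

lemma fs_subset_iff: "V \<subseteq> LP \<Longrightarrow> W \<subseteq> LP \<Longrightarrow> V \<subseteq> W \<longleftrightarrow> fs V \<subseteq> fs W"
proof
  assume V: "V \<subseteq> LP" and sub: "fs V \<subseteq> fs W"
  show "V \<subseteq> W"
  proof
    fix X assume X: "X \<in> V"
    then have "cl (rep X) \<in> W" using rep_fs[OF V X] sub cl_in by blast
    then show "X \<in> W" using cl_rep[OF V X] by simp
  qed
qed (auto simp: fs_def)

lemma fs_eq_iff: "V \<subseteq> LP \<Longrightarrow> W \<subseteq> LP \<Longrightarrow> V = W \<longleftrightarrow> fs V = fs W"
  using fs_subset_iff[of V W] fs_subset_iff[of W V] by blast

lemma qs_2:
  assumes "qs Q" "qs R" "\<And>x. x \<in> space M \<Longrightarrow> Q x \<Longrightarrow> R x \<Longrightarrow> S x"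
  shows "qs S"
  by (rule qs_elim[OF qs_conj[OF assms(1,2)]]) (use assms(3) in auto)

lemma
  assumes [measurable]: "f \<in> borel_measurable M" "g \<in> borel_measurable M"
  shows qs_add_cl: "qs_add M PP (cl f) (cl g) = cl (\<lambda>x. f x + g x)"
    and qs_diff_cl: "qs_diff M PP (cl f) (cl g) = cl (\<lambda>x. f x - g x)"
    and qs_sup_cl: "qs_sup M PP (cl f) (cl g) = cl (\<lambda>x. max (f x) (g x))"
    and qs_scale_cl: "qs_scale M PP c (cl f) = cl (\<lambda>x. c * f x)"
    and qs_abs_cl: "qs_abs M PP (cl f) = cl (\<lambda>x. \<bar>f x\<bar>)"
proof -
  note [measurable] = rep_cl(1)[OF assms(1)] rep_cl(1)[OF assms(2)]
  note e = qs_2[OF rep_cl(2)[OF assms(1)] rep_cl(2)[OF assms(2)]]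
  show "qs_add M PP (cl f) (cl g) = cl (\<lambda>x. f x + g x)"
    unfolding qs_add_def by (subst cl_eq_iff) (auto intro: e)
  show "qs_diff M PP (cl f) (cl g) = cl (\<lambda>x. f x - g x)"
    unfolding qs_diff_def by (subst cl_eq_iff) (auto intro: e)
  show "qs_sup M PP (cl f) (cl g) = cl (\<lambda>x. max (f x) (g x))"
    unfolding qs_sup_def by (subst cl_eq_iff) (auto intro: e)
  show "qs_scale M PP c (cl f) = cl (\<lambda>x. c * f x)"
    unfolding qs_scale_def by (subst cl_eq_iff) (auto intro: e)
  show "qs_abs M PP (cl f) = cl (\<lambda>x. \<bar>f x\<bar>)"
    unfolding qs_abs_def by (subst cl_eq_iff) (auto intro: e)
qed

lemma qs_le_cl:
  assumes f: "f \<in> borel_measurable M" and g: "g \<in> borel_measurable M"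
  shows "qs_le PP (cl f) (cl g) \<longleftrightarrow> qs (\<lambda>x. f x \<le> g x)"
proof
  assume "qs_le PP (cl f) (cl g)"
  moreover have "f \<in> cl f" "g \<in> cl g" using f g by (auto simp: mem_cl_iff qsI)
  ultimately show "qs (\<lambda>x. f x \<le> g x)" by (auto simp: qs_le_def qs_def)
next
  assume le: "qs (\<lambda>x. f x \<le> g x)"
  have "qs (\<lambda>x. f' x \<le> g' x)" if "f' \<in> cl f" "g' \<in> cl g" for f' g'
  proof -
    have "qs (\<lambda>x. f x = f' x \<and> g x = g' x)"
      using that f g by (auto simp: mem_cl_iff intro: qs_conj)
    then show ?thesis by (rule qs_2[OF le]) auto
  qed
  then show "qs_le PP (cl f) (cl g)" by (auto simp: qs_le_def qs_def)
qed

lemma subspace_fs: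
  assumes "qs_subspace M PP LP V"
  shows "V \<subseteq> LP" "(\<lambda>_. 0) \<in> fs V"
    "\<And>f g. f \<in> fs V \<Longrightarrow> g \<in> fs V \<Longrightarrow> (\<lambda>x. f x + g x) \<in> fs V"
    "\<And>c f. f \<in> fs V \<Longrightarrow> (\<lambda>x. c * f x) \<in> fs V"
proof -
  show "V \<subseteq> LP" "(\<lambda>_. 0) \<in> fs V"
    using assms by (auto simp: qs_subspace_def fs_def)
  fix f g c assume f: "f \<in> fs V"
  then have [measurable]: "f \<in> borel_measurable M" by (rule fs_measurable)
  have "qs_scale M PP c (cl f) \<in> V"
    using assms cl_in[OF f] unfolding qs_subspace_def by blast
  then show "(\<lambda>x. c * f x) \<in> fs V"
    using qs_scale_cl[of f f c] by (simp add: fs_def)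
  assume g: "g \<in> fs V"
  then have [measurable]: "g \<in> borel_measurable M" by (rule fs_measurable)
  have "qs_add M PP (cl f) (cl g) \<in> V"
    using assms cl_in[OF f] cl_in[OF g] unfolding qs_subspace_def by blast
  then show "(\<lambda>x. f x + g x) \<in> fs V"
    using qs_add_cl[of f g] by (simp add: fs_def)
qed

lemma subspaceI:
  assumes V: "V \<subseteq> LP" and "(\<lambda>_. 0) \<in> fs V"
    and add: "\<And>f g. f \<in> fs V \<Longrightarrow> g \<in> fs V \<Longrightarrow> (\<lambda>x. f x + g x) \<in> fs V"
    and scale: "\<And>c f. f \<in> fs V \<Longrightarrow> (\<lambda>x. c * f x) \<in> fs V"
  shows "qs_subspace M PP LP V"
  unfolding qs_subspace_def
proof (intro conjI ballI allI)
  show "V \<subseteq> LP" "cl (\<lambda>_. 0) \<in> V" using assms by (auto simp: fs_def)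
  fix X assume "X \<in> V"
  then obtain f where f: "f \<in> fs V" "X = cl f" by (rule fs_obtain[OF V])
  show "qs_scale M PP c X \<in> V" for c
    using scale[OF f(1)] f qs_scale_cl[of f f c] by (auto simp: fs_def)
  fix Y assume "Y \<in> V"
  then obtain g where g: "g \<in> fs V" "Y = cl g" by (rule fs_obtain[OF V])
  show "qs_add M PP X Y \<in> V"
    using add[OF f(1) g(1)] f g qs_add_cl[of f g] by (auto simp: fs_def)
qed

definition dst :: "('a \<Rightarrow> real) set \<Rightarrow> ('a \<Rightarrow> real) set \<Rightarrow> real" where
  "dst X Y = enn2real (Phi_norm PP \<phi> (qs_diff M PP X Y))"

lemma dst_cl: "f \<in> borel_measurable M \<Longrightarrow> g \<in> borel_measurable M \<Longrightarrow> dst (cl f) (cl g) = nn (\<lambda>x. f x - g x)"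
  by (simp add: dst_def qs_diff_cl Phi_norm_cl nn_def)

lemma dst_commute: "dst X Y = dst Y X"
proof (cases "(\<lambda>x. rep X x - rep Y x) \<in> borel_measurable M")
  case True
  then have "(\<lambda>x. rep Y x - rep X x) \<in> borel_measurable M"
    using borel_measurable_uminus[OF True] by simp
  then show ?thesis
    using True nn_minus_commute[of "rep X" "rep Y"] by (simp add: dst_def qs_diff_def Phi_norm_cl nn_def)
next
  case False
  then have "(\<lambda>x. rep Y x - rep X x) \<notin> borel_measurable M"
    using borel_measurable_uminus[of "\<lambda>x. rep Y x - rep X x" M] by auto
  then show ?thesis
    using False by (simp add: dst_def qs_diff_def qs_class_not_measurable)
qed

lemma Metric_space_LP: "Metric_space LP dst"
proof
  fix X Y Z
  show "0 \<le> dst X Y" by (simp add: dst_def)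
  show "dst X Y = dst Y X" by (rule dst_commute)
  assume X: "X \<in> LP" and Y: "Y \<in> LP"
  from X obtain f where f: "f \<in> LF" "X = cl f" by (rule LP_obtain)
  from Y obtain g where g: "g \<in> LF" "Y = cl g" by (rule LP_obtain)
  note m = LF_measurable[OF f(1)] LF_measurable[OF g(1)]
  have "dst X Y = 0 \<longleftrightarrow> qs (\<lambda>x. f x - g x = 0)"
    using f g m by (simp add: dst_cl nn_eq_0_iff LF_diff)
  then show "dst X Y = 0 \<longleftrightarrow> X = Y"
    using f g m by (simp add: cl_eq_iff)
  assume "Z \<in> LP"
  then obtain h where h: "h \<in> LF" "Z = cl h" by (rule LP_obtain)
  show "dst X Z \<le> dst X Y + dst Y Z"
    using f g h m LF_measurable[OF h(1)] nn_triangle by (simp add: dst_cl)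
qed

sublocale LP: Metric_space LP dst
  by (rule Metric_space_LP)

lemma norm_topology_eq: "norm_topology M PP V (Phi_norm PP \<phi>) = Metric_space.mtopology V dst"
  by (simp add: norm_topology_def dst_def[abs_def])

lemma Phi_topology_eq: "Phi_topology M PP \<phi> = LP.mtopology"
  by (simp add: Phi_topology_def norm_topology_eq)

lemma Submetric_LP: "V \<subseteq> LP \<Longrightarrow> Submetric LP dst V"
  by unfold_locales

lemma subtopology_eq: "V \<subseteq> LP \<Longrightarrow> subtopology (Phi_topology M PP \<phi>) V = norm_topology M PP V (Phi_norm PP \<phi>)"
  unfolding Phi_topology_eq norm_topology_eq
  by (rule Submetric.mtopology_submetric[OF Submetric_LP, symmetric])

lemma fs_closure_iff:
  assumes V: "V \<subseteq> LP"
  shows "f \<in> fs (Phi_topology M PP \<phi> closure_of V) \<longleftrightarrow>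
    f \<in> LF \<and> (\<forall>e>0. \<exists>g\<in>fs V. nn (\<lambda>x. f x - g x) < e)"
proof -
  have "(\<exists>Y\<in>V. Y \<in> LP.mball (cl f) e) \<longleftrightarrow> (\<exists>g\<in>fs V. nn (\<lambda>x. f x - g x) < e)" if f: "f \<in> LF" for e
  proof
    assume "\<exists>Y\<in>V. Y \<in> LP.mball (cl f) e"
    then obtain Y where Y: "Y \<in> V" "dst (cl f) Y < e" by auto
    obtain g where "g \<in> fs V" "Y = cl g" using Y V by (metis fs_obtain)
    then show "\<exists>g\<in>fs V. nn (\<lambda>x. f x - g x) < e"
      using Y f by (auto simp: dst_cl LF_measurable fs_measurable)
  next
    assume "\<exists>g\<in>fs V. nn (\<lambda>x. f x - g x) < e"
    then obtain g where "g \<in> fs V" "nn (\<lambda>x. f x - g x) < e" by auto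
    then show "\<exists>Y\<in>V. Y \<in> LP.mball (cl f) e"
      using f V by (intro bexI[of _ "cl g"]) (auto simp: dst_cl LF_measurable fs_measurable cl_LP_iff cl_in intro: fs_LF)
  qed
  then show ?thesis
    unfolding Phi_topology_eq LP.metric_closure_of fs_def
    using LF_measurable cl_LP_iff by (auto simp: fs_def)
qed

lemma closure_subset_LP: "Phi_topology M PP \<phi> closure_of V \<subseteq> LP"
  unfolding Phi_topology_eq by (metis LP.topspace_mtopology closure_of_subset_topspace)

lemma continuous_iff_bounded:
  assumes V: "qs_subspace M PP LP V"
    and add: "\<And>X Y. X \<in> V \<Longrightarrow> Y \<in> V \<Longrightarrow> l (qs_add M PP X Y) = l X + l Y"
    and scale: "\<And>c X. X \<in> V \<Longrightarrow> l (qs_scale M PP c X) = c * l X"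
  shows "continuous_map (norm_topology M PP V (Phi_norm PP \<phi>)) euclideanreal l \<longleftrightarrow>
    (\<exists>K. \<forall>f\<in>fs V. \<bar>l (cl f)\<bar> \<le> K * nn f)"
proof -
  note VLP = subspace_fs(1)[OF V] and sub = subspace_fs(2-4)[OF V]
  interpret S: Submetric LP dst V by (rule Submetric_LP[OF VLP])
  have scalef: "l (cl (\<lambda>x. c * f x)) = c * l (cl f)" if "f \<in> fs V" for f c
    using that scale[of "cl f" c] qs_scale_cl[of f f c] by (simp add: fs_def)
  have difff: "l (cl (\<lambda>x. f x - g x)) = l (cl f) - l (cl g)" and diff_in: "(\<lambda>x. f x - g x) \<in> fs V"
    if "f \<in> fs V" "g \<in> fs V" for f g
  proof -
    have g': "(\<lambda>x. - 1 * g x) \<in> fs V" by (rule sub(3)[OF that(2)])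
    have "l (cl (\<lambda>x. f x + - 1 * g x)) = l (cl f) + l (cl (\<lambda>x. - 1 * g x))"
      using that g' add[of "cl f" "cl (\<lambda>x. - 1 * g x)"] qs_add_cl[of f "\<lambda>x. - 1 * g x"] by (simp add: fs_def)
    then show "l (cl (\<lambda>x. f x - g x)) = l (cl f) - l (cl g)"
      using scalef[OF that(2), of "-1"] by simp
    show "(\<lambda>x. f x - g x) \<in> fs V" using sub(2)[OF that(1) g'] by simp
  qed
  have top: "continuous_map (norm_topology M PP V (Phi_norm PP \<phi>)) euclideanreal l \<longleftrightarrow>
    (\<forall>a\<in>V. \<forall>\<epsilon>>0. \<exists>\<delta>>0. \<forall>x. x \<in> V \<and> dst a x < \<delta> \<longrightarrow> dist (l a) (l x) < \<epsilon>)"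
    unfolding norm_topology_eq mtopology_is_euclidean[symmetric]
    by (subst S.sub.metric_continuous_map[OF Met_TC.Metric_space_axioms]) auto
  show ?thesis
    unfolding top
  proof
    assume L: "\<forall>a\<in>V. \<forall>\<epsilon>>0. \<exists>\<delta>>0. \<forall>x. x \<in> V \<and> dst a x < \<delta> \<longrightarrow> dist (l a) (l x) < \<epsilon>"
    have "cl (\<lambda>_. 0) \<in> V" using sub(1) by (simp add: fs_def)
    with L obtain \<delta> where \<delta>: "0 < \<delta>" "\<And>x. x \<in> V \<Longrightarrow> dst (cl (\<lambda>_. 0)) x < \<delta> \<Longrightarrow> dist (l (cl (\<lambda>_. 0))) (l x) < 1"
      by (metis zero_less_one)
    have l0: "l (cl (\<lambda>_. 0)) = 0" using scalef[OF sub(1), of 0] by simp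
    have small: "\<bar>l (cl f)\<bar> < 1" if f: "f \<in> fs V" "nn f < \<delta>" for f
      using \<delta>(2)[of "cl f"] f l0 nn_minus_commute[of "\<lambda>_. 0" f] by (simp add: fs_def dst_cl)
    have "\<bar>l (cl f)\<bar> \<le> 2 / \<delta> * nn f" if f: "f \<in> fs V" for f
    proof (cases "nn f = 0")
      case True
      have fL: "f \<in> LF" using f VLP by (rule fs_LF[rotated])
      have "\<bar>l (cl f)\<bar> \<le> e" if "0 < e" for e
      proof -
        have "nn (\<lambda>x. (1 / e) * f x) = 0" using True nn_scale[OF fL, of "1 / e"] by simp
        then have "\<bar>l (cl (\<lambda>x. (1 / e) * f x))\<bar> < 1" using \<delta> by (intro small sub(3) f) simp
        then have "\<bar>1 / e * l (cl f)\<bar> < 1" using scalef[OF f, of "1 / e"] by simp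
        then show ?thesis using that by (simp add: abs_mult pos_divide_less_eq)
      qed
      then have "\<bar>l (cl f)\<bar> \<le> 0" by (rule dense_ge)
      with True show ?thesis by simp
    next
      case False
      then have n: "0 < nn f" using nn_nonneg[of f] by linarith
      have fL: "f \<in> LF" using f VLP by (rule fs_LF[rotated])
      define c where "c = \<delta> / (2 * nn f)"
      have c: "0 < c" using n \<delta> by (simp add: c_def)
      have "nn (\<lambda>x. c * f x) = c * nn f" using nn_scale[OF fL, of c] c by simp
      also have "\<dots> = \<delta> / 2" using n by (simp add: c_def)
      finally have "nn (\<lambda>x. c * f x) = \<delta> / 2" .
      then have "\<bar>l (cl (\<lambda>x. c * f x))\<bar> < 1" using \<delta> by (intro small sub(3) f) simp
      then have "c * \<bar>l (cl f)\<bar> < 1" using scalef[OF f, of c] c by (simp add: abs_mult)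
      then show ?thesis using n \<delta> by (simp add: c_def field_simps)
    qed
    then show "\<exists>K. \<forall>f\<in>fs V. \<bar>l (cl f)\<bar> \<le> K * nn f" by blast
  next
    assume "\<exists>K. \<forall>f\<in>fs V. \<bar>l (cl f)\<bar> \<le> K * nn f"
    then obtain K0 where K0: "\<And>f. f \<in> fs V \<Longrightarrow> \<bar>l (cl f)\<bar> \<le> K0 * nn f" by blast
    define K where "K = \<bar>K0\<bar> + 1"
    have K: "\<bar>l (cl f)\<bar> \<le> K * nn f" if "f \<in> fs V" for f
    proof -
      have "K0 * nn f \<le> K * nn f" by (intro mult_right_mono) (auto simp: K_def)
      with K0[OF that] show ?thesis by linarith
    qed
    have "0 < K" by (simp add: K_def)
    show "\<forall>a\<in>V. \<forall>\<epsilon>>0. \<exists>\<delta>>0. \<forall>x. x \<in> V \<and> dst a x < \<delta> \<longrightarrow> dist (l a) (l x) < \<epsilon>"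
    proof (intro ballI allI impI)
      fix A and e :: real assume A: "A \<in> V" and e: "0 < e"
      obtain f where f: "f \<in> fs V" "A = cl f" using A by (rule fs_obtain[OF VLP])
      have "dist (l A) (l X) < e" if X: "X \<in> V" "dst A X < e / K" for X
      proof -
        obtain g where g: "g \<in> fs V" "X = cl g" using X(1) by (rule fs_obtain[OF VLP])
        have "\<bar>l (cl f) - l (cl g)\<bar> \<le> K * nn (\<lambda>x. f x - g x)"
          using K[OF diff_in[OF f(1) g(1)]] difff[OF f(1) g(1)] by simp
        also have "\<dots> < e"
          using X f g \<open>0 < K\<close> by (simp add: dst_cl fs_measurable field_simps)
        finally show ?thesis using f g by (simp add: dist_real_def)
      qed
      then show "\<exists>\<delta>>0. \<forall>x. x \<in> V \<and> dst A x < \<delta> \<longrightarrow> dist (l A) (l x) < e"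
        using e \<open>0 < K\<close> by (intro exI[of _ "e / K"]) auto
    qed
  qed
qed

end

context robust_orlicz
begin

lemma closure_mem:
  assumes V: "V \<subseteq> LP" and f: "f \<in> LF"
    and approx: "\<And>e. 0 < e \<Longrightarrow> \<exists>g\<in>fs (Phi_topology M PP \<phi> closure_of V). nn (\<lambda>x. f x - g x) < e"
  shows "f \<in> fs (Phi_topology M PP \<phi> closure_of V)"
  unfolding fs_closure_iff[OF V]
proof (intro conjI allI impI f)
  fix e :: real assume e: "0 < e"
  obtain g where g: "g \<in> fs (Phi_topology M PP \<phi> closure_of V)" "nn (\<lambda>x. f x - g x) < e / 2"
    using approx[of "e / 2"] e by auto
  then have gL: "g \<in> LF" and "\<forall>e>0. \<exists>h\<in>fs V. nn (\<lambda>x. g x - h x) < e"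
    using fs_closure_iff[OF V] by blast+
  moreover have "0 < e / 2" using e by simp
  ultimately obtain h where h: "h \<in> fs V" "nn (\<lambda>x. g x - h x) < e / 2" by blast
  have "nn (\<lambda>x. f x - h x) \<le> nn (\<lambda>x. f x - g x) + nn (\<lambda>x. g x - h x)"
    using f gL h V by (intro nn_triangle) (auto intro: fs_LF)
  with g h show "\<exists>h\<in>fs V. nn (\<lambda>x. f x - h x) < e" by (intro bexI[of _ h]) auto
qed

lemma closure_subset_fs: "V \<subseteq> LP \<Longrightarrow> fs V \<subseteq> fs (Phi_topology M PP \<phi> closure_of V)"
proof
  fix f assume V: "V \<subseteq> LP" and f: "f \<in> fs V"
  show "f \<in> fs (Phi_topology M PP \<phi> closure_of V)"
    unfolding fs_closure_iff[OF V] using fs_LF[OF V f] f by (auto intro!: bexI[of _ f])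
qed

lemma closure_subspace:
  assumes V: "qs_subspace M PP LP V"
  shows "qs_subspace M PP LP (Phi_topology M PP \<phi> closure_of V)"
proof (rule subspaceI)
  note VL = subspace_fs(1)[OF V] and sub = subspace_fs(2-4)[OF V]
  note iff = fs_closure_iff[OF VL]
  show "Phi_topology M PP \<phi> closure_of V \<subseteq> LP" by (rule closure_subset_LP)
  show "(\<lambda>_. 0) \<in> fs (Phi_topology M PP \<phi> closure_of V)"
    using sub(1) closure_subset_fs[OF VL] by blast
  fix f assume f: "f \<in> fs (Phi_topology M PP \<phi> closure_of V)"
  then have fL: "f \<in> LF" using iff by blast
  show "(\<lambda>x. c * f x) \<in> fs (Phi_topology M PP \<phi> closure_of V)" for c
  proof (cases "c = 0")
    case True
    then show ?thesis using sub(1) closure_subset_fs[OF VL] by auto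
  next
    case False
    show ?thesis
      unfolding iff
    proof (intro conjI allI impI LF_scale fL)
      fix e :: real assume "0 < e"
      then have "0 < e / \<bar>c\<bar>" using False by simp
      then obtain g where g: "g \<in> fs V" "nn (\<lambda>x. f x - g x) < e / \<bar>c\<bar>"
        using f iff by blast
      have "nn (\<lambda>x. c * (f x - g x)) = \<bar>c\<bar> * nn (\<lambda>x. f x - g x)"
        by (intro nn_scale LF_diff fL fs_LF[OF VL g(1)])
      also have "\<dots> < e" using g(2) False by (simp add: field_simps)
      finally show "\<exists>g\<in>fs V. nn (\<lambda>x. c * f x - g x) < e"
        using sub(3)[OF g(1), of c] by (intro bexI[of _ "\<lambda>x. c * g x"]) (auto simp: algebra_simps)
    qed
  qed
  fix g assume g: "g \<in> fs (Phi_topology M PP \<phi> closure_of V)"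
  then have gL: "g \<in> LF" using iff by blast
  show "(\<lambda>x. f x + g x) \<in> fs (Phi_topology M PP \<phi> closure_of V)"
    unfolding iff
  proof (intro conjI allI impI LF_add(1) fL gL)
    fix e :: real assume "0 < e"
    then have e: "0 < e / 2" by simp
    obtain f' where f': "f' \<in> fs V" "nn (\<lambda>x. f x - f' x) < e / 2" using f iff e by blast
    obtain g' where g': "g' \<in> fs V" "nn (\<lambda>x. g x - g' x) < e / 2" using g iff e by blast
    have "nn (\<lambda>x. (f x - f' x) + (g x - g' x)) \<le> nn (\<lambda>x. f x - f' x) + nn (\<lambda>x. g x - g' x)"
      by (intro LF_add LF_diff fL gL fs_LF[OF VL f'(1)] fs_LF[OF VL g'(1)])
    with f'(2) g'(2) have "nn (\<lambda>x. (f x + g x) - (f' x + g' x)) < e" by (simp add: algebra_simps)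
    with sub(2)[OF f'(1) g'(1)] show "\<exists>h\<in>fs V. nn (\<lambda>x. (f x + g x) - h x) < e"
      by (intro bexI[of _ "\<lambda>x. f' x + g' x"])
  qed
qed

lemma closure_abs:
  assumes V: "V \<subseteq> LP" and abs: "\<And>f. f \<in> fs V \<Longrightarrow> (\<lambda>x. \<bar>f x\<bar>) \<in> fs V"
    and f: "f \<in> fs (Phi_topology M PP \<phi> closure_of V)"
  shows "(\<lambda>x. \<bar>f x\<bar>) \<in> fs (Phi_topology M PP \<phi> closure_of V)"
  unfolding fs_closure_iff[OF V]
proof (intro conjI allI impI)
  have fL: "f \<in> LF" using f fs_closure_iff[OF V] by blast
  have [measurable]: "f \<in> borel_measurable M" by (rule LF_measurable[OF fL])
  show "(\<lambda>x. \<bar>f x\<bar>) \<in> LF" using fL by (rule LF_solid) (auto intro: qsI)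
  fix e :: real assume "0 < e"
  then obtain g where g: "g \<in> fs V" "nn (\<lambda>x. f x - g x) < e" using f fs_closure_iff[OF V] by blast
  have "nn (\<lambda>x. \<bar>f x\<bar> - \<bar>g x\<bar>) \<le> nn (\<lambda>x. f x - g x)"
    using fL fs_LF[OF V g(1)] by (intro nn_mono LF_diff qsI) auto
  with g abs[OF g(1)] show "\<exists>g\<in>fs V. nn (\<lambda>x. \<bar>f x\<bar> - g x) < e"
    by (intro bexI[of _ "\<lambda>x. \<bar>g x\<bar>"]) auto
qed

lemma fs_Linf: "f \<in> fs (Linf M PP) \<longleftrightarrow> f \<in> borel_measurable M \<and>
  (\<exists>g\<in>borel_measurable M. qs (\<lambda>x. f x = g x) \<and> (\<exists>c. \<forall>x\<in>space M. \<bar>g x\<bar> \<le> c))"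
proof (cases "f \<in> borel_measurable M")
  case True
  then have "cl f \<in> L0 M PP" by (simp add: L0_eq)
  with True show ?thesis
    unfolding fs_def Linf_def Bex_def mem_Collect_eq mem_cl_iff[OF True] by blast
qed (simp add: fs_def)

lemma bounded_Linf: "f \<in> borel_measurable M \<Longrightarrow> (\<And>x. x \<in> space M \<Longrightarrow> \<bar>f x\<bar> \<le> c) \<Longrightarrow> f \<in> fs (Linf M PP)"
  unfolding fs_Linf by (auto intro!: bexI[of _ f] qsI)

end

locale robust_orlicz_Linf = robust_orlicz +
  assumes Linf_LP: "Linf M PP \<subseteq> LP"
begin

lemma bounded_LF: "f \<in> borel_measurable M \<Longrightarrow> (\<And>x. x \<in> space M \<Longrightarrow> \<bar>f x\<bar> \<le> c) \<Longrightarrow> f \<in> LF"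
  using bounded_Linf fs_LF[OF Linf_LP] by blast

lemma const_LF [simp]: "(\<lambda>_. c) \<in> LF"
  by (rule bounded_LF[where c = "\<bar>c\<bar>"]) auto

lemma Linf_subspace: "qs_subspace M PP LP (Linf M PP)"
proof (rule subspaceI[OF Linf_LP])
  show "(\<lambda>_. 0) \<in> fs (Linf M PP)" by (rule bounded_Linf[where c = 0]) auto
  fix f assume "f \<in> fs (Linf M PP)"
  then obtain f' c where f: "f \<in> borel_measurable M" "f' \<in> borel_measurable M" "qs (\<lambda>x. f x = f' x)"
    "\<And>x. x \<in> space M \<Longrightarrow> \<bar>f' x\<bar> \<le> c" unfolding fs_Linf by auto
  show "(\<lambda>x. a * f x) \<in> fs (Linf M PP)" for a
    unfolding fs_Linf
  proof (intro conjI bexI[of _ "\<lambda>x. a * f' x"] exI[of _ "\<bar>a\<bar> * c"] ballI)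
    show "qs (\<lambda>x. a * f x = a * f' x)" using f(3) by (rule qs_elim) simp
    show "\<bar>a * f' x\<bar> \<le> \<bar>a\<bar> * c" if "x \<in> space M" for x
      using f(4)[OF that] by (simp add: abs_mult mult_left_mono)
  qed (use f in auto)
  fix g assume "g \<in> fs (Linf M PP)"
  then obtain g' d where g: "g \<in> borel_measurable M" "g' \<in> borel_measurable M" "qs (\<lambda>x. g x = g' x)"
    "\<And>x. x \<in> space M \<Longrightarrow> \<bar>g' x\<bar> \<le> d" unfolding fs_Linf by auto
  show "(\<lambda>x. f x + g x) \<in> fs (Linf M PP)"
    unfolding fs_Linf
  proof (intro conjI bexI[of _ "\<lambda>x. f' x + g' x"] exI[of _ "c + d"] ballI)
    show "qs (\<lambda>x. f x + g x = f' x + g' x)" using f(3) g(3) by (rule qs_2) simp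
    show "\<bar>f' x + g' x\<bar> \<le> c + d" if "x \<in> space M" for x
      using f(4)[OF that] g(4)[OF that] by linarith
  qed (use f g in auto)
qed

lemma closure_Linf_ideal: "qs_ideal M PP LP (Phi_topology M PP \<phi> closure_of Linf M PP)" (is "qs_ideal M PP LP ?D")
  unfolding qs_ideal_def
proof (intro conjI ballI impI)
  show "qs_subspace M PP LP ?D" by (rule closure_subspace[OF Linf_subspace])
  fix X Y assume X: "X \<in> LP" and Y: "Y \<in> ?D" and le: "qs_le PP (qs_abs M PP X) (qs_abs M PP Y)"
  obtain f where f: "f \<in> LF" "X = cl f" using X by (rule LP_obtain)
  obtain g where g: "g \<in> fs ?D" "Y = cl g" using Y by (rule fs_obtain[OF closure_subset_LP])
  have [measurable]: "f \<in> borel_measurable M" "g \<in> borel_measurable M"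
    using f g by (auto intro: LF_measurable fs_measurable)
  have fg: "qs (\<lambda>x. \<bar>f x\<bar> \<le> \<bar>g x\<bar>)"
    using le unfolding f g by (simp add: qs_abs_cl[of f f] qs_abs_cl[of g g] qs_le_cl)
  have "f \<in> fs ?D"
    unfolding fs_closure_iff[OF Linf_LP]
  proof (intro conjI allI impI f)
    fix e :: real assume e: "0 < e"
    then obtain h0 where "h0 \<in> fs (Linf M PP)" and h0e: "nn (\<lambda>x. g x - h0 x) < e"
      using g(1) unfolding fs_closure_iff[OF Linf_LP] by blast
    then obtain h c where h0: "h0 \<in> borel_measurable M" and [measurable]: "h \<in> borel_measurable M"
      and eq: "qs (\<lambda>x. h0 x = h x)" and c: "\<And>x. x \<in> space M \<Longrightarrow> \<bar>h x\<bar> \<le> c"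
      unfolding fs_Linf by auto
    have "nn (\<lambda>x. g x - h x) = nn (\<lambda>x. g x - h0 x)"
      by (rule nn_cong) (rule qs_elim[OF eq], simp)
    define k where "k x = max (min (f x) \<bar>h x\<bar>) (- \<bar>h x\<bar>)" for x
    have "k \<in> fs (Linf M PP)"
    proof (rule bounded_Linf[where c = c])
      show "\<bar>k x\<bar> \<le> c" if "x \<in> space M" for x
        using c[OF that] by (auto simp: k_def)
    qed (simp add: k_def[abs_def])
    moreover have "nn (\<lambda>x. f x - k x) \<le> nn (\<lambda>x. g x - h x)"
    proof (rule nn_mono)
      show "(\<lambda>x. g x - h x) \<in> LF"
        using g(1) bounded_LF[of h c] c fs_LF[OF closure_subset_LP] by (intro LF_diff) auto
      show "qs (\<lambda>x. \<bar>f x - k x\<bar> \<le> \<bar>g x - h x\<bar>)"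
        using fg by (rule qs_elim) (auto simp: k_def)
    qed
    ultimately show "\<exists>k\<in>fs (Linf M PP). nn (\<lambda>x. f x - k x) < e"
      using h0e \<open>nn (\<lambda>x. g x - h x) = nn (\<lambda>x. g x - h0 x)\<close> by (intro bexI[of _ k]) auto
  qed
  then show "X \<in> ?D" using f cl_in by simp
qed

end

locale closed_lattice = robust_orlicz_Linf +
  fixes C :: "('a \<Rightarrow> real) set set"
  assumes C_sub: "qs_subspace M PP LP C"
    and C_abs: "\<And>f. f \<in> fs C \<Longrightarrow> (\<lambda>x. \<bar>f x\<bar>) \<in> fs C"
    and C_closed: "\<And>f. f \<in> LF \<Longrightarrow> (\<And>e. 0 < e \<Longrightarrow> \<exists>g\<in>fs C. nn (\<lambda>x. f x - g x) < e) \<Longrightarrow> f \<in> fs C"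
    and C_one: "(\<lambda>_. 1) \<in> fs C"
begin

abbreviation "CF \<equiv> fs C"

lemmas C_LP = subspace_fs(1)[OF C_sub]
  and CF_zero = subspace_fs(2)[OF C_sub]
  and CF_add = subspace_fs(3)[OF C_sub]
  and CF_scale = subspace_fs(4)[OF C_sub]

lemmas CF_LF = fs_LF[OF C_LP]

lemma CF_diff: "f \<in> CF \<Longrightarrow> g \<in> CF \<Longrightarrow> (\<lambda>x. f x - g x) \<in> CF"
  using CF_add[OF _ CF_scale[of g "-1"], of f] by simp

lemma CF_const: "(\<lambda>_. c) \<in> CF"
  using CF_scale[OF C_one, of c] by simp

lemma CF_max: "f \<in> CF \<Longrightarrow> g \<in> CF \<Longrightarrow> (\<lambda>x. max (f x) (g x)) \<in> CF"
proof -
  assume f: "f \<in> CF" and g: "g \<in> CF"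
  have "(\<lambda>x. (1/2) * ((f x + g x) + \<bar>f x - g x\<bar>)) \<in> CF"
    by (intro CF_scale CF_add C_abs CF_diff f g)
  moreover have "(\<lambda>x. (1/2) * ((f x + g x) + \<bar>f x - g x\<bar>)) = (\<lambda>x. max (f x) (g x))"
    by (auto simp: fun_eq_iff max_def)
  ultimately show ?thesis by simp
qed

lemma CF_min: "f \<in> CF \<Longrightarrow> g \<in> CF \<Longrightarrow> (\<lambda>x. min (f x) (g x)) \<in> CF"
proof -
  assume f: "f \<in> CF" and g: "g \<in> CF"
  have "(\<lambda>x. (f x + g x) - max (f x) (g x)) \<in> CF"
    by (intro CF_add CF_diff CF_max f g)
  moreover have "(\<lambda>x. (f x + g x) - max (f x) (g x)) = (\<lambda>x. min (f x) (g x))"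
    by (auto simp: fun_eq_iff max_def min_def)
  ultimately show ?thesis by simp
qed

lemma CF_sum: "finite I \<Longrightarrow> (\<And>i. i \<in> I \<Longrightarrow> f i \<in> CF) \<Longrightarrow> (\<lambda>x. \<Sum>i\<in>I. f i x) \<in> CF"
  by (induction I rule: finite_induct) (auto intro: CF_zero CF_add)

definition mono_complete :: bool where
  "mono_complete \<longleftrightarrow> (\<forall>f F u. (\<forall>n::nat. f n \<in> CF) \<longrightarrow> u \<in> CF \<longrightarrow> F \<in> borel_measurable M \<longrightarrow>
     (\<forall>x\<in>space M. (\<forall>n. f n x \<le> f (Suc n) x \<and> f n x \<le> u x) \<and> (\<lambda>n. f n x) \<longlonglongrightarrow> F x) \<longrightarrow>
     F \<in> CF \<and> (\<lambda>n. nn (\<lambda>x. F x - f n x)) \<longlonglongrightarrow> 0)"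

lemma mono_completeD:
  assumes "mono_complete" "\<And>n. f n \<in> CF" "u \<in> CF" "F \<in> borel_measurable M"
    "\<And>x n. x \<in> space M \<Longrightarrow> f n x \<le> f (Suc n) x" "\<And>x n. x \<in> space M \<Longrightarrow> f n x \<le> u x"
    "\<And>x. x \<in> space M \<Longrightarrow> (\<lambda>n. f n x) \<longlonglongrightarrow> F x"
  shows "F \<in> CF" "(\<lambda>n. nn (\<lambda>x. F x - f n x)) \<longlonglongrightarrow> 0"
  using assms unfolding mono_complete_def by blast+

lemma Cauchy_limit:
  assumes f: "\<And>n. f n \<in> CF" and F: "F \<in> borel_measurable M"
    and inc: "\<And>x n. x \<in> space M \<Longrightarrow> f n x \<le> f (Suc n) x"
    and lim: "\<And>x. x \<in> space M \<Longrightarrow> (\<lambda>n. f n x) \<longlonglongrightarrow> F x"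
    and Cauchy: "\<And>e. 0 < e \<Longrightarrow> \<exists>N. \<forall>m\<ge>N. nn (\<lambda>x. f m x - f N x) \<le> e"
  shows "F \<in> CF" "(\<lambda>n. nn (\<lambda>x. F x - f n x)) \<longlonglongrightarrow> 0"
proof -
  have le: "f n x \<le> f m x" if "x \<in> space M" "n \<le> m" for n m x
    using inc[OF that(1)] that(2) by (rule lift_Suc_mono_le)
  have leF: "f n x \<le> F x" if x: "x \<in> space M" for n x
    using lim[OF x] by (rule LIMSEQ_le_const) (use le[OF x] in blast)
  have key: "\<exists>N. (\<lambda>x. F x - f N x) \<in> LF \<and> nn (\<lambda>x. F x - f N x) \<le> e" if e: "0 < e" for e
  proof -
    obtain N where N: "\<And>m. N \<le> m \<Longrightarrow> nn (\<lambda>x. f m x - f N x) \<le> e" using Cauchy[OF e] by blast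
    have L: "(\<lambda>x. f (N + m) x - f N x) \<in> LF" for m
      by (intro CF_LF CF_diff f)
    have b: "nn (\<lambda>x. f (N + m) x - f N x) \<le> e" for m by (rule N) simp
    have meas: "(\<lambda>x. F x - f N x) \<in> borel_measurable M" using F fs_measurable[OF f] by measurable
    have "qs (\<lambda>x. (\<lambda>m. f (N + m) x - f N x) \<longlonglongrightarrow> F x - f N x)"
      by (intro qsI tendsto_diff tendsto_const)
        (simp add: add.commute[of N] LIMSEQ_ignore_initial_segment[OF lim])
    from Fatou[OF L b meas this] show ?thesis by blast
  qed
  have FL: "F \<in> LF"
  proof -
    obtain N where "(\<lambda>x. F x - f N x) \<in> LF" using key[of 1] by auto
    from LF_add(1)[OF this CF_LF[OF f[of N]]] show ?thesis by simp
  qed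
  show "F \<in> CF"
  proof (rule C_closed[OF FL])
    fix e :: real assume "0 < e"
    then obtain N where "nn (\<lambda>x. F x - f N x) \<le> e / 2" using key[of "e / 2"] half_gt_zero by blast
    then show "\<exists>g\<in>CF. nn (\<lambda>x. F x - g x) < e"
      using \<open>0 < e\<close> f[of N] by (intro bexI[of _ "f N"]) auto
  qed
  show "(\<lambda>n. nn (\<lambda>x. F x - f n x)) \<longlonglongrightarrow> 0"
  proof (rule LIMSEQ_I)
    fix e :: real assume "0 < e"
    then obtain N where N: "(\<lambda>x. F x - f N x) \<in> LF" "nn (\<lambda>x. F x - f N x) \<le> e / 2" using key[of "e / 2"] half_gt_zero by blast
    have "norm (nn (\<lambda>x. F x - f n x) - 0) < e" if "N \<le> n" for n
    proof -
      have "nn (\<lambda>x. F x - f n x) \<le> nn (\<lambda>x. F x - f N x)"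
      proof (rule nn_mono[OF N(1)], rule qsI)
        fix x assume "x \<in> space M"
        then show "\<bar>F x - f n x\<bar> \<le> \<bar>F x - f N x\<bar>" using le[of x N n] leF[of x n] that by simp
      qed
      with N(2) \<open>0 < e\<close> show ?thesis by simp
    qed
    then show "\<exists>N. \<forall>n\<ge>N. norm (nn (\<lambda>x. F x - f n x) - 0) < e" by blast
  qed
qed

text \<open>
  If the increments stayed away from zero, the suprema of the partial sums along the sets
  \<open>{k. q k < r}\<close>, where \<open>q\<close> enumerates the rationals and \<open>r\<close> is real, would form an uncountable
  uniformly separated set.
\<close>

lemma small_increment:
  assumes sep: "separable_space (subtopology (Phi_topology M PP \<phi>) C)"
    and ded: "dedekind_sigma_complete C (qs_le PP)"
    and y: "\<And>k::nat. y k \<in> CF" and y0: "\<And>k x. x \<in> space M \<Longrightarrow> 0 \<le> y k x"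
    and u: "u \<in> CF" and yu: "\<And>n x. x \<in> space M \<Longrightarrow> (\<Sum>k<n. y k x) \<le> u x"
    and e: "0 < e"
  shows "\<exists>k. nn (y k) < e"
proof (rule ccontr)
  assume "\<nexists>k. nn (y k) < e"
  then have big: "e \<le> nn (y k)" for k by (simp add: not_less)
  define part where "part S n x = (\<Sum>k\<in>S \<inter> {..<n}. y k x)" for S n x
  have part_CF: "part S n \<in> CF" for S n
    unfolding part_def[abs_def] by (intro CF_sum y) auto
  note meas = fs_measurable[OF part_CF] fs_measurable[OF u] fs_measurable[OF y]
  have part_u: "part S n x \<le> u x" if x: "x \<in> space M" for S n x
  proof -
    have "part S n x \<le> (\<Sum>k<n. y k x)"
      unfolding part_def using x y0 by (intro sum_mono2) auto
    with yu[OF x, of n] show ?thesis by linarith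
  qed
  have "\<exists>Y. is_lub_in C (qs_le PP) (range (\<lambda>n. cl (part S n))) Y" for S
  proof -
    have "range (\<lambda>n. cl (part S n)) \<subseteq> C" using part_CF cl_in by blast
    moreover have "\<forall>a\<in>range (\<lambda>n. cl (part S n)). qs_le PP a (cl u)"
      using meas by (auto simp: qs_le_cl intro: qsI part_u)
    moreover have "cl u \<in> C" by (rule cl_in[OF u])
    ultimately show ?thesis
      using ded unfolding dedekind_sigma_complete_def by (metis countable_image countableI_type image_is_empty UNIV_not_empty)
  qed
  then obtain Y where Y: "\<And>S. is_lub_in C (qs_le PP) (range (\<lambda>n. cl (part S n))) (Y S)" by metis
  have YC: "Y S \<in> C" for S using Y by (simp add: is_lub_in_def)
  have far: "e \<le> dst (Y S) (Y T)" if TS: "T \<subseteq> S" and k: "k \<in> S" "k \<notin> T" for S T k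
  proof -
    obtain s where s: "s \<in> CF" "Y S = cl s" by (rule fs_obtain[OF C_LP YC])
    obtain t where t: "t \<in> CF" "Y T = cl t" by (rule fs_obtain[OF C_LP YC])
    have up: "qs (\<lambda>x. part T n x \<le> s x - y k x)" for n
    proof -
      define m where "m = max n (Suc k)"
      have "qs_le PP (cl (part S m)) (cl s)" using Y[of S] s by (simp add: is_lub_in_def)
      then have "qs (\<lambda>x. part S m x \<le> s x)" using meas fs_measurable[OF s(1)] by (simp add: qs_le_cl)
      then show ?thesis
      proof (rule qs_elim)
        fix x assume x: "x \<in> space M" "part S m x \<le> s x"
        have "part T n x + y k x = (\<Sum>k\<in>insert k (T \<inter> {..<n}). y k x)"
          unfolding part_def using k by (subst sum.insert) auto
        also have "\<dots> \<le> part S m x"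
          unfolding part_def using k TS x y0 by (intro sum_mono2) (auto simp: m_def)
        finally show "part T n x \<le> s x - y k x" using x by simp
      qed
    qed
    have sy: "(\<lambda>x. s x - y k x) \<in> CF" by (intro CF_diff s y)
    have "qs_le PP (cl t) (cl (\<lambda>x. s x - y k x))"
      using Y[of T] up meas fs_measurable[OF sy] cl_in[OF sy] unfolding t(2) is_lub_in_def
      by (auto simp: qs_le_cl)
    then have "qs (\<lambda>x. t x \<le> s x - y k x)"
      using fs_measurable[OF t(1)] fs_measurable[OF sy] by (simp add: qs_le_cl)
    then have "qs (\<lambda>x. \<bar>y k x\<bar> \<le> \<bar>s x - t x\<bar>)"
    proof (rule qs_elim)
      fix x assume "x \<in> space M" "t x \<le> s x - y k x"
      then show "\<bar>y k x\<bar> \<le> \<bar>s x - t x\<bar>" using y0[of x k] by linarith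
    qed
    then have "nn (y k) \<le> nn (\<lambda>x. s x - t x)" by (intro nn_mono CF_LF CF_diff s t)
    with big[of k] show ?thesis using s t by (simp add: dst_cl fs_measurable)
  qed
  interpret S: Submetric LP dst C by (rule Submetric_LP[OF C_LP])
  obtain D where D: "countable D" "D \<subseteq> C" "S.sub.mtopology closure_of D = C"
    using sep unfolding separable_space_def Phi_topology_eq S.mtopology_submetric[symmetric] by auto
  have "\<exists>d\<in>D. dst X d < e / 2" if "X \<in> C" for X
  proof -
    have "X \<in> S.sub.mtopology closure_of D" using that D(3) by simp
    moreover have "0 < e / 2" using e by simp
    ultimately have "\<exists>d\<in>D. d \<in> S.sub.mball X (e / 2)"
      unfolding S.sub.metric_closure_of by blast
    then show ?thesis by auto
  qed
  then obtain g where g: "\<And>X. X \<in> C \<Longrightarrow> g X \<in> D" "\<And>X. X \<in> C \<Longrightarrow> dst X (g X) < e / 2" by metis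
  define Z where "Z r = Y {k. real_of_rat (nat_to_rat_surj k) < r}" for r
  have ZC: "Z r \<in> C" for r by (simp add: Z_def YC)
  have less: "g (Z r) \<noteq> g (Z r')" if rr: "r < r'" for r r'
  proof
    assume eq: "g (Z r) = g (Z r')"
    obtain q where "r < real_of_rat q" "real_of_rat q < r'" using of_rat_dense[OF rr] by blast
    moreover obtain k where "q = nat_to_rat_surj k" using surj_nat_to_rat_surj by (metis surj_def)
    ultimately have "e \<le> dst (Z r') (Z r)"
      unfolding Z_def using rr by (intro far[of _ _ k]) auto
    also have "\<dots> \<le> dst (Z r') (g (Z r')) + dst (g (Z r)) (Z r)"
      unfolding eq using g(1)[OF ZC] ZC D(2) C_LP by (intro LP.triangle) blast+
    also have "\<dots> < e" using g(2)[OF ZC[of r]] g(2)[OF ZC[of r']] by (simp add: dst_commute[of _ "Z r"])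
    finally show False by simp
  qed
  have "inj (\<lambda>r. g (Z r))"
    by (rule injI) (metis less linorder_neqE_linordered_idom)
  moreover have "range (\<lambda>r. g (Z r)) \<subseteq> D" using g ZC by auto
  ultimately have "countable (UNIV :: real set)"
    using D(1) countable_subset by (metis countable_image_inj_on)
  then show False using uncountable_UNIV_real by simp
qed

lemma sigma_complete_imp_mono_complete:
  assumes sep: "separable_space (subtopology (Phi_topology M PP \<phi>) C)"
    and ded: "dedekind_sigma_complete C (qs_le PP)"
  shows mono_complete
  unfolding mono_complete_def
proof (intro allI impI)
  fix f F u
  assume f: "\<forall>n::nat. f n \<in> CF" and u: "u \<in> CF" and F: "F \<in> borel_measurable M"
    and all: "\<forall>x\<in>space M. (\<forall>n. f n x \<le> f (Suc n) x \<and> f n x \<le> u x) \<and> (\<lambda>n. f n x) \<longlonglongrightarrow> F x"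
  have le: "f n x \<le> f m x" if "x \<in> space M" "n \<le> m" for n m x
    using all that by (blast intro: lift_Suc_mono_le[of "\<lambda>n. f n x"])
  have Cauchy: "\<exists>N. \<forall>m\<ge>N. nn (\<lambda>x. f m x - f N x) \<le> e" if e: "0 < e" for e
  proof (rule ccontr)
    assume "\<nexists>N. \<forall>m\<ge>N. nn (\<lambda>x. f m x - f N x) \<le> e"
    then have "\<forall>N. \<exists>m\<ge>N. e < nn (\<lambda>x. f m x - f N x)" by (auto simp: not_le)
    then obtain r where r: "\<And>N. N \<le> r N" "\<And>N. e < nn (\<lambda>x. f (r N) x - f N x)" by metis
    define i where "i k = (r ^^ k) 0" for k
    have i: "i (Suc k) = r (i k)" for k by (simp add: i_def)
    define y where "y k x = f (i (Suc k)) x - f (i k) x" for k x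
    have "\<exists>k. nn (y k) < e"
    proof (rule small_increment[OF sep ded])
      show "y k \<in> CF" for k unfolding y_def[abs_def] using f by (intro CF_diff) auto
      show "0 \<le> y k x" if "x \<in> space M" for k x using le[OF that r(1)[of "i k"]] by (simp add: y_def i)
      show "(\<lambda>x. u x - f (i 0) x) \<in> CF" using f u by (intro CF_diff) auto
      show "(\<Sum>k<n. y k x) \<le> u x - f (i 0) x" if "x \<in> space M" for n x
        unfolding y_def using sum_lessThan_telescope[of "\<lambda>k. f (i k) x" n] all that by simp
    qed (rule e)
    then obtain k where "nn (y k) < e" by blast
    with r(2)[of "i k"] show False by (simp add: y_def[abs_def] i)
  qed
  show "F \<in> CF \<and> (\<lambda>n. nn (\<lambda>x. F x - f n x)) \<longlonglongrightarrow> 0"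
    using Cauchy_limit[of f F] f F all Cauchy by blast
qed

end

context closed_lattice
begin

lemma CF_cong: "f \<in> CF \<Longrightarrow> g \<in> borel_measurable M \<Longrightarrow> (\<And>x. x \<in> space M \<Longrightarrow> f x = g x) \<Longrightarrow> g \<in> CF"
  by (rule fs_cong[of f]) (auto intro: qsI)

lemma Linf_subset:
  assumes HC: "H \<subseteq> C" and gen: "generates_sigma M PP H"
    and bmono: "\<And>f F. (\<And>n::nat. f n \<in> CF) \<Longrightarrow> F \<in> borel_measurable M \<Longrightarrow>
      (\<And>x n. x \<in> space M \<Longrightarrow> 0 \<le> f n x \<and> f n x \<le> f (Suc n) x \<and> f n x \<le> 1) \<Longrightarrow>
      (\<And>x. x \<in> space M \<Longrightarrow> (\<lambda>n. f n x) \<longlonglongrightarrow> F x) \<Longrightarrow> F \<in> CF"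
  shows "Linf M PP \<subseteq> C"
proof -
  define \<A> where "\<A> = {A \<in> sets M. (indicator A :: 'a \<Rightarrow> real) \<in> CF}"
  have \<A>_sets: "A \<in> \<A> \<Longrightarrow> A \<in> sets M" for A by (simp add: \<A>_def)
  have sa: "sigma_algebra (space M) \<A>"
    unfolding sigma_algebra_iff2
  proof (intro conjI ballI allI impI)
    show "\<A> \<subseteq> Pow (space M)" using sets.sets_into_space by (auto simp: \<A>_def)
    have "(indicator {} :: 'a \<Rightarrow> real) = (\<lambda>_. 0)" by (auto simp: fun_eq_iff)
    then show "{} \<in> \<A>" using CF_zero by (simp add: \<A>_def)
    show "space M - A \<in> \<A>" if A: "A \<in> \<A>" for A
    proof -
      have "(\<lambda>x. 1 - indicator A x :: real) \<in> CF"
        using A by (intro CF_diff C_one) (simp add: \<A>_def)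
      then have "(indicator (space M - A) :: 'a \<Rightarrow> real) \<in> CF"
        by (rule CF_cong) (use \<A>_sets[OF A] in \<open>auto split: split_indicator\<close>)
      with \<A>_sets[OF A] show ?thesis by (simp add: \<A>_def)
    qed
    fix A :: "nat \<Rightarrow> 'a set" assume A: "range A \<subseteq> \<A>"
    then have [measurable]: "A i \<in> sets M" for i using \<A>_sets by auto
    have fin: "(indicator (\<Union>i<n. A i) :: 'a \<Rightarrow> real) \<in> CF" for n
    proof (induction n)
      case 0
      have "(indicator {} :: 'a \<Rightarrow> real) = (\<lambda>_. 0)" by (auto simp: fun_eq_iff)
      then show ?case using CF_zero by simp
    next
      case (Suc n)
      have "(indicator (A n) :: 'a \<Rightarrow> real) \<in> CF" using A by (auto simp: \<A>_def)
      then have "(\<lambda>x. max (indicator (\<Union>i<n. A i) x) (indicator (A n) x) :: real) \<in> CF"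
        by (intro CF_max Suc)
      then show ?case by (rule CF_cong) (auto simp: lessThan_Suc split: split_indicator)
    qed
    have "(indicator (\<Union>i. A i) :: 'a \<Rightarrow> real) \<in> CF"
    proof (rule bmono[of "\<lambda>n. indicator (\<Union>i<n. A i)", OF fin])
      show "(\<lambda>n. indicator (\<Union>i<n. A i) x :: real) \<longlonglongrightarrow> indicator (\<Union>i. A i) x" for x
        by (rule LIMSEQ_indicator_UN)
    qed (auto split: split_indicator intro: less_SucI)
    then show "(\<Union>i. A i) \<in> \<A>" by (simp add: \<A>_def)
  qed
  define N where "N = sigma (space M) \<A>"
  have N: "space N = space M" "sets N = \<A>"
    using sa by (auto simp: N_def sigma_algebra.sets_measure_of_eq space_measure_of_conv)
  have meas: "f \<in> borel_measurable N" if f: "f \<in> CF" for f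
    unfolding borel_measurable_iff_greater N
  proof
    fix a
    have [measurable]: "f \<in> borel_measurable M" by (rule fs_measurable[OF f])
    have S: "{w \<in> space M. a < f w} \<in> sets M" by measurable
    have "(indicator {w \<in> space M. a < f w} :: 'a \<Rightarrow> real) \<in> CF"
    proof (rule bmono[of "\<lambda>n x. min 1 (real n * max (f x - a) 0)"])
      show "(\<lambda>x. min 1 (real n * max (f x - a) 0)) \<in> CF" for n
        by (intro CF_min CF_scale CF_max CF_diff CF_const f CF_zero)
      fix x assume x: "x \<in> space M"
      show "0 \<le> min 1 (real n * max (f x - a) 0) \<and>
        min 1 (real n * max (f x - a) 0) \<le> min 1 (real (Suc n) * max (f x - a) 0) \<and>
        min 1 (real n * max (f x - a) 0) \<le> 1" for n
        by (intro conjI min.mono mult_right_mono) auto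
      show "(\<lambda>n. min 1 (real n * max (f x - a) 0)) \<longlonglongrightarrow> indicator {w \<in> space M. a < f w} x"
      proof (cases "a < f x")
        case True
        then obtain n0 :: nat where n0: "1 < real n0 * (f x - a)"
          using reals_Archimedean3[of "f x - a"] by auto
        have "\<forall>\<^sub>F n in sequentially. min 1 (real n * max (f x - a) 0) = 1"
          using eventually_ge_at_top[of n0]
        proof eventually_elim
          case (elim n)
          have "real n0 * (f x - a) \<le> real n * (f x - a)" using elim True by (intro mult_right_mono) auto
          then have "1 \<le> real n * (f x - a)" using n0 by linarith
          then show ?case using True by (simp add: max_absorb1 min_absorb1)
        qed
        then show ?thesis using True x by (simp add: tendsto_eventually)
      next
        case False
        then show ?thesis by simp
      qed
    qed (use S in simp)
    with S show "{w \<in> space M. a < f w} \<in> \<A>" by (simp add: \<A>_def)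
  qed
  have "sets M \<subseteq> \<A>"
  proof -
    have "sigma_sets (space M) {f -` B \<inter> space M | f B.
       f \<in> borel_measurable M \<and> cl f \<in> H \<and> B \<in> sets borel} \<subseteq> \<A>"
    proof (rule sigma_algebra.sigma_sets_subset[OF sa], clarsimp)
      fix f and B :: "real set" assume "f \<in> borel_measurable M" "cl f \<in> H" "B \<in> sets borel"
      then have "f \<in> borel_measurable N" using HC by (intro meas) (auto simp: fs_def)
      from measurable_sets[OF this \<open>B \<in> sets borel\<close>] show "f -` B \<inter> space M \<in> \<A>"
        by (simp add: N)
    qed
    then show ?thesis using gen by (simp add: generates_sigma_def)
  qed
  then have ind: "(indicator A :: 'a \<Rightarrow> real) \<in> CF" if "A \<in> sets M" for A
    using that by (auto simp: \<A>_def)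
  have pos: "(\<exists>c. \<forall>x\<in>space M. u x \<le> c) \<longrightarrow> u \<in> CF"
    if u: "u \<in> borel_measurable M" "\<And>x. 0 \<le> u x" for u
    using u
  proof (induction rule: borel_measurable_induct_real)
    case (set A)
    then show ?case by (simp add: ind)
  next
    case (mult u c)
    show ?case
    proof (cases "c = 0")
      case False
      then have "0 < c" using mult by simp
      show ?thesis
      proof
        assume "\<exists>b. \<forall>x\<in>space M. c * u x \<le> b"
        then obtain b where "\<And>x. x \<in> space M \<Longrightarrow> c * u x \<le> b" by blast
        then have "\<forall>x\<in>space M. u x \<le> b / c" using \<open>0 < c\<close> by (simp add: field_simps)
        with mult show "(\<lambda>x. c * u x) \<in> CF" by (blast intro: CF_scale)
      qed
    qed (simp add: CF_zero)
  next
    case (add u v)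
    show ?case
    proof
      assume "\<exists>b. \<forall>x\<in>space M. v x + u x \<le> b"
      then obtain b where b: "\<And>x. x \<in> space M \<Longrightarrow> v x + u x \<le> b" by blast
      have uv0: "\<And>x. 0 \<le> u x" "\<And>x. 0 \<le> v x" using add by blast+
      have "u x \<le> b" "v x \<le> b" if "x \<in> space M" for x
        using b[OF that] uv0[of x] by linarith+
      with add show "(\<lambda>x. v x + u x) \<in> CF" by (blast intro: CF_add)
    qed
  next
    case (seq U)
    have inc: "U n x \<le> U (Suc n) x" for n x using seq by (auto simp: incseq_def le_fun_def)
    have U0: "0 \<le> U n x" for n x using seq by blast
    have Ulim: "(\<lambda>i. U i x) \<longlonglongrightarrow> u x" if "x \<in> space M" for x using seq that by blast
    have UC': "U i \<in> CF" if "\<exists>c. \<forall>x\<in>space M. U i x \<le> c" for i using seq that by blast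
    show ?case
    proof
      assume "\<exists>b. \<forall>x\<in>space M. u x \<le> b"
      then obtain b0 where b0: "\<And>x. x \<in> space M \<Longrightarrow> u x \<le> b0" by blast
      define b where "b = max b0 1"
      have b: "0 < b" "\<And>x. x \<in> space M \<Longrightarrow> u x \<le> b" using b0 by (force simp: b_def)+
      have Uu: "U i x \<le> u x" if "x \<in> space M" for i x
        using inc Ulim[OF that] by (intro incseq_le[of "\<lambda>i. U i x"]) (auto intro: incseq_SucI)
      then have UC: "U i \<in> CF" for i using b(2) by (blast intro: UC' order_trans)
      have "(\<lambda>x. 1 / b * u x) \<in> CF"
      proof (rule bmono[of "\<lambda>n x. 1 / b * U n x"])
        show "(\<lambda>x. 1 / b * U n x) \<in> CF" for n by (rule CF_scale[OF UC])
        show "(\<lambda>x. 1 / b * u x) \<in> borel_measurable M" using u by measurable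
        fix x assume x: "x \<in> space M"
        show "(\<lambda>n. 1 / b * U n x) \<longlonglongrightarrow> 1 / b * u x" by (intro tendsto_intros Ulim[OF x])
        fix n
        show "0 \<le> 1 / b * U n x \<and> 1 / b * U n x \<le> 1 / b * U (Suc n) x \<and> 1 / b * U n x \<le> 1"
          using b(1) b(2)[OF x] Uu[OF x, of n] U0[of n x] inc[of n x] by (auto simp: divide_right_mono)
      qed
      from CF_scale[OF this, of b] show "u \<in> CF" using b(1) by simp
    qed
  qed
  have "fs (Linf M PP) \<subseteq> CF"
  proof
    fix f assume "f \<in> fs (Linf M PP)"
    then obtain g c where f: "f \<in> borel_measurable M" and [measurable]: "g \<in> borel_measurable M"
      and fg: "qs (\<lambda>x. f x = g x)" and c: "\<And>x. x \<in> space M \<Longrightarrow> \<bar>g x\<bar> \<le> c"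
      unfolding fs_Linf by auto
    have "max (g x) 0 \<le> c \<and> max (- g x) 0 \<le> c" if "x \<in> space M" for x using c[OF that] by linarith
    then have "(\<lambda>x. max (g x) 0) \<in> CF" "(\<lambda>x. max (- g x) 0) \<in> CF"
      by (intro pos[rule_format] exI[of _ c] ballI; simp)+
    then have "(\<lambda>x. max (g x) 0 - max (- g x) 0) \<in> CF" by (rule CF_diff)
    moreover have "(\<lambda>x. max (g x) 0 - max (- g x) 0) = g" by (auto simp: fun_eq_iff)
    ultimately have gC: "g \<in> CF" by simp
    have "qs (\<lambda>x. g x = f x)" using fg by (rule qs_elim) simp
    then show "f \<in> CF" by (rule fs_cong[OF gC f])
  qed
  then show ?thesis by (subst fs_subset_iff[OF Linf_LP C_LP])
qed

lemma closure_Linf_eq: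
  assumes mc: mono_complete and sub: "Linf M PP \<subseteq> C"
  shows "C = Phi_topology M PP \<phi> closure_of Linf M PP" (is "C = ?D")
proof -
  have DL: "?D \<subseteq> LP" by (rule closure_subset_LP)
  note D_sub = subspace_fs[OF closure_subspace[OF Linf_subspace]]
  have "fs ?D \<subseteq> CF"
  proof
    fix f assume "f \<in> fs ?D"
    then have "f \<in> LF" "\<And>e. 0 < e \<Longrightarrow> \<exists>g\<in>fs (Linf M PP). nn (\<lambda>x. f x - g x) < e"
      using fs_closure_iff[OF Linf_LP] by blast+
    then show "f \<in> CF" using sub fs_subset_iff[OF Linf_LP C_LP] by (intro C_closed) blast+
  qed
  moreover have pos: "f \<in> fs ?D" if f: "f \<in> CF" and f0: "\<And>x. x \<in> space M \<Longrightarrow> 0 \<le> f x" for f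
    unfolding fs_closure_iff[OF Linf_LP]
  proof (intro conjI allI impI CF_LF f)
    fix e :: real assume e: "0 < e"
    have [measurable]: "f \<in> borel_measurable M" by (rule fs_measurable[OF f])
    have "(\<lambda>n. nn (\<lambda>x. f x - min (f x) (real n))) \<longlonglongrightarrow> 0"
    proof (rule mono_completeD(2)[OF mc])
      show "(\<lambda>x. min (f x) (real n)) \<in> CF" for n by (intro CF_min f CF_const)
      fix x
      obtain n0 where n0: "f x < real n0" using reals_Archimedean2 by blast
      have "\<forall>\<^sub>F n in sequentially. min (f x) (real n) = f x"
        using eventually_ge_at_top[of n0] by eventually_elim (use n0 in auto)
      then show "(\<lambda>n. min (f x) (real n)) \<longlonglongrightarrow> f x" by (rule tendsto_eventually)
    qed (use f in auto)
    from LIMSEQ_D[OF this e] obtain n where "norm (nn (\<lambda>x. f x - min (f x) (real n)) - 0) < e"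
      by blast
    moreover have "(\<lambda>x. min (f x) (real n)) \<in> fs (Linf M PP)"
      using f0 by (intro bounded_Linf[where c = "real n"]) auto
    ultimately show "\<exists>g\<in>fs (Linf M PP). nn (\<lambda>x. f x - g x) < e" by (intro bexI[of _ "\<lambda>x. min (f x) (real n)"]) auto
  qed
  have "CF \<subseteq> fs ?D"
  proof
    fix f assume f: "f \<in> CF"
    have "(\<lambda>x. max (f x) 0) \<in> fs ?D" "(\<lambda>x. max (- f x) 0) \<in> fs ?D"
      using CF_max[OF f CF_zero] CF_max[OF CF_scale[OF f, of "-1"] CF_zero] by (auto intro!: pos)
    from D_sub(3)[OF this(1) D_sub(4)[OF this(2), of "-1"]]
    have "(\<lambda>x. max (f x) 0 + - 1 * max (- f x) 0) \<in> fs ?D" .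
    moreover have "(\<lambda>x. max (f x) 0 + - 1 * max (- f x) 0) = f" by (auto simp: fun_eq_iff)
    ultimately show "f \<in> fs ?D" by simp
  qed
  ultimately show ?thesis using fs_eq_iff[OF C_LP DL] by blast
qed

lemma ideal_iff:
  "qs_ideal M PP LP C \<longleftrightarrow> (\<forall>f g. f \<in> borel_measurable M \<longrightarrow> g \<in> CF \<longrightarrow> qs (\<lambda>x. \<bar>f x\<bar> \<le> \<bar>g x\<bar>) \<longrightarrow> f \<in> CF)"
proof
  assume I: "qs_ideal M PP LP C"
  show "\<forall>f g. f \<in> borel_measurable M \<longrightarrow> g \<in> CF \<longrightarrow> qs (\<lambda>x. \<bar>f x\<bar> \<le> \<bar>g x\<bar>) \<longrightarrow> f \<in> CF"
  proof (intro allI impI)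
    fix f g assume f [measurable]: "f \<in> borel_measurable M" and g: "g \<in> CF" and le: "qs (\<lambda>x. \<bar>f x\<bar> \<le> \<bar>g x\<bar>)"
    have [measurable]: "g \<in> borel_measurable M" by (rule fs_measurable[OF g])
    have "f \<in> LF" by (rule LF_solid[OF CF_LF[OF g] f le])
    then have "cl f \<in> LP" by (simp add: cl_LP_iff)
    moreover have "qs_le PP (qs_abs M PP (cl f)) (qs_abs M PP (cl g))"
      using le by (simp add: qs_abs_cl[of f f] qs_abs_cl[of g g] qs_le_cl)
    ultimately have "cl f \<in> C" using I cl_in[OF g] unfolding qs_ideal_def by blast
    then show "f \<in> CF" by (simp add: fs_def)
  qed
next
  assume I: "\<forall>f g. f \<in> borel_measurable M \<longrightarrow> g \<in> CF \<longrightarrow> qs (\<lambda>x. \<bar>f x\<bar> \<le> \<bar>g x\<bar>) \<longrightarrow> f \<in> CF"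
  show "qs_ideal M PP LP C"
    unfolding qs_ideal_def
  proof (intro conjI ballI impI C_sub)
    fix X Y assume X: "X \<in> LP" and Y: "Y \<in> C" and le: "qs_le PP (qs_abs M PP X) (qs_abs M PP Y)"
    obtain f where f: "f \<in> LF" "X = cl f" using X by (rule LP_obtain)
    obtain g where g: "g \<in> CF" "Y = cl g" using Y by (rule fs_obtain[OF C_LP])
    have [measurable]: "f \<in> borel_measurable M" "g \<in> borel_measurable M"
      using f g by (auto intro: LF_measurable fs_measurable)
    have "qs (\<lambda>x. \<bar>f x\<bar> \<le> \<bar>g x\<bar>)"
      using le unfolding f g by (simp add: qs_abs_cl[of f f] qs_abs_cl[of g g] qs_le_cl)
    then have "f \<in> CF" using I g by auto
    then show "X \<in> C" using f cl_in by simp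
  qed
qed

lemma ideal_imp_sigma_complete:
  assumes I: "qs_ideal M PP LP C"
  shows "dedekind_sigma_complete C (qs_le PP)"
  unfolding dedekind_sigma_complete_def
proof (intro allI impI, elim conjE bexE)
  fix A U assume A: "A \<subseteq> C" "A \<noteq> {}" "countable A" and U: "U \<in> C" "\<forall>a\<in>A. qs_le PP a U"
  obtain u where u: "u \<in> CF" "U = cl u" using U(1) by (rule fs_obtain[OF C_LP])
  define X where "X = from_nat_into A"
  have XA: "range X = A" unfolding X_def using A by (intro range_from_nat_into)
  define f where "f n = rep (X n)" for n
  have f: "f n \<in> CF" "cl (f n) = X n" for n
    using XA A(1) rep_fs[OF C_LP] cl_rep[OF C_LP] by (auto simp: f_def)
  have [measurable]: "u \<in> borel_measurable M" "f n \<in> borel_measurable M" for n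
    using u f by (auto intro: fs_measurable)
  have fu: "qs (\<lambda>x. f n x \<le> u x)" for n
    using U(2) XA f(2)[of n] u by (auto simp flip: qs_le_cl)
  define s where "s x = (SUP n. min (f n x) (u x))" for x
  have bdd: "bdd_above (range (\<lambda>n. min (f n x) (u x)))" for x
    by (rule bdd_aboveI[of _ "u x"]) auto
  have s_meas [measurable]: "s \<in> borel_measurable M"
    unfolding s_def[abs_def] by (rule borel_measurable_cSUP) (use bdd in auto)
  have s_ge: "min (f n x) (u x) \<le> s x" for n x
    unfolding s_def by (rule cSUP_upper[OF _ bdd]) simp
  have s_le: "s x \<le> c" if "\<And>n. min (f n x) (u x) \<le> c" for x c
    unfolding s_def by (rule cSUP_least) (use that in auto)
  have "s \<in> CF"
  proof -
    have "(\<lambda>x. \<bar>f 0 x\<bar> + \<bar>u x\<bar>) \<in> CF" by (intro CF_add C_abs f u)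
    moreover have "qs (\<lambda>x. \<bar>s x\<bar> \<le> \<bar>\<bar>f 0 x\<bar> + \<bar>u x\<bar>\<bar>)"
    proof (rule qsI)
      fix x
      have "s x \<le> u x" by (rule s_le) simp
      with s_ge[of 0 x] show "\<bar>s x\<bar> \<le> \<bar>\<bar>f 0 x\<bar> + \<bar>u x\<bar>\<bar>" by linarith
    qed
    ultimately show ?thesis using I s_meas unfolding ideal_iff by blast
  qed
  moreover have "qs_le PP a (cl s)" if a: "a \<in> A" for a
  proof -
    obtain n where n: "a = cl (f n)" using a XA f(2) by auto
    have "qs (\<lambda>x. f n x \<le> s x)"
      using fu[of n]
    proof (rule qs_elim)
      show "f n x \<le> s x" if "f n x \<le> u x" for x using s_ge[of n x] that by simp
    qed
    then show ?thesis by (simp add: n qs_le_cl)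
  qed
  moreover have "qs_le PP (cl s) V" if V: "V \<in> C" "\<forall>a\<in>A. qs_le PP a V" for V
  proof -
    obtain v where v: "v \<in> CF" "V = cl v" using V(1) by (rule fs_obtain[OF C_LP])
    have [measurable]: "v \<in> borel_measurable M" by (rule fs_measurable[OF v(1)])
    have "qs (\<lambda>x. f n x \<le> v x)" for n
      using V(2) XA f(2)[of n] v by (auto simp flip: qs_le_cl)
    then have "qs (\<lambda>x. \<forall>n. f n x \<le> v x)" by (rule qs_all)
    then have "qs (\<lambda>x. s x \<le> v x)"
      by (rule qs_elim) (auto intro!: s_le simp: min_le_iff_disj)
    then show ?thesis by (simp add: v qs_le_cl)
  qed
  ultimately show "\<exists>S. is_lub_in C (qs_le PP) A S"
    by (intro exI[of _ "cl s"]) (auto simp: is_lub_in_def cl_in)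
qed

text \<open>
  A sequence of finite suprema along which the strictly positive functional approaches its least
  upper bound already determines the supremum.
\<close>

lemma sigma_complete_imp_super:
  fixes I :: "('a \<Rightarrow> real) \<Rightarrow> real"
  assumes ded: "dedekind_sigma_complete C (qs_le PP)"
    and I_diff: "\<And>f g. f \<in> CF \<Longrightarrow> g \<in> CF \<Longrightarrow> I (\<lambda>x. f x - g x) = I f - I g"
    and I_nonneg: "\<And>f. f \<in> CF \<Longrightarrow> qs (\<lambda>x. 0 \<le> f x) \<Longrightarrow> 0 \<le> I f"
    and I_strict: "\<And>f. f \<in> CF \<Longrightarrow> qs (\<lambda>x. 0 \<le> f x) \<Longrightarrow> I f \<le> 0 \<Longrightarrow> qs (\<lambda>x. f x = 0)"
  shows "super_dedekind_complete C (qs_le PP)"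
proof -
  let ?lub = "is_lub_in C (qs_le PP)"
  have I_mono: "I f \<le> I g" if "f \<in> CF" "g \<in> CF" "qs (\<lambda>x. f x \<le> g x)" for f g
  proof -
    have "qs (\<lambda>x. 0 \<le> g x - f x)" using that(3) by (rule qs_elim) simp
    then show ?thesis using I_nonneg[OF CF_diff[OF that(2,1)]] I_diff[OF that(2,1)] by simp
  qed
  have trans: "qs_le PP X Z" if X: "X \<in> C" and Y: "Y \<in> C" and Z: "Z \<in> C"
    and le: "qs_le PP X Y" "qs_le PP Y Z" for X Y Z
  proof -
    obtain x where x: "x \<in> CF" "X = cl x" using X by (rule fs_obtain[OF C_LP])
    obtain y where y: "y \<in> CF" "Y = cl y" using Y by (rule fs_obtain[OF C_LP])
    obtain z where z: "z \<in> CF" "Z = cl z" using Z by (rule fs_obtain[OF C_LP])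
    have "qs (\<lambda>w. x w \<le> y w)" "qs (\<lambda>w. y w \<le> z w)"
      using le x y z by (auto simp: qs_le_cl fs_measurable)
    then have "qs (\<lambda>w. x w \<le> z w)" by (rule qs_2) simp
    then show ?thesis using x z by (simp add: qs_le_cl fs_measurable)
  qed
  have key: "\<exists>B\<subseteq>A. B \<noteq> {} \<and> countable B \<and> (\<exists>S. ?lub A S \<and> ?lub B S)"
    if A: "A \<subseteq> C" "A \<noteq> {}" and U: "U \<in> C" "\<forall>a\<in>A. qs_le PP a U" for A U
  proof -
    obtain u where u: "u \<in> CF" "U = cl u" using U(1) by (rule fs_obtain[OF C_LP])
    have [measurable]: "u \<in> borel_measurable M" by (rule fs_measurable[OF u(1)])
    define G where "G = {g \<in> CF. \<exists>B\<subseteq>A. finite B \<and> ?lub B (cl g)}"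
    have G_single: "a \<in> G" if "a \<in> CF" "cl a \<in> A" for a
      using that by (auto simp: G_def is_lub_in_def qs_le_cl fs_measurable cl_in intro!: exI[of _ "{cl a}"] qsI)
    have G_max: "(\<lambda>x. max (g x) (a x)) \<in> G" if g: "g \<in> G" and a: "a \<in> CF" "cl a \<in> A" for g a
    proof -
      obtain B where B: "B \<subseteq> A" "finite B" "?lub B (cl g)" and gC: "g \<in> CF" using g by (auto simp: G_def)
      have [measurable]: "g \<in> borel_measurable M" "a \<in> borel_measurable M"
        using gC a by (auto intro: fs_measurable)
      have mC: "(\<lambda>x. max (g x) (a x)) \<in> CF" by (rule CF_max[OF gC a(1)])
      have "?lub (insert (cl a) B) (cl (\<lambda>x. max (g x) (a x)))"
        unfolding is_lub_in_def
      proof (intro conjI ballI impI cl_in mC)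
        have le1: "qs_le PP (cl g) (cl (\<lambda>x. max (g x) (a x)))" and le2: "qs_le PP (cl a) (cl (\<lambda>x. max (g x) (a x)))"
          by (auto simp: qs_le_cl intro: qsI)
        fix b assume "b \<in> insert (cl a) B"
        then show "qs_le PP b (cl (\<lambda>x. max (g x) (a x)))"
          using le1 le2 B A trans[of b "cl g"] cl_in[OF mC] cl_in[OF gC] by (auto simp: is_lub_in_def)
      next
        fix V assume V: "V \<in> C" "\<forall>b\<in>insert (cl a) B. qs_le PP b V"
        obtain v where v: "v \<in> CF" "V = cl v" using V(1) by (rule fs_obtain[OF C_LP])
        have [measurable]: "v \<in> borel_measurable M" by (rule fs_measurable[OF v(1)])
        have "qs_le PP (cl g) V" using V B(3) by (auto simp: is_lub_in_def)
        then have "qs (\<lambda>x. g x \<le> v x)" "qs (\<lambda>x. a x \<le> v x)"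
          using V by (auto simp: v qs_le_cl)
        then have "qs (\<lambda>x. max (g x) (a x) \<le> v x)" by (rule qs_2) simp
        then show "qs_le PP (cl (\<lambda>x. max (g x) (a x))) V" by (simp add: v qs_le_cl)
      qed
      with B(1,2) a mC show ?thesis
        unfolding G_def by (intro CollectI conjI exI[of _ "insert (cl a) B"]) auto
    qed
    have G_u: "qs (\<lambda>x. g x \<le> u x)" if g: "g \<in> G" for g
    proof -
      obtain B where B: "B \<subseteq> A" "?lub B (cl g)" and gC: "g \<in> CF" using g by (auto simp: G_def)
      have "qs_le PP (cl g) U" using B U unfolding is_lub_in_def by blast
      then show ?thesis using gC by (simp add: u qs_le_cl fs_measurable)
    qed
    have GC: "g \<in> CF" if "g \<in> G" for g using that by (simp add: G_def)
    define \<alpha> where "\<alpha> = (SUP g\<in>G. I g)"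
    have bddG: "bdd_above (I ` G)"
      by (rule bdd_aboveI[of _ "I u"]) (auto intro: I_mono GC G_u u)
    obtain a0 where a0: "a0 \<in> CF" "cl a0 \<in> A" using A rep_fs[OF C_LP] cl_rep[OF C_LP] by (metis subsetD ex_in_conv)
    have G0: "G \<noteq> {}" using G_single[OF a0] by blast
    have "\<exists>g\<in>G. \<alpha> - 1 / Suc n < I g" for n
      using less_cSUP_iff[OF G0 bddG, of "\<alpha> - 1 / Suc n"] by (simp add: \<alpha>_def)
    then obtain g where g: "\<And>n. g n \<in> G" "\<And>n. \<alpha> - 1 / Suc n < I (g n)" by metis
    have "\<exists>B. B \<subseteq> A \<and> finite B \<and> ?lub B (cl (g n))" for n using g(1)[of n] by (auto simp: G_def)
    then obtain B where B: "\<And>n. B n \<subseteq> A" "\<And>n. finite (B n)" "\<And>n. ?lub (B n) (cl (g n))" by metis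
    define BB where "BB = insert (cl a0) (\<Union>n. B n)"
    have BBA: "BB \<subseteq> A" using B a0 by (auto simp: BB_def)
    have cBB: "countable BB" unfolding BB_def using countable_finite[OF B(2)] by simp
    have BBne: "BB \<noteq> {}" by (simp add: BB_def)
    have BBC: "BB \<subseteq> C" using BBA A(1) by blast
    have "\<exists>u\<in>C. \<forall>a\<in>BB. qs_le PP a u" using U BBA by blast
    then obtain S where S: "?lub BB S"
      using ded BBC BBne cBB unfolding dedekind_sigma_complete_def by blast
    then have SC: "S \<in> C" by (simp add: is_lub_in_def)
    obtain s where s: "s \<in> CF" "S = cl s" using SC by (rule fs_obtain[OF C_LP])
    have [measurable]: "s \<in> borel_measurable M" by (rule fs_measurable[OF s(1)])
    have gs: "qs (\<lambda>x. g n x \<le> s x)" for n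
    proof -
      have "\<forall>b\<in>BB. qs_le PP b S" using S unfolding is_lub_in_def by blast
      then have "\<forall>b\<in>B n. qs_le PP b S" unfolding BB_def by blast
      then have "qs_le PP (cl (g n)) S" using B(3)[of n] SC unfolding is_lub_in_def by blast
      then show ?thesis using fs_measurable[OF GC[OF g(1)], of n] by (simp add: s qs_le_cl)
    qed
    have upper: "qs_le PP X S" if X: "X \<in> A" for X
    proof -
      have XC: "X \<in> C" using X A(1) by blast
      obtain a where a: "a \<in> CF" "X = cl a" using XC by (rule fs_obtain[OF C_LP])
      have [measurable]: "a \<in> borel_measurable M" by (rule fs_measurable[OF a(1)])
      define p where "p x = max (a x - s x) 0" for x
      have p: "p \<in> CF" unfolding p_def[abs_def] by (intro CF_max CF_diff a s CF_zero)
      have p0: "qs (\<lambda>x. 0 \<le> p x)" by (rule qsI) (simp add: p_def)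
      have "I p \<le> 1 / Suc n" for n
      proof -
        have m: "(\<lambda>x. max (g n x) (a x)) \<in> G" using X a by (intro G_max g) auto
        have "I p \<le> I (\<lambda>x. max (g n x) (a x) - g n x)"
        proof (intro I_mono p CF_diff GC m g)
          show "qs (\<lambda>x. p x \<le> max (g n x) (a x) - g n x)"
            using gs[of n] by (rule qs_elim) (auto simp: p_def)
        qed
        also have "\<dots> = I (\<lambda>x. max (g n x) (a x)) - I (g n)" by (intro I_diff GC m g)
        also have "I (\<lambda>x. max (g n x) (a x)) \<le> \<alpha>" unfolding \<alpha>_def by (rule cSUP_upper[OF m bddG])
        finally show ?thesis using g(2)[of n] by linarith
      qed
      moreover have "(\<lambda>n. 1 / real (Suc n)) \<longlonglongrightarrow> 0" using LIMSEQ_inverse_real_of_nat by (simp add: inverse_eq_divide)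
      ultimately have "I p \<le> 0" by (intro LIMSEQ_le_const[of _ 0 "I p"]) auto
      then have "qs (\<lambda>x. p x = 0)" by (rule I_strict[OF p p0])
      then have "qs (\<lambda>x. a x \<le> s x)" by (rule qs_elim) (simp add: p_def max_def split: if_splits)
      then show ?thesis by (simp add: a s qs_le_cl)
    qed
    have "?lub A S"
      using S upper SC BBA unfolding is_lub_in_def by blast
    with S BBA BBne cBB show ?thesis by blast
  qed
  show ?thesis
    unfolding super_dedekind_complete_def dedekind_complete_def
  proof (intro conjI allI impI; elim conjE)
    fix A assume "A \<subseteq> C" "A \<noteq> {}" "\<exists>u\<in>C. \<forall>a\<in>A. qs_le PP a u"
    then show "\<exists>s. ?lub A s" using key by blast
  next
    fix A S' assume A: "A \<subseteq> C" "A \<noteq> {}" and S': "?lub A S'"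
    then obtain B S where B: "B \<subseteq> A" "B \<noteq> {}" "countable B" "?lub A S" "?lub B S"
      using key[of A S'] by (auto simp: is_lub_in_def)
    have SS: "S' \<in> C" "S \<in> C" "qs_le PP S' S" using S' B by (auto simp: is_lub_in_def)
    have "?lub B S'"
      unfolding is_lub_in_def
    proof (intro conjI ballI impI SS)
      show "qs_le PP b S'" if "b \<in> B" for b using that B S' by (auto simp: is_lub_in_def)
      fix V assume V: "V \<in> C" "\<forall>b\<in>B. qs_le PP b V"
      then have "qs_le PP S V" using B by (auto simp: is_lub_in_def)
      then show "qs_le PP S' V" using SS V by (rule_tac trans[of S' S V]) auto
    qed
    with B show "\<exists>B\<subseteq>A. B \<noteq> {} \<and> countable B \<and> ?lub B S'" by blast
  qed
qed

end

section \<open>Functionals and signed measures\<close>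

context signed_measure
begin

lemma measurable_V: "borel_measurable V = borel_measurable M"
  by (rule measurable_cong_sets) auto

lemma density_V:
  fixes f :: "'a \<Rightarrow> real"
  assumes A: "A \<in> sets M" and f: "f \<in> borel_measurable M"
  shows "integrable (density V (indicator A)) f \<longleftrightarrow> integrable V (\<lambda>x. indicator A x * f x)"
    and "(\<integral>x. f x \<partial>density V (indicator A)) = (\<integral>x. indicator A x * f x \<partial>V)"
proof -
  have eq: "density V (indicator A) = density V (\<lambda>x. ennreal (indicator A x))"
    by (simp add: ennreal_indicator)
  have m: "f \<in> borel_measurable V" "(indicator A :: 'a \<Rightarrow> real) \<in> borel_measurable V"
    using A f by (auto simp: measurable_V)
  show "integrable (density V (indicator A)) f \<longleftrightarrow> integrable V (\<lambda>x. indicator A x * f x)"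
    unfolding eq using integrable_density[OF m] by simp
  show "(\<integral>x. f x \<partial>density V (indicator A)) = (\<integral>x. indicator A x * f x \<partial>V)"
    unfolding eq using integral_density[OF m] by simp
qed

lemma integrable_V_iff:
  fixes f :: "'a \<Rightarrow> real"
  assumes f: "f \<in> borel_measurable M"
  shows "integrable V f \<longleftrightarrow> integrable (pos_part M \<mu>) f \<and> integrable (neg_part M \<mu>) f"
    and "integrable V f \<Longrightarrow> (\<integral>x. f x \<partial>V) = (\<integral>x. f x \<partial>pos_part M \<mu>) + (\<integral>x. f x \<partial>neg_part M \<mu>)"
proof -
  obtain D where D: "D \<in> sets M" "pos_part M \<mu> = density V (indicator D)"
    "neg_part M \<mu> = density V (indicator (space M - D))"
    by (rule pos_part_density)
  have D': "space M - D \<in> sets M" using D(1) by auto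
  have eq: "f x = indicator D x * f x + indicator (space M - D) x * f x" if "x \<in> space M" for x
    using that by (auto split: split_indicator)
  have i: "integrable V (\<lambda>x. indicator A x * f x)" if "integrable V f" "A \<in> sets M" for A
    using integrable_real_mult_indicator[of A V f] that by (simp add: mult.commute)
  show iff: "integrable V f \<longleftrightarrow> integrable (pos_part M \<mu>) f \<and> integrable (neg_part M \<mu>) f"
    unfolding D(2,3) density_V[OF D(1) f] density_V[OF D' f]
  proof (intro iffI conjI; (elim conjE)?)
    assume "integrable V (\<lambda>x. indicator D x * f x)" "integrable V (\<lambda>x. indicator (space M - D) x * f x)"
    then have "integrable V (\<lambda>x. indicator D x * f x + indicator (space M - D) x * f x)" by simp
    moreover have "integrable V (\<lambda>x. indicator D x * f x + indicator (space M - D) x * f x) = integrable V f"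
      by (rule Bochner_Integration.integrable_cong) (auto simp: eq[symmetric])
    ultimately show "integrable V f" by simp
  qed (auto intro: i D(1) D')
  assume V: "integrable V f"
  have "(\<integral>x. f x \<partial>V) = (\<integral>x. indicator D x * f x + indicator (space M - D) x * f x \<partial>V)"
    by (rule Bochner_Integration.integral_cong) (auto simp: eq[symmetric])
  also have "\<dots> = (\<integral>x. indicator D x * f x \<partial>V) + (\<integral>x. indicator (space M - D) x * f x \<partial>V)"
    using V D(1) D' by (intro Bochner_Integration.integral_add i)
  finally show "(\<integral>x. f x \<partial>V) = (\<integral>x. f x \<partial>pos_part M \<mu>) + (\<integral>x. f x \<partial>neg_part M \<mu>)"
    unfolding D(2,3) density_V[OF D(1) f] density_V[OF D' f] .
qed

lemma AE_parts:
  assumes "AE x in V. Q x"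
  shows "AE x in pos_part M \<mu>. Q x" "AE x in neg_part M \<mu>. Q x"
proof -
  obtain D where D: "D \<in> sets M" "pos_part M \<mu> = density V (indicator D)"
    "neg_part M \<mu> = density V (indicator (space M - D))"
    by (rule pos_part_density)
  show "AE x in pos_part M \<mu>. Q x" "AE x in neg_part M \<mu>. Q x"
    using assms D(1) unfolding D(2,3) by (subst AE_density; auto)+
qed

lemma integral_indicator_parts:
  assumes A: "A \<in> sets M"
  shows "(\<integral>x. indicator A x \<partial>pos_part M \<mu>) - (\<integral>x. indicator A x \<partial>neg_part M \<mu>) = \<mu> A"
proof -
  interpret minus: signed_measure M "\<lambda>A. - \<mu> A" by unfold_locales (rule neg_in_ca)
  have "A \<inter> space M = A" using sets.sets_into_space[OF A] by blast
  then have "(\<integral>x. indicator A x \<partial>pos_part M \<mu>) = pos A"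
    "(\<integral>x. indicator A x \<partial>neg_part M \<mu>) = minus.pos A"
    using A by (auto simp: measure_pos_part neg_part_def minus.measure_pos_part)
  then show ?thesis using minus_pos[OF A] by simp
qed

end

text \<open>
  The integrals against the Jordan parts of the representing measure are obtained by multiplying
  the argument of the functional with the indicator of a Hahn set.
\<close>

locale order_continuous_functional =
  fixes M :: "'a measure" and S :: "('a \<Rightarrow> real) set" and N l :: "('a \<Rightarrow> real) \<Rightarrow> real" and K :: real
  assumes S_meas: "\<And>f. f \<in> S \<Longrightarrow> f \<in> borel_measurable M"
    and S_bounded: "\<And>f c. f \<in> borel_measurable M \<Longrightarrow> (\<And>x. x \<in> space M \<Longrightarrow> \<bar>f x\<bar> \<le> c) \<Longrightarrow> f \<in> S"
    and S_add: "\<And>f g. f \<in> S \<Longrightarrow> g \<in> S \<Longrightarrow> (\<lambda>x. f x + g x) \<in> S"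
    and S_scale: "\<And>c f. f \<in> S \<Longrightarrow> (\<lambda>x. c * f x) \<in> S"
    and S_solid: "\<And>f g. g \<in> S \<Longrightarrow> f \<in> borel_measurable M \<Longrightarrow> (\<And>x. x \<in> space M \<Longrightarrow> \<bar>f x\<bar> \<le> \<bar>g x\<bar>) \<Longrightarrow> f \<in> S"
    and N_mono: "\<And>f g. g \<in> S \<Longrightarrow> f \<in> borel_measurable M \<Longrightarrow> (\<And>x. x \<in> space M \<Longrightarrow> \<bar>f x\<bar> \<le> \<bar>g x\<bar>) \<Longrightarrow> N f \<le> N g"
    and N_oc: "\<And>f. (\<And>n::nat. f n \<in> S) \<Longrightarrow> (\<And>x n. x \<in> space M \<Longrightarrow> 0 \<le> f n x \<and> f (Suc n) x \<le> f n x) \<Longrightarrow>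
      (\<And>x. x \<in> space M \<Longrightarrow> (\<lambda>n. f n x) \<longlonglongrightarrow> 0) \<Longrightarrow> (\<lambda>n. N (f n)) \<longlonglongrightarrow> 0"
    and l_add: "\<And>f g. f \<in> S \<Longrightarrow> g \<in> S \<Longrightarrow> l (\<lambda>x. f x + g x) = l f + l g"
    and l_scale: "\<And>c f. f \<in> S \<Longrightarrow> l (\<lambda>x. c * f x) = c * l f"
    and l_bound: "\<And>f. f \<in> S \<Longrightarrow> \<bar>l f\<bar> \<le> K * N f"
begin

lemma S_zero: "(\<lambda>_. 0) \<in> S"
  by (rule S_bounded[where c = 0]) auto

lemma S_ind: "A \<in> sets M \<Longrightarrow> (indicator A :: 'a \<Rightarrow> real) \<in> S"
  by (rule S_bounded[where c = 1]) (auto split: split_indicator)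

lemma S_diff: "f \<in> S \<Longrightarrow> g \<in> S \<Longrightarrow> (\<lambda>x. f x - g x) \<in> S"
  using S_add[OF _ S_scale[of g "-1"], of f] by simp

lemma l_diff: "f \<in> S \<Longrightarrow> g \<in> S \<Longrightarrow> l (\<lambda>x. f x - g x) = l f - l g"
  using l_add[OF _ S_scale[of g "-1"], of f] l_scale[of g "-1"] by simp

lemma N_zero: "N (\<lambda>_. 0) = 0"
  using N_oc[of "\<lambda>_ _. 0"] S_zero by (simp add: LIMSEQ_const_iff)

lemma N_nonneg: "f \<in> S \<Longrightarrow> 0 \<le> N f"
  using N_mono[of f "\<lambda>_. 0"] by (simp add: N_zero)

lemma l_cong: "f \<in> S \<Longrightarrow> g \<in> S \<Longrightarrow> (\<And>x. x \<in> space M \<Longrightarrow> f x = g x) \<Longrightarrow> l f = l g"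
proof -
  assume f: "f \<in> S" and g: "g \<in> S" and eq: "\<And>x. x \<in> space M \<Longrightarrow> f x = g x"
  have d: "(\<lambda>x. f x - g x) \<in> S" by (rule S_diff[OF f g])
  have "N (\<lambda>x. f x - g x) \<le> N (\<lambda>_. 0)"
    by (rule N_mono[OF S_zero S_meas[OF d]]) (simp add: eq)
  then have "N (\<lambda>x. f x - g x) = 0" using N_nonneg[OF d] by (simp add: N_zero)
  then show ?thesis using l_bound[OF d] l_diff[OF f g] by simp
qed

lemma l_sum: "finite I \<Longrightarrow> (\<And>i. i \<in> I \<Longrightarrow> f i \<in> S) \<Longrightarrow>
  (\<lambda>x. \<Sum>i\<in>I. f i x) \<in> S \<and> l (\<lambda>x. \<Sum>i\<in>I. f i x) = (\<Sum>i\<in>I. l (f i))"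
proof (induction I rule: finite_induct)
  case empty
  show ?case using l_scale[OF S_zero, of 0] S_zero by simp
next
  case (insert i I)
  then show ?case using l_add[of "f i" "\<lambda>x. \<Sum>i\<in>I. f i x"] S_add[of "f i" "\<lambda>x. \<Sum>i\<in>I. f i x"] by simp
qed

lemma l_le: "f \<in> S \<Longrightarrow> \<bar>l f\<bar> \<le> \<bar>K\<bar> * N f"
  using l_bound[of f] mult_right_mono[OF abs_ge_self N_nonneg[of f], of K] by linarith

lemma l_lim:
  assumes f: "\<And>n. f n \<in> S" and F: "F \<in> S" and inc: "\<And>x n. x \<in> space M \<Longrightarrow> f n x \<le> f (Suc n) x"
    and le: "\<And>x n. x \<in> space M \<Longrightarrow> f n x \<le> F x"
    and lim: "\<And>x. x \<in> space M \<Longrightarrow> (\<lambda>n. f n x) \<longlonglongrightarrow> F x"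
  shows "(\<lambda>n. l (f n)) \<longlonglongrightarrow> l F"
proof -
  have "(\<lambda>n. N (\<lambda>x. F x - f n x)) \<longlonglongrightarrow> 0"
  proof (rule N_oc)
    show "(\<lambda>x. F x - f n x) \<in> S" for n by (intro S_diff f F)
    show "0 \<le> F x - f n x \<and> F x - f (Suc n) x \<le> F x - f n x" if "x \<in> space M" for x n
      using inc[OF that, of n] le[OF that, of n] by simp
    show "(\<lambda>n. F x - f n x) \<longlonglongrightarrow> 0" if "x \<in> space M" for x
      using tendsto_diff[OF tendsto_const lim[OF that], of "F x"] by simp
  qed
  then have "(\<lambda>n. \<bar>K\<bar> * N (\<lambda>x. F x - f n x)) \<longlonglongrightarrow> 0" by (rule tendsto_mult_right_zero)
  then have "(\<lambda>n. l F - l (f n)) \<longlonglongrightarrow> 0"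
  proof (rule Lim_null_comparison[rotated])
    show "\<forall>\<^sub>F n in sequentially. norm (l F - l (f n)) \<le> \<bar>K\<bar> * N (\<lambda>x. F x - f n x)"
      using l_le[OF S_diff[OF F f]] l_diff[OF F f] by (intro always_eventually) simp
  qed
  from tendsto_diff[OF tendsto_const this, of "l F"] show ?thesis by simp
qed

definition \<mu> :: "'a set \<Rightarrow> real" where
  "\<mu> A = (if A \<in> sets M then l (indicator A) else 0)"

lemma \<mu>_ca: "\<mu> \<in> ca M"
  unfolding ca_def
proof (intro CollectI conjI allI impI; (elim conjE)?)
  have ind0: "(indicator {} :: 'a \<Rightarrow> real) = (\<lambda>_. 0)" by (auto simp: fun_eq_iff)
  have l0: "l (\<lambda>_. 0) = 0" using l_scale[OF S_zero, of 0] by simp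
  show "\<mu> {} = 0" by (simp add: \<mu>_def ind0 l0)
  show "\<mu> A = 0" if "A \<notin> sets M" for A using that by (simp add: \<mu>_def)
  show "(\<lambda>n. \<mu> (A n)) sums \<mu> (\<Union>n. A n)" if A: "range A \<subseteq> sets M" "disjoint_family A" for A :: "nat \<Rightarrow> 'a set"
  proof -
    have [measurable]: "A n \<in> sets M" for n using A by auto
    have eq: "indicator (\<Union>i<n. A i) x = (\<Sum>i<n. indicator (A i) x :: real)" for n x
      using A(2) by (intro indicator_UN_disjoint) (auto simp: disjoint_family_on_def)
    have part: "l (indicator (\<Union>i<n. A i)) = (\<Sum>i<n. \<mu> (A i))" for n
    proof -
      have "l (indicator (\<Union>i<n. A i)) = l (\<lambda>x. \<Sum>i<n. indicator (A i) x)"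
        by (rule arg_cong[of _ _ l]) (simp add: fun_eq_iff eq)
      also have "\<dots> = (\<Sum>i<n. l (indicator (A i)))"
        using l_sum[of "{..<n}" "\<lambda>i. indicator (A i)"] by (simp add: S_ind)
      finally show ?thesis by (simp add: \<mu>_def)
    qed
    have "(\<lambda>n. l (indicator (\<Union>i<n. A i))) \<longlonglongrightarrow> l (indicator (\<Union>i. A i))"
    proof (rule l_lim)
      show "(\<lambda>n. indicator (\<Union>i<n. A i) x :: real) \<longlonglongrightarrow> indicator (\<Union>i. A i) x" for x
        by (rule LIMSEQ_indicator_UN)
    qed (auto intro!: S_ind split: split_indicator intro: less_SucI)
    then show ?thesis unfolding part sums_def by (simp add: \<mu>_def)
  qed
  have "total_variation M \<mu> (space M) \<le> ennreal (\<bar>K\<bar> * N (\<lambda>_. 1))"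
    unfolding total_variation_def
  proof (rule SUP_least)
    fix D assume "D \<in> {D. finite D \<and> partition_on (space M) D \<and> D \<subseteq> sets M}"
    then have D: "finite D" "D \<subseteq> sets M" "disjoint D" by (auto simp: partition_on_def)
    define g where "g x = (\<Sum>B\<in>D. sgn (\<mu> B) * indicator B x)" for x
    have S1: "(\<lambda>x. sgn (\<mu> B) * indicator B x) \<in> S" if "B \<in> D" for B
      using that D by (intro S_scale S_ind) auto
    have g: "g \<in> S" "l g = (\<Sum>B\<in>D. l (\<lambda>x. sgn (\<mu> B) * indicator B x))"
      using l_sum[OF D(1) S1] by (auto simp: g_def[abs_def])
    have "(\<Sum>B\<in>D. \<bar>\<mu> B\<bar>) = l g"
      unfolding g(2)
    proof (intro sum.cong refl)
      fix B assume "B \<in> D"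
      then have "B \<in> sets M" using D by blast
      then show "\<bar>\<mu> B\<bar> = l (\<lambda>x. sgn (\<mu> B) * indicator B x)"
        using l_scale[OF S_ind, of B "sgn (\<mu> B)"] by (simp add: \<mu>_def abs_sgn mult.commute[of "l _"])
    qed
    also have "\<dots> \<le> \<bar>K\<bar> * N g" using l_le[OF g(1)] by linarith
    also have "\<dots> \<le> \<bar>K\<bar> * N (\<lambda>_. 1)"
    proof (intro mult_left_mono N_mono S_meas g)
      show "(\<lambda>_. 1) \<in> S" by (rule S_bounded[where c = 1]) auto
      fix x
      have "\<bar>g x\<bar> \<le> (\<Sum>B\<in>D. \<bar>sgn (\<mu> B) * indicator B x\<bar>)" unfolding g_def by (rule sum_abs)
      also have "\<dots> \<le> (\<Sum>B\<in>D. indicator B x)"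
        by (intro sum_mono) (auto simp: abs_mult sgn_if split: split_indicator)
      also have "\<dots> = indicator (\<Union>B\<in>D. B) x"
        using D by (intro indicator_UN_disjoint[symmetric]) (auto simp: disjoint_family_on_def disjoint_def)
      also have "\<dots> \<le> (1::real)" by (auto split: split_indicator)
      finally show "\<bar>g x\<bar> \<le> \<bar>1\<bar>" by simp
    qed simp
    finally have "(\<Sum>B\<in>D. \<bar>\<mu> B\<bar>) \<le> \<bar>K\<bar> * N (\<lambda>_. 1)" .
    then show "(\<Sum>B\<in>D. ennreal \<bar>\<mu> B\<bar>) \<le> ennreal (\<bar>K\<bar> * N (\<lambda>_. 1))"
      by (subst sum_ennreal) (auto intro: ennreal_leI)
  qed
  also have "\<dots> < \<infinity>" by simp
  finally show "total_variation M \<mu> (space M) < \<infinity>" .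
qed

lemma integral_cut:
  assumes \<nu>: "finite_measure \<nu>" "sets \<nu> = sets M" and E: "E \<in> sets M"
    and eq: "\<And>A. A \<in> sets M \<Longrightarrow> measure \<nu> A = c * l (indicator (A \<inter> E))"
    and u: "u \<in> borel_measurable M" "\<And>x. 0 \<le> u x"
  shows "u \<in> S \<longrightarrow> integrable \<nu> u \<and> (\<integral>x. u x \<partial>\<nu>) = c * l (\<lambda>x. u x * indicator E x)"
proof -
  interpret \<nu>: finite_measure \<nu> by fact
  have m\<nu>: "borel_measurable \<nu> = borel_measurable M" by (rule measurable_cong_sets) (auto simp: \<nu>)
  have sp: "space \<nu> = space M" using \<nu>(2) by (rule sets_eq_imp_space_eq)
  have cutS: "(\<lambda>x. f x * indicator E x) \<in> S" if "f \<in> S" for f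
    using that S_meas[OF that] E by (intro S_solid[OF that]) (auto split: split_indicator)
  show ?thesis
    using u
  proof (induction rule: borel_measurable_induct_real)
    case (set A)
    have "(\<lambda>x. indicator A x * indicator E x :: real) = indicator (A \<inter> E)"
      by (simp add: fun_eq_iff indicator_inter_arith)
    moreover have "A \<inter> space M = A" using sets.sets_into_space[OF set] by blast
    ultimately show ?case using eq[OF set] set \<nu> by (auto simp: sp \<nu>.emeasure_finite less_top[symmetric])
  next
    case (mult u d)
    show ?case
    proof (cases "d = 0")
      case True
      then show ?thesis using l_scale[OF S_zero, of 0] by simp
    next
      case False
      show ?thesis
      proof
        assume "(\<lambda>x. d * u x) \<in> S"
        from S_scale[OF this, of "1/d"] False have uS: "u \<in> S" by simp
        then have "integrable \<nu> u" "(\<integral>x. u x \<partial>\<nu>) = c * l (\<lambda>x. u x * indicator E x)" using mult by auto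
        then show "integrable \<nu> (\<lambda>x. d * u x) \<and> (\<integral>x. d * u x \<partial>\<nu>) = c * l (\<lambda>x. d * u x * indicator E x)"
          using l_scale[OF cutS[OF uS], of d] by (simp add: mult.assoc mult.left_commute)
      qed
    qed
  next
    case (add u v)
    show ?case
    proof
      assume uvS: "(\<lambda>x. v x + u x) \<in> S"
      have nn: "\<And>x. 0 \<le> u x" "\<And>x. 0 \<le> v x" using add by blast+
      have uS: "u \<in> S" and vS: "v \<in> S"
        using add nn by (auto intro!: S_solid[OF uvS])
      then have *: "integrable \<nu> u" "(\<integral>x. u x \<partial>\<nu>) = c * l (\<lambda>x. u x * indicator E x)"
        "integrable \<nu> v" "(\<integral>x. v x \<partial>\<nu>) = c * l (\<lambda>x. v x * indicator E x)" using add by auto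
      have "l (\<lambda>x. (v x + u x) * indicator E x) = l (\<lambda>x. v x * indicator E x) + l (\<lambda>x. u x * indicator E x)"
        using l_add[OF cutS[OF vS] cutS[OF uS]] by (simp add: distrib_right)
      with * show "integrable \<nu> (\<lambda>x. v x + u x) \<and> (\<integral>x. v x + u x \<partial>\<nu>) = c * l (\<lambda>x. (v x + u x) * indicator E x)"
        by (simp add: distrib_left)
    qed
  next
    case (seq U)
    have inc: "U n x \<le> U (Suc n) x" for n x using seq by (auto simp: incseq_def le_fun_def)
    have U0: "0 \<le> U n x" for n x using seq by blast
    have Ulim: "(\<lambda>i. U i x) \<longlonglongrightarrow> u x" if "x \<in> space M" for x using seq that by blast
    have Um: "U n \<in> borel_measurable M" for n using seq by blast
    have Uu: "U i x \<le> u x" if "x \<in> space M" for i x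
      using inc Ulim[OF that] by (intro incseq_le[of "\<lambda>i. U i x"]) (auto intro: incseq_SucI)
    show ?case
    proof
      assume uS: "u \<in> S"
      have US: "U n \<in> S" for n
        using Uu U0 by (intro S_solid[OF uS Um]) (smt (verit))
      have IH: "integrable \<nu> (U n) \<and> (\<integral>x. U n x \<partial>\<nu>) = c * l (\<lambda>x. U n x * indicator E x)" for n
        using seq US by blast
      have "(\<lambda>n. l (\<lambda>x. U n x * indicator E x)) \<longlonglongrightarrow> l (\<lambda>x. u x * indicator E x)"
      proof (rule l_lim)
        show "(\<lambda>n. U n x * indicator E x) \<longlonglongrightarrow> u x * indicator E x" if "x \<in> space M" for x
          by (intro tendsto_intros Ulim that)
      qed (use cutS US uS inc Uu in \<open>auto split: split_indicator\<close>)
      then have lim: "(\<lambda>n. \<integral>x. U n x \<partial>\<nu>) \<longlonglongrightarrow> c * l (\<lambda>x. u x * indicator E x)"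
        using IH by (auto intro: tendsto_intros)
      have ae: "AE x in \<nu>. mono (\<lambda>n. U n x)" "AE x in \<nu>. (\<lambda>n. U n x) \<longlonglongrightarrow> u x"
        using inc Ulim by (auto simp: mono_iff_le_Suc sp)
      have um: "u \<in> borel_measurable \<nu>" using S_meas[OF uS] m\<nu> by blast
      have "integrable \<nu> u" "(\<integral>x. u x \<partial>\<nu>) = c * l (\<lambda>x. u x * indicator E x)"
        using IH by (blast intro: integrable_monotone_convergence[OF _ ae lim um]
            integral_monotone_convergence[OF _ ae lim um])+
      then show "integrable \<nu> u \<and> (\<integral>x. u x \<partial>\<nu>) = c * l (\<lambda>x. u x * indicator E x)" ..
    qed
  qed
qed

lemma representation:
  assumes f: "f \<in> S"
  shows "integrable (variation_measure M \<mu>) f"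
    and "(\<integral>x. f x \<partial>pos_part M \<mu>) - (\<integral>x. f x \<partial>neg_part M \<mu>) = l f"
    and "(\<integral>x. \<bar>f x\<bar> \<partial>variation_measure M \<mu>) \<le> 2 * \<bar>K\<bar> * N f"
proof -
  interpret signed_measure M \<mu> by unfold_locales (rule \<mu>_ca)
  interpret minus: signed_measure M "\<lambda>A. - \<mu> A" by unfold_locales (rule neg_in_ca)
  obtain D where D: "D \<in> sets M" "\<And>A. A \<in> sets M \<Longrightarrow> pos A = \<mu> (A \<inter> D)"
    "\<And>A. A \<in> sets M \<Longrightarrow> minus.pos A = - \<mu> (A - D)"
    by (rule Hahn) blast
  let ?E = "space M - D"
  have E: "?E \<in> sets M" using D(1) by auto
  have [measurable]: "f \<in> borel_measurable M" by (rule S_meas[OF f])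
  have pos: "u \<in> S \<longrightarrow> integrable (pos_part M \<mu>) u \<and> (\<integral>x. u x \<partial>pos_part M \<mu>) = 1 * l (\<lambda>x. u x * indicator D x)"
    if "u \<in> borel_measurable M" "\<And>x. 0 \<le> u x" for u
    by (rule integral_cut[OF finite_pos_part _ D(1) _ that])
      (use D(1) D(2) in \<open>auto simp: measure_pos_part \<mu>_def\<close>)
  have neg: "u \<in> S \<longrightarrow> integrable (neg_part M \<mu>) u \<and> (\<integral>x. u x \<partial>neg_part M \<mu>) = - 1 * l (\<lambda>x. u x * indicator ?E x)"
    if "u \<in> borel_measurable M" "\<And>x. 0 \<le> u x" for u
    unfolding neg_part_def
  proof (rule integral_cut[OF minus.finite_pos_part _ E _ that])
    fix A assume A: "A \<in> sets M"
    have "A - D = A \<inter> ?E" using sets.sets_into_space[OF A] by auto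
    then show "measure (pos_part M (\<lambda>A. - \<mu> A)) A = - 1 * l (indicator (A \<inter> ?E))"
      using A D(1) D(3)[OF A] \<mu>_def[of "A - D"] by (simp add: minus.measure_pos_part)
  qed simp
  have cutS: "(\<lambda>x. f x * indicator A x) \<in> S" if "f \<in> S" "A \<in> sets M" for f A
    using that S_meas[OF that(1)] by (intro S_solid[OF that(1)]) (auto split: split_indicator)
  let ?p = "\<lambda>x. max (f x) 0" and ?n = "\<lambda>x. max (- f x) 0" and ?a = "\<lambda>x. \<bar>f x\<bar>"
  have pS: "?p \<in> S" and nS: "?n \<in> S" and aS: "?a \<in> S"
    by (auto intro!: S_solid[OF f])
  have f_eq: "f = (\<lambda>x. ?p x - ?n x)" by (auto simp: fun_eq_iff)
  have cut_diff: "l (\<lambda>x. ?p x * indicator A x) - l (\<lambda>x. ?n x * indicator A x) = l (\<lambda>x. f x * indicator A x)"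
    if A: "A \<in> sets M" for A
  proof -
    have "(\<lambda>x. ?p x * indicator A x - ?n x * indicator A x) = (\<lambda>x. f x * indicator A x)"
      by (auto simp: fun_eq_iff split: split_indicator)
    then show ?thesis using l_diff[OF cutS[OF pS A] cutS[OF nS A]] by simp
  qed
  have P: "integrable (pos_part M \<mu>) f" "(\<integral>x. f x \<partial>pos_part M \<mu>) = l (\<lambda>x. f x * indicator D x)"
  proof -
    have *: "integrable (pos_part M \<mu>) ?p" "integrable (pos_part M \<mu>) ?n" using pos[of ?p] pos[of ?n] pS nS by auto
    then show "integrable (pos_part M \<mu>) f" by (subst f_eq) auto
    have "(\<integral>x. f x \<partial>pos_part M \<mu>) = (\<integral>x. ?p x \<partial>pos_part M \<mu>) - (\<integral>x. ?n x \<partial>pos_part M \<mu>)"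
      by (subst f_eq) (rule Bochner_Integration.integral_diff[OF *])
    then show "(\<integral>x. f x \<partial>pos_part M \<mu>) = l (\<lambda>x. f x * indicator D x)"
      using pos[of ?p] pos[of ?n] pS nS cut_diff[OF D(1)] by simp
  qed
  have Ng: "integrable (neg_part M \<mu>) f" "(\<integral>x. f x \<partial>neg_part M \<mu>) = - l (\<lambda>x. f x * indicator ?E x)"
  proof -
    have *: "integrable (neg_part M \<mu>) ?p" "integrable (neg_part M \<mu>) ?n" using neg[of ?p] neg[of ?n] pS nS by auto
    then show "integrable (neg_part M \<mu>) f" by (subst f_eq) auto
    have "(\<integral>x. f x \<partial>neg_part M \<mu>) = (\<integral>x. ?p x \<partial>neg_part M \<mu>) - (\<integral>x. ?n x \<partial>neg_part M \<mu>)"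
      by (subst f_eq) (rule Bochner_Integration.integral_diff[OF *])
    then show "(\<integral>x. f x \<partial>neg_part M \<mu>) = - l (\<lambda>x. f x * indicator ?E x)"
      using neg[of ?p] neg[of ?n] pS nS cut_diff[OF E] by simp
  qed
  show V: "integrable V f" using P(1) Ng(1) by (simp add: integrable_V_iff)
  have "l f = l (\<lambda>x. f x * indicator D x + f x * indicator ?E x)"
    by (intro l_cong f S_add cutS D(1) E) (auto split: split_indicator)
  then show "(\<integral>x. f x \<partial>pos_part M \<mu>) - (\<integral>x. f x \<partial>neg_part M \<mu>) = l f"
    using l_add[OF cutS[OF f D(1)] cutS[OF f E]] P(2) Ng(2) by simp
  have bd: "\<bar>l (\<lambda>x. \<bar>f x\<bar> * indicator A x)\<bar> \<le> \<bar>K\<bar> * N f" if A: "A \<in> sets M" for A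
  proof -
    have "\<bar>l (\<lambda>x. \<bar>f x\<bar> * indicator A x)\<bar> \<le> \<bar>K\<bar> * N (\<lambda>x. \<bar>f x\<bar> * indicator A x)"
      by (intro l_le cutS aS A)
    also have "\<dots> \<le> \<bar>K\<bar> * N f"
      using A by (intro mult_left_mono N_mono f) (auto split: split_indicator)
    finally show ?thesis .
  qed
  have "(\<integral>x. \<bar>f x\<bar> \<partial>V) = (\<integral>x. \<bar>f x\<bar> \<partial>pos_part M \<mu>) + (\<integral>x. \<bar>f x\<bar> \<partial>neg_part M \<mu>)"
    using V by (intro integrable_V_iff(2)) auto
  also have "\<dots> = l (\<lambda>x. \<bar>f x\<bar> * indicator D x) - l (\<lambda>x. \<bar>f x\<bar> * indicator ?E x)"
    using pos[of ?a] neg[of ?a] aS by simp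
  also have "\<dots> \<le> 2 * \<bar>K\<bar> * N f" using bd[OF D(1)] bd[OF E] by linarith
  finally show "(\<integral>x. \<bar>f x\<bar> \<partial>variation_measure M \<mu>) \<le> 2 * \<bar>K\<bar> * N f" .
qed

end

text \<open>
  A minimal sublinear functional is linear, because the functional
  \<open>f \<mapsto> inf {q (f + t y) - t q y | t \<ge> 0}\<close> is sublinear and below \<open>q\<close>.
\<close>

locale function_space =
  fixes S :: "('b \<Rightarrow> real) set"
  assumes zero: "(\<lambda>_. 0) \<in> S"
    and add: "\<And>f g. f \<in> S \<Longrightarrow> g \<in> S \<Longrightarrow> (\<lambda>x. f x + g x) \<in> S"
    and scale: "\<And>c f. f \<in> S \<Longrightarrow> (\<lambda>x. c * f x) \<in> S"
begin

definition sublinear :: "(('b \<Rightarrow> real) \<Rightarrow> real) \<Rightarrow> bool" where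
  "sublinear q \<longleftrightarrow> (\<forall>f\<in>S. \<forall>g\<in>S. q (\<lambda>x. f x + g x) \<le> q f + q g) \<and>
     (\<forall>c>0. \<forall>f\<in>S. q (\<lambda>x. c * f x) \<le> c * q f)"

lemma minus: "f \<in> S \<Longrightarrow> (\<lambda>x. - f x) \<in> S"
  using scale[of f "-1"] by simp

lemma sublinear_add: "sublinear q \<Longrightarrow> f \<in> S \<Longrightarrow> g \<in> S \<Longrightarrow> q (\<lambda>x. f x + g x) \<le> q f + q g"
  by (simp add: sublinear_def)

lemma sublinear_scale: "sublinear q \<Longrightarrow> f \<in> S \<Longrightarrow> 0 < c \<Longrightarrow> q (\<lambda>x. c * f x) = c * q f"
proof (rule antisym)
  assume q: "sublinear q" and f: "f \<in> S" and c: "0 < c"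
  show "q (\<lambda>x. c * f x) \<le> c * q f" using q f c by (simp add: sublinear_def)
  have "q (\<lambda>x. (1 / c) * (c * f x)) \<le> (1 / c) * q (\<lambda>x. c * f x)"
    using q scale[OF f] c unfolding sublinear_def by (metis zero_less_divide_1_iff)
  then show "c * q f \<le> q (\<lambda>x. c * f x)" using c by (simp add: field_simps)
qed

lemma sublinear_zero: "sublinear q \<Longrightarrow> q (\<lambda>_. 0) = 0"
  using sublinear_scale[OF _ zero, of q 2] by simp

lemma sublinear_scale0: "sublinear q \<Longrightarrow> f \<in> S \<Longrightarrow> 0 \<le> c \<Longrightarrow> q (\<lambda>x. c * f x) = c * q f"
  using sublinear_scale[of q f c] sublinear_zero[of q] by (cases "c = 0") auto

lemma sublinear_neg: "sublinear q \<Longrightarrow> f \<in> S \<Longrightarrow> - q (\<lambda>x. - f x) \<le> q f"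
  using sublinear_add[of q f "\<lambda>x. - f x"] minus[of f] sublinear_zero[of q] by simp

definition reduce :: "(('b \<Rightarrow> real) \<Rightarrow> real) \<Rightarrow> ('b \<Rightarrow> real) \<Rightarrow> ('b \<Rightarrow> real) \<Rightarrow> real" where
  "reduce q y f = (if f \<in> S then INF t\<in>{0..}. q (\<lambda>x. f x + t * y x) - t * q y else 0)"

lemma reduce_le:
  assumes q: "sublinear q" and y: "y \<in> S" and f: "f \<in> S" and t: "0 \<le> t"
  shows "reduce q y f \<le> q (\<lambda>x. f x + t * y x) - t * q y"
proof -
  have "bdd_below ((\<lambda>t. q (\<lambda>x. f x + t * y x) - t * q y) ` {0..})"
  proof (rule bdd_belowI2)
    fix t :: real assume "t \<in> {0..}"
    then have t: "0 \<le> t" by simp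
    have "q (\<lambda>x. (f x + t * y x) + - f x) \<le> q (\<lambda>x. f x + t * y x) + q (\<lambda>x. - f x)"
      by (intro sublinear_add q add minus f scale y)
    then show "- q (\<lambda>x. - f x) \<le> q (\<lambda>x. f x + t * y x) - t * q y"
      using sublinear_scale0[OF q y t] by simp
  qed
  then have "(INF t\<in>{0..}. q (\<lambda>x. f x + t * y x) - t * q y) \<le> q (\<lambda>x. f x + t * y x) - t * q y"
    by (rule cINF_lower) (simp add: t)
  then show ?thesis by (simp add: reduce_def f)
qed

lemma reduce_ge:
  assumes "f \<in> S" "\<And>t. 0 \<le> t \<Longrightarrow> c \<le> q (\<lambda>x. f x + t * y x) - t * q y"
  shows "c \<le> reduce q y f"
  unfolding reduce_def using assms by (auto intro!: cINF_greatest)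

lemma reduce_le_self: "sublinear q \<Longrightarrow> y \<in> S \<Longrightarrow> f \<in> S \<Longrightarrow> reduce q y f \<le> q f"
  using reduce_le[of q y f 0] by simp

lemma reduce_minus: "sublinear q \<Longrightarrow> y \<in> S \<Longrightarrow> reduce q y (\<lambda>x. - y x) \<le> - q y"
  using reduce_le[of q y "\<lambda>x. - y x" 1] minus[of y] sublinear_zero[of q] by simp

lemma sublinear_reduce:
  assumes q: "sublinear q" and y: "y \<in> S"
  shows "sublinear (reduce q y)"
  unfolding sublinear_def
proof (intro conjI ballI allI impI)
  fix f g assume f: "f \<in> S" and g: "g \<in> S"
  have "reduce q y (\<lambda>x. f x + g x) - (q (\<lambda>x. g x + s * y x) - s * q y) \<le> reduce q y f" if s: "0 \<le> s" for s
  proof (rule reduce_ge[OF f])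
    fix t :: real assume t: "0 \<le> t"
    have "reduce q y (\<lambda>x. f x + g x) \<le> q (\<lambda>x. f x + g x + (t + s) * y x) - (t + s) * q y"
      using s t by (intro reduce_le q y add f g) simp
    moreover have "q (\<lambda>x. (f x + t * y x) + (g x + s * y x)) \<le> q (\<lambda>x. f x + t * y x) + q (\<lambda>x. g x + s * y x)"
      by (intro sublinear_add q add f g scale y)
    moreover have "(\<lambda>x. (f x + t * y x) + (g x + s * y x)) = (\<lambda>x. f x + g x + (t + s) * y x)"
      by (simp add: fun_eq_iff algebra_simps)
    ultimately show "reduce q y (\<lambda>x. f x + g x) - (q (\<lambda>x. g x + s * y x) - s * q y) \<le> q (\<lambda>x. f x + t * y x) - t * q y"
      by (simp add: algebra_simps)
  qed
  then have "reduce q y (\<lambda>x. f x + g x) - reduce q y f \<le> reduce q y g"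
    by (intro reduce_ge[OF g]) (simp add: algebra_simps)
  then show "reduce q y (\<lambda>x. f x + g x) \<le> reduce q y f + reduce q y g" by simp
next
  fix c :: real and f assume c: "0 < c" and f: "f \<in> S"
  have "reduce q y (\<lambda>x. c * f x) / c \<le> reduce q y f"
  proof (rule reduce_ge[OF f])
    fix t :: real assume t: "0 \<le> t"
    have "reduce q y (\<lambda>x. c * f x) \<le> q (\<lambda>x. c * f x + (c * t) * y x) - (c * t) * q y"
      using c t by (intro reduce_le q y scale f) simp
    also have "q (\<lambda>x. c * f x + (c * t) * y x) = c * q (\<lambda>x. f x + t * y x)"
      using sublinear_scale[OF q add[OF f scale[OF y, of t]] c] by (simp add: algebra_simps)
    finally show "reduce q y (\<lambda>x. c * f x) / c \<le> q (\<lambda>x. f x + t * y x) - t * q y"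
      using c by (simp add: field_simps)
  qed
  then show "reduce q y (\<lambda>x. c * f x) \<le> c * reduce q y f" using c by (simp add: field_simps)
qed

lemma sublinear_minimal:
  assumes p: "sublinear p"
  shows "\<exists>m. sublinear m \<and> (\<forall>f\<in>S. m f \<le> p f) \<and>
    (\<forall>q. sublinear q \<longrightarrow> (\<forall>f\<in>S. q f \<le> m f) \<longrightarrow> (\<forall>f\<in>S. q f = m f))"
proof -
  define Q where "Q = {q. sublinear q \<and> (\<forall>f\<in>S. q f \<le> p f) \<and> (\<forall>f. f \<notin> S \<longrightarrow> q f = 0)}"
  define res where "res q f = (if f \<in> S then q f else 0)" for q :: "('b \<Rightarrow> real) \<Rightarrow> real" and f
  have res: "sublinear (res q)" if "sublinear q" for q
    using that add scale by (simp add: sublinear_def res_def)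
  have pQ: "res p \<in> Q" using res[OF p] by (simp add: Q_def res_def)
  have "\<exists>m\<in>Q. \<forall>a\<in>Q. a \<le> m \<longrightarrow> a = m"
  proof (rule predicate_Zorn[where P = "\<lambda>m a. a \<le> m"])
    show "partial_order_on Q (relation_of (\<lambda>m a. a \<le> m) Q)"
      by (rule partial_order_on_relation_ofI) auto
    fix C assume "C \<in> Chains (relation_of (\<lambda>m a. a \<le> m) Q)"
    then have CQ: "C \<subseteq> Q" and chain: "\<And>q r. q \<in> C \<Longrightarrow> r \<in> C \<Longrightarrow> q \<le> r \<or> r \<le> q"
      by (auto simp: Chains_def relation_of_def)
    show "\<exists>u\<in>Q. \<forall>a\<in>C. u \<le> a"
    proof (cases "C = {}")
      case True
      with pQ show ?thesis by blast
    next
      case False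
      define u where "u f = (INF q\<in>C. q f)" for f
      have bdd: "bdd_below ((\<lambda>q. q f) ` C)" for f
      proof (cases "f \<in> S")
        case True
        have "- p (\<lambda>x. - f x) \<le> q f" if "q \<in> C" for q
        proof -
          have "q \<in> Q" using that CQ by blast
          then have "sublinear q" "q (\<lambda>x. - f x) \<le> p (\<lambda>x. - f x)" using minus[OF True] by (auto simp: Q_def)
          with sublinear_neg[OF _ True, of q] show ?thesis by linarith
        qed
        then show ?thesis by (rule bdd_belowI2)
      next
        case False
        then have "(\<lambda>q. q f) ` C \<subseteq> {0}" using CQ by (auto simp: Q_def)
        then show ?thesis by (meson bdd_below_mono bdd_below_finite finite.emptyI finite_insert)
      qed
      have lower: "u f \<le> q f" if "q \<in> C" for q f unfolding u_def by (rule cINF_lower[OF bdd that])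
      have great: "c \<le> u f" if "\<And>q. q \<in> C \<Longrightarrow> c \<le> q f" for c f
        unfolding u_def using False that by (intro cINF_greatest)
      have sub: "sublinear q" if "q \<in> C" for q using that CQ by (auto simp: Q_def)
      have "sublinear u"
        unfolding sublinear_def
      proof (intro conjI ballI allI impI)
        fix f g assume f: "f \<in> S" and g: "g \<in> S"
        have "u (\<lambda>x. f x + g x) - r g \<le> u f" if r: "r \<in> C" for r
        proof (rule great)
          fix q assume q: "q \<in> C"
          obtain s where s: "s \<in> C" "s \<le> q" "s \<le> r" using chain[OF q r] q r by blast
          have "u (\<lambda>x. f x + g x) \<le> s f + s g"
            using lower[OF s(1), of "\<lambda>x. f x + g x"] sublinear_add[OF sub[OF s(1)] f g] by linarith
          with s(2,3) show "u (\<lambda>x. f x + g x) - r g \<le> q f"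
            by (smt (verit) le_funD)
        qed
        then have "u (\<lambda>x. f x + g x) - u f \<le> u g" by (intro great) (simp add: algebra_simps)
        then show "u (\<lambda>x. f x + g x) \<le> u f + u g" by simp
      next
        fix c :: real and f assume c: "0 < c" and f: "f \<in> S"
        have "u (\<lambda>x. c * f x) / c \<le> u f"
        proof (rule great)
          fix q assume q: "q \<in> C"
          show "u (\<lambda>x. c * f x) / c \<le> q f"
            using lower[OF q, of "\<lambda>x. c * f x"] sublinear_scale[OF sub[OF q] f c] c by (simp add: field_simps)
        qed
        then show "u (\<lambda>x. c * f x) \<le> c * u f" using c by (simp add: field_simps)
      qed
      moreover have "u f \<le> p f" if "f \<in> S" for f
      proof -
        obtain q where "q \<in> C" using False by blast
        then show ?thesis using lower[of q f] CQ that by (force simp: Q_def)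
      qed
      moreover have "u f = 0" if "f \<notin> S" for f
      proof -
        have "q f = 0" if "q \<in> C" for q using that CQ \<open>f \<notin> S\<close> by (auto simp: Q_def)
        then have "(\<lambda>q. q f) ` C = {0}" using False by force
        then show ?thesis by (simp add: u_def)
      qed
      ultimately have "u \<in> Q" by (simp add: Q_def)
      then show ?thesis using lower by (auto simp: le_fun_def)
    qed
  qed
  then obtain m where m: "m \<in> Q" "\<And>a. a \<in> Q \<Longrightarrow> a \<le> m \<Longrightarrow> a = m" by blast
  have min: "q f = m f" if q: "sublinear q" "\<And>f. f \<in> S \<Longrightarrow> q f \<le> m f" and f: "f \<in> S" for q f
  proof -
    have "res q \<in> Q" using res[OF q(1)] q(2) m(1) by (force simp: Q_def res_def)
    moreover have "res q \<le> m" using q(2) m(1) by (auto simp: le_fun_def res_def Q_def)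
    ultimately have "res q = m" by (rule m(2))
    then show ?thesis using f by (metis res_def)
  qed
  have "sublinear m" "\<And>f. f \<in> S \<Longrightarrow> m f \<le> p f" using m(1) by (auto simp: Q_def)
  with min show ?thesis by blast
qed

theorem Hahn_Banach:
  assumes p: "sublinear p" and y: "y \<in> S"
  shows "\<exists>l. (\<forall>f\<in>S. \<forall>g\<in>S. l (\<lambda>x. f x + g x) = l f + l g) \<and>
    (\<forall>c. \<forall>f\<in>S. l (\<lambda>x. c * f x) = c * l f) \<and> (\<forall>f\<in>S. l f \<le> p f) \<and> l y = p y"
proof -
  from sublinear_minimal[OF sublinear_reduce[OF p y]]
  obtain m where M: "sublinear m \<and> (\<forall>f\<in>S. m f \<le> reduce p y f) \<and>
    (\<forall>q. sublinear q \<longrightarrow> (\<forall>f\<in>S. q f \<le> m f) \<longrightarrow> (\<forall>f\<in>S. q f = m f))" ..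
  have m: "sublinear m" "\<And>f. f \<in> S \<Longrightarrow> m f \<le> reduce p y f" using M by blast+
  have min: "q f = m f" if "sublinear q" "\<And>f. f \<in> S \<Longrightarrow> q f \<le> m f" "f \<in> S" for q f
    using M that by blast
  have le: "m f \<le> p f" if "f \<in> S" for f
    using m(2)[OF that] reduce_le_self[OF p y that] by linarith
  have odd: "m (\<lambda>x. - z x) = - m z" if z: "z \<in> S" for z
  proof -
    have "reduce m z (\<lambda>x. - z x) = m (\<lambda>x. - z x)"
      by (rule min[OF sublinear_reduce[OF m(1) z] reduce_le_self[OF m(1) z] minus[OF z]])
    then show ?thesis using reduce_minus[OF m(1) z] sublinear_neg[OF m(1) z] by linarith
  qed
  have m_add: "m (\<lambda>x. f x + g x) = m f + m g" if f: "f \<in> S" and g: "g \<in> S" for f g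
  proof -
    have "m (\<lambda>x. (f x + g x) + - g x) \<le> m (\<lambda>x. f x + g x) + m (\<lambda>x. - g x)"
      by (intro sublinear_add m add minus f g)
    then show ?thesis using sublinear_add[OF m(1) f g] odd[OF g] by simp
  qed
  have m_scale: "m (\<lambda>x. c * f x) = c * m f" if f: "f \<in> S" for c f
  proof (cases "0 \<le> c")
    case True
    then show ?thesis by (rule sublinear_scale0[OF m(1) f])
  next
    case False
    then have "m (\<lambda>x. - ((- c) * f x)) = - ((- c) * m f)"
      using odd[OF scale[OF f, of "- c"]] sublinear_scale0[OF m(1) f, of "- c"] by simp
    then show ?thesis by simp
  qed
  have "m (\<lambda>x. - y x) \<le> - p y"
    using m(2)[OF minus[OF y]] reduce_minus[OF p y] by linarith
  then have "m y = p y" using odd[OF y] le[OF y] by linarith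
  with m_add m_scale le show ?thesis by (intro exI[of _ m]) blast
qed

end

lemma SUP_eq_0_iff: "(SUP x\<in>A. f x) = (0::ennreal) \<longleftrightarrow> (\<forall>x\<in>A. f x = 0)"
  using SUP_bot_conv(1)[of f A] by (simp add: bot_ennreal)

context robust_orlicz
begin

lemma ca_qs_iff: "\<mu> \<in> ca_qs M PP \<longleftrightarrow> \<mu> \<in> ca M \<and>
  (\<forall>N\<in>sets M. (\<forall>P\<in>PP. emeasure P N = 0) \<longrightarrow> total_variation M \<mu> N = 0)"
proof -
  have "total_variation M (measure P) N = emeasure P N" if "P \<in> PP" "N \<in> sets M" for P N
    using that prob_PP[OF that(1)] sets_PP[OF that(1)]
    by (intro total_variation_measure) (auto simp: prob_space_def)
  then show ?thesis
    by (auto simp: ca_qs_def abs_cont_def SUP_eq_0_iff)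
qed

lemma qs_null:
  assumes "qs Q" and N: "{x \<in> space M. \<not> Q x} \<in> sets M" and P: "P \<in> PP"
  shows "emeasure P {x \<in> space M. \<not> Q x} = 0"
  using assms AE_iff_measurable[of "{x \<in> space M. \<not> Q x}" P Q]
  by (auto simp: qs_def sets_PP space_PP)

lemma null_qs:
  assumes N: "N \<in> sets M" and P: "\<And>P. P \<in> PP \<Longrightarrow> emeasure P N = 0"
  shows "qs (\<lambda>x. x \<notin> N)"
  unfolding qs_def
proof
  fix P assume "P \<in> PP"
  then show "AE x in P. x \<notin> N" using N P sets_PP by (intro AE_not_in) (auto simp: null_sets_def)
qed

lemma ca_qs_AE:
  fixes f g :: "'a \<Rightarrow> real"
  assumes \<mu>: "\<mu> \<in> ca_qs M PP" and [measurable]: "f \<in> borel_measurable M" "g \<in> borel_measurable M"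
    and eq: "qs (\<lambda>x. f x = g x)"
  shows "AE x in variation_measure M \<mu>. f x = g x"
proof -
  interpret signed_measure M \<mu> using \<mu> by unfold_locales (simp add: ca_qs_iff)
  let ?N = "{x \<in> space M. \<not> f x = g x}"
  have N: "?N \<in> sets M" by measurable
  have "total_variation M \<mu> ?N = 0" using \<mu> N qs_null[OF eq N] unfolding ca_qs_iff by blast
  then have "emeasure V ?N = 0" using N by (simp add: emeasure_V)
  with N show ?thesis by (intro AE_I[of _ _ ?N]) auto
qed

definition jint :: "('a set \<Rightarrow> real) \<Rightarrow> ('a \<Rightarrow> real) \<Rightarrow> real" where
  "jint \<mu> f = (\<integral>x. f x \<partial>pos_part M \<mu>) - (\<integral>x. f x \<partial>neg_part M \<mu>)"

lemma
  assumes \<mu>: "\<mu> \<in> ca_qs M PP" and f: "f \<in> borel_measurable M"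
  shows integrable_rep: "integrable (variation_measure M \<mu>) (rep (cl f)) \<longleftrightarrow> integrable (variation_measure M \<mu>) f"
    and integral_rep: "(\<integral>x. rep (cl f) x \<partial>variation_measure M \<mu>) = (\<integral>x. f x \<partial>variation_measure M \<mu>)"
    and signed_integral_cl: "signed_integral M \<mu> (cl f) = jint \<mu> f"
proof -
  interpret signed_measure M \<mu> using \<mu> by unfold_locales (simp add: ca_qs_iff)
  have r: "rep (cl f) \<in> borel_measurable M" by (rule rep_cl(1)[OF f])
  have ae: "AE x in V. rep (cl f) x = f x" by (rule ca_qs_AE[OF \<mu> r f rep_qs_eq[OF f]])
  have mV: "rep (cl f) \<in> borel_measurable V" "f \<in> borel_measurable V"
    using r f by (auto simp: measurable_V)
  show "integrable V (rep (cl f)) \<longleftrightarrow> integrable V f" by (rule integrable_cong_AE[OF mV ae])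
  show "(\<integral>x. rep (cl f) x \<partial>V) = (\<integral>x. f x \<partial>V)" by (rule integral_cong_AE[OF mV ae])
  have mp: "borel_measurable (pos_part M \<mu>) = borel_measurable M"
    "borel_measurable (neg_part M \<mu>) = borel_measurable M"
    by (auto intro!: measurable_cong_sets simp: neg_part_def pos_part_def)
  have "(\<integral>x. rep (cl f) x \<partial>pos_part M \<mu>) = (\<integral>x. f x \<partial>pos_part M \<mu>)"
    by (rule integral_cong_AE[OF _ _ AE_parts(1)[OF ae]]) (use r f mp in blast)+
  moreover have "(\<integral>x. rep (cl f) x \<partial>neg_part M \<mu>) = (\<integral>x. f x \<partial>neg_part M \<mu>)"
    by (rule integral_cong_AE[OF _ _ AE_parts(2)[OF ae]]) (use r f mp in blast)+
  ultimately show "signed_integral M \<mu> (cl f) = jint \<mu> f"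
    by (simp add: signed_integral_def jint_def)
qed

lemma ca_on_iff:
  assumes V: "qs_subspace M PP LP V"
  shows "\<mu> \<in> ca_on M PP \<phi> V \<longleftrightarrow> \<mu> \<in> ca_qs M PP \<and>
    (\<forall>f\<in>fs V. integrable (variation_measure M \<mu>) f) \<and>
    (\<exists>K. \<forall>f\<in>fs V. \<bar>\<integral>x. f x \<partial>variation_measure M \<mu>\<bar> \<le> K * nn f)"
proof (cases "\<mu> \<in> ca_qs M PP")
  case \<mu>: True
  note VLP = subspace_fs(1)[OF V]
  let ?v = "variation_measure M \<mu>"
  let ?l = "\<lambda>X. \<integral>x. rep X x \<partial>?v"
  have 1: "(\<forall>X\<in>V. integrable ?v (rep X)) \<longleftrightarrow> (\<forall>f\<in>fs V. integrable ?v f)"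
  proof (intro iffI ballI)
    fix f assume "\<forall>X\<in>V. integrable ?v (rep X)" "f \<in> fs V"
    then show "integrable ?v f" using integrable_rep[OF \<mu>, of f] by (auto simp: fs_def)
  next
    fix X assume "\<forall>f\<in>fs V. integrable ?v f" "X \<in> V"
    then show "integrable ?v (rep X)" using rep_fs[OF VLP] by blast
  qed
  have 2: "continuous_map (subtopology (Phi_topology M PP \<phi>) V) euclideanreal ?l \<longleftrightarrow>
      (\<exists>K. \<forall>f\<in>fs V. \<bar>\<integral>x. f x \<partial>?v\<bar> \<le> K * nn f)"
    if int: "\<forall>f\<in>fs V. integrable ?v f"
  proof -
    have add: "?l (qs_add M PP X Y) = ?l X + ?l Y" if X: "X \<in> V" and Y: "Y \<in> V" for X Y
    proof -
      obtain f where f: "f \<in> fs V" "X = cl f" using X by (rule fs_obtain[OF VLP])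
      obtain g where g: "g \<in> fs V" "Y = cl g" using Y by (rule fs_obtain[OF VLP])
      have [measurable]: "f \<in> borel_measurable M" "g \<in> borel_measurable M" using f g by (auto intro: fs_measurable)
      show ?thesis using f g int by (simp add: qs_add_cl integral_rep[OF \<mu>])
    qed
    have scale: "?l (qs_scale M PP c X) = c * ?l X" if X: "X \<in> V" for c X
    proof -
      obtain f where f: "f \<in> fs V" "X = cl f" using X by (rule fs_obtain[OF VLP])
      have [measurable]: "f \<in> borel_measurable M" using f by (auto intro: fs_measurable)
      show ?thesis using f int by (simp add: qs_scale_cl[of f f] integral_rep[OF \<mu>])
    qed
    have "(\<exists>K. \<forall>f\<in>fs V. \<bar>?l (cl f)\<bar> \<le> K * nn f) \<longleftrightarrow> (\<exists>K. \<forall>f\<in>fs V. \<bar>\<integral>x. f x \<partial>?v\<bar> \<le> K * nn f)"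
      using integral_rep[OF \<mu> fs_measurable] by simp
    then show ?thesis
      unfolding subtopology_eq[OF VLP] using continuous_iff_bounded[of V ?l, OF V add scale] by simp
  qed
  show ?thesis using \<mu> 1 2 by (auto simp: ca_on_def)
qed (simp add: ca_on_def)

lemma norm_dual_iff:
  assumes V: "qs_subspace M PP LP V"
  shows "l \<in> norm_dual M PP V (Phi_norm PP \<phi>) \<longleftrightarrow> l \<in> extensional V \<and>
    (\<forall>f\<in>fs V. \<forall>g\<in>fs V. l (cl (\<lambda>x. f x + g x)) = l (cl f) + l (cl g)) \<and>
    (\<forall>c. \<forall>f\<in>fs V. l (cl (\<lambda>x. c * f x)) = c * l (cl f)) \<and>
    (\<exists>K. \<forall>f\<in>fs V. \<bar>l (cl f)\<bar> \<le> K * nn f)" (is "_ \<longleftrightarrow> ?R")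
proof -
  note VLP = subspace_fs(1)[OF V]
  have add: "(\<forall>X\<in>V. \<forall>Y\<in>V. l (qs_add M PP X Y) = l X + l Y) \<longleftrightarrow>
    (\<forall>f\<in>fs V. \<forall>g\<in>fs V. l (cl (\<lambda>x. f x + g x)) = l (cl f) + l (cl g))"
  proof (intro iffI ballI)
    fix f g assume L: "\<forall>X\<in>V. \<forall>Y\<in>V. l (qs_add M PP X Y) = l X + l Y" and f: "f \<in> fs V" and g: "g \<in> fs V"
    show "l (cl (\<lambda>x. f x + g x)) = l (cl f) + l (cl g)"
      using L cl_in[OF f] cl_in[OF g] qs_add_cl[OF fs_measurable[OF f] fs_measurable[OF g]] by metis
  next
    fix X Y assume L: "\<forall>f\<in>fs V. \<forall>g\<in>fs V. l (cl (\<lambda>x. f x + g x)) = l (cl f) + l (cl g)"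
      and X: "X \<in> V" and Y: "Y \<in> V"
    obtain f where f: "f \<in> fs V" "X = cl f" using X by (rule fs_obtain[OF VLP])
    obtain g where g: "g \<in> fs V" "Y = cl g" using Y by (rule fs_obtain[OF VLP])
    show "l (qs_add M PP X Y) = l X + l Y"
      using L f g qs_add_cl[OF fs_measurable[OF f(1)] fs_measurable[OF g(1)]] by metis
  qed
  have scale: "(\<forall>c. \<forall>X\<in>V. l (qs_scale M PP c X) = c * l X) \<longleftrightarrow>
    (\<forall>c. \<forall>f\<in>fs V. l (cl (\<lambda>x. c * f x)) = c * l (cl f))"
  proof (intro iffI ballI allI)
    fix c f assume L: "\<forall>c. \<forall>X\<in>V. l (qs_scale M PP c X) = c * l X" and f: "f \<in> fs V"
    show "l (cl (\<lambda>x. c * f x)) = c * l (cl f)"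
      using L cl_in[OF f] qs_scale_cl[OF fs_measurable[OF f] fs_measurable[OF f], of c] by metis
  next
    fix c X assume L: "\<forall>c. \<forall>f\<in>fs V. l (cl (\<lambda>x. c * f x)) = c * l (cl f)" and X: "X \<in> V"
    obtain f where f: "f \<in> fs V" "X = cl f" using X by (rule fs_obtain[OF VLP])
    show "l (qs_scale M PP c X) = c * l X"
      using L f qs_scale_cl[OF fs_measurable[OF f(1)] fs_measurable[OF f(1)], of c] by metis
  qed
  have "continuous_map (norm_topology M PP V (Phi_norm PP \<phi>)) euclideanreal l \<longleftrightarrow>
      (\<exists>K. \<forall>f\<in>fs V. \<bar>l (cl f)\<bar> \<le> K * nn f)"
    if "\<forall>X\<in>V. \<forall>Y\<in>V. l (qs_add M PP X Y) = l X + l Y" "\<forall>c. \<forall>X\<in>V. l (qs_scale M PP c X) = c * l X"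
    using that by (intro continuous_iff_bounded[OF V]) auto
  then show ?thesis
    unfolding norm_dual_def mem_Collect_eq add[symmetric] scale[symmetric] by blast
qed

lemma dual_norm_le_1:
  assumes V: "qs_subspace M PP LP V" and l: "l \<in> norm_dual M PP V (Phi_norm PP \<phi>)"
  shows "dual_norm V (Phi_norm PP \<phi>) l \<le> 1 \<longleftrightarrow> (\<forall>f\<in>fs V. \<bar>l (cl f)\<bar> \<le> nn f)"
proof
  note VLP = subspace_fs(1)[OF V] and sub = subspace_fs(2-4)[OF V]
  have scale: "\<And>c f. f \<in> fs V \<Longrightarrow> l (cl (\<lambda>x. c * f x)) = c * l (cl f)"
    and bd: "\<exists>K. \<forall>f\<in>fs V. \<bar>l (cl f)\<bar> \<le> K * nn f"
    using l unfolding norm_dual_iff[OF V] by blast+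
  assume L: "dual_norm V (Phi_norm PP \<phi>) l \<le> 1"
  show "\<forall>f\<in>fs V. \<bar>l (cl f)\<bar> \<le> nn f"
  proof
    fix f assume f: "f \<in> fs V"
    have fL: "f \<in> LF" by (rule fs_LF[OF VLP f])
    show "\<bar>l (cl f)\<bar> \<le> nn f"
    proof (cases "nn f = 0")
      case True
      obtain K where "\<forall>f\<in>fs V. \<bar>l (cl f)\<bar> \<le> K * nn f" using bd ..
      then have "\<bar>l (cl f)\<bar> \<le> K * nn f" using f by blast
      with True show ?thesis by simp
    next
      case False
      then have n: "0 < nn f" using nn_nonneg[of f] by linarith
      define g where "g x = (1 / nn f) * f x" for x
      have g: "g \<in> fs V" unfolding g_def[abs_def] by (rule sub(3)[OF f])
      have "nn g = 1" unfolding g_def[abs_def] nn_scale[OF fL] using n by simp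
      then have "Phi_norm PP \<phi> (cl g) \<le> 1"
        using fs_LF[OF VLP g] by (simp add: Phi_norm_cl LF_def Lux_eq_nn)
      then have "ennreal \<bar>l (cl g)\<bar> \<le> dual_norm V (Phi_norm PP \<phi>) l"
        unfolding dual_norm_def using cl_in[OF g] by (intro SUP_upper) auto
      also note L
      finally have "\<bar>l (cl g)\<bar> \<le> 1" by simp
      moreover have "l (cl g) = (1 / nn f) * l (cl f)" unfolding g_def[abs_def] by (rule scale[OF f])
      ultimately show ?thesis using n by (simp add: abs_mult field_simps)
    qed
  qed
next
  note VLP = subspace_fs(1)[OF V]
  assume L: "\<forall>f\<in>fs V. \<bar>l (cl f)\<bar> \<le> nn f"
  show "dual_norm V (Phi_norm PP \<phi>) l \<le> 1"
    unfolding dual_norm_def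
  proof (rule SUP_least)
    fix X assume "X \<in> {X \<in> V. Phi_norm PP \<phi> X \<le> 1}"
    then have X: "X \<in> V" "Phi_norm PP \<phi> X \<le> 1" by auto
    obtain f where f: "f \<in> fs V" "X = cl f" using X(1) by (rule fs_obtain[OF VLP])
    have "ennreal (nn f) \<le> 1"
      using X(2) f fs_LF[OF VLP f(1)] by (simp add: Phi_norm_cl LF_def Lux_eq_nn)
    moreover have "ennreal \<bar>l X\<bar> \<le> ennreal (nn f)" using L f by (auto intro: ennreal_leI)
    ultimately show "ennreal \<bar>l X\<bar> \<le> 1" by (rule order_trans[rotated])
  qed
qed

lemma extend_functional:
  assumes V: "qs_subspace M PP LP V"
    and add: "\<And>f g. f \<in> fs V \<Longrightarrow> g \<in> fs V \<Longrightarrow> k (\<lambda>x. f x + g x) = k f + k g"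
    and scale: "\<And>c f. f \<in> fs V \<Longrightarrow> k (\<lambda>x. c * f x) = c * k f"
    and bd: "\<And>f. f \<in> fs V \<Longrightarrow> \<bar>k f\<bar> \<le> K * nn f"
  obtains l where "l \<in> norm_dual M PP V (Phi_norm PP \<phi>)" "\<And>f. f \<in> fs V \<Longrightarrow> l (cl f) = k f"
proof -
  note VLP = subspace_fs(1)[OF V] and sub = subspace_fs(2-4)[OF V]
  define l where "l = restrict (\<lambda>X. k (rep X)) V"
  have eq: "l (cl f) = k f" if f: "f \<in> fs V" for f
  proof -
    have r: "rep (cl f) \<in> fs V" by (rule rep_fs[OF VLP cl_in[OF f]])
    have d: "(\<lambda>x. rep (cl f) x + - 1 * f x) \<in> fs V" by (rule sub(2)[OF r sub(3)[OF f]])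
    have "nn (\<lambda>x. rep (cl f) x + - 1 * f x) = nn (\<lambda>_. 0)"
      by (rule nn_cong, rule qs_elim[OF rep_qs_eq[OF fs_measurable[OF f]]]) simp
    then have "k (\<lambda>x. rep (cl f) x + - 1 * f x) = 0" using bd[OF d] by simp
    then have "k (rep (cl f)) = k f" using add[OF r sub(3)[OF f], of "-1"] scale[OF f, of "-1"] by simp
    then show ?thesis using cl_in[OF f] by (simp add: l_def)
  qed
  have "l \<in> norm_dual M PP V (Phi_norm PP \<phi>)"
    unfolding norm_dual_iff[OF V]
  proof (intro conjI ballI allI exI)
    show "l \<in> extensional V" by (simp add: l_def)
    fix f assume f: "f \<in> fs V"
    show "\<bar>l (cl f)\<bar> \<le> K * nn f" using bd f by (simp add: eq)
    show "l (cl (\<lambda>x. c * f x)) = c * l (cl f)" for c by (simp add: eq f sub(3) scale)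
    show "l (cl (\<lambda>x. f x + g x)) = l (cl f) + l (cl g)" if "g \<in> fs V" for g
      by (simp add: eq f that sub(2) add)
  qed
  then show thesis using eq by (rule that)
qed

lemma abs_jint_le:
  assumes \<mu>: "\<mu> \<in> ca M" and f: "f \<in> borel_measurable M" and i: "integrable (variation_measure M \<mu>) f"
  shows "\<bar>jint \<mu> f\<bar> \<le> (\<integral>x. \<bar>f x\<bar> \<partial>variation_measure M \<mu>)"
proof -
  interpret signed_measure M \<mu> by unfold_locales (rule \<mu>)
  have p: "integrable (pos_part M \<mu>) f" "integrable (neg_part M \<mu>) f"
    using i integrable_V_iff(1)[OF f] by auto
  have "(\<integral>x. \<bar>f x\<bar> \<partial>V) = (\<integral>x. \<bar>f x\<bar> \<partial>pos_part M \<mu>) + (\<integral>x. \<bar>f x\<bar> \<partial>neg_part M \<mu>)"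
    using i f by (intro integrable_V_iff(2)) auto
  moreover have "\<bar>\<integral>x. f x \<partial>pos_part M \<mu>\<bar> \<le> (\<integral>x. \<bar>f x\<bar> \<partial>pos_part M \<mu>)"
    "\<bar>\<integral>x. f x \<partial>neg_part M \<mu>\<bar> \<le> (\<integral>x. \<bar>f x\<bar> \<partial>neg_part M \<mu>)"
    by (rule integral_abs_bound)+
  ultimately show ?thesis unfolding jint_def by linarith
qed

lemma ca_functional_in_dual:
  assumes V: "qs_subspace M PP LP V" and abs: "\<And>f. f \<in> fs V \<Longrightarrow> (\<lambda>x. \<bar>f x\<bar>) \<in> fs V"
    and \<mu>: "\<mu> \<in> ca_on M PP \<phi> V"
  shows "ca_functional M V \<mu> \<in> norm_dual M PP V (Phi_norm PP \<phi>)"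
    and "\<And>f. f \<in> fs V \<Longrightarrow> ca_functional M V \<mu> (cl f) = jint \<mu> f"
proof -
  note VLP = subspace_fs(1)[OF V] and sub = subspace_fs(2-4)[OF V]
  have \<mu>qs: "\<mu> \<in> ca_qs M PP" and int: "\<And>f. f \<in> fs V \<Longrightarrow> integrable (variation_measure M \<mu>) f"
    and bd: "\<exists>K. \<forall>f\<in>fs V. \<bar>\<integral>x. f x \<partial>variation_measure M \<mu>\<bar> \<le> K * nn f"
    using \<mu> unfolding ca_on_iff[OF V] by blast+
  interpret signed_measure M \<mu> using \<mu>qs by unfold_locales (simp add: ca_qs_iff)
  show eq: "ca_functional M V \<mu> (cl f) = jint \<mu> f" if "f \<in> fs V" for f
    using signed_integral_cl[OF \<mu>qs fs_measurable[OF that]] cl_in[OF that] by (simp add: ca_functional_def)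
  obtain K where K: "\<And>f. f \<in> fs V \<Longrightarrow> \<bar>\<integral>x. f x \<partial>variation_measure M \<mu>\<bar> \<le> K * nn f" using bd by blast
  have p: "integrable (pos_part M \<mu>) f" "integrable (neg_part M \<mu>) f" if "f \<in> fs V" for f
    using int[OF that] integrable_V_iff(1)[OF fs_measurable[OF that]] by auto
  show "ca_functional M V \<mu> \<in> norm_dual M PP V (Phi_norm PP \<phi>)"
    unfolding norm_dual_iff[OF V]
  proof (intro conjI ballI allI exI)
    show "ca_functional M V \<mu> \<in> extensional V" by (simp add: ca_functional_def)
    fix f assume f: "f \<in> fs V"
    have "\<bar>jint \<mu> f\<bar> \<le> (\<integral>x. \<bar>f x\<bar> \<partial>variation_measure M \<mu>)"
      by (rule abs_jint_le[OF in_ca fs_measurable[OF f] int[OF f]])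
    then show "\<bar>ca_functional M V \<mu> (cl f)\<bar> \<le> K * nn f"
      using K[OF abs[OF f]] unfolding eq[OF f] nn_abs by linarith
    show "ca_functional M V \<mu> (cl (\<lambda>x. c * f x)) = c * ca_functional M V \<mu> (cl f)" for c
      by (simp add: eq f sub(3) jint_def right_diff_distrib)
    show "ca_functional M V \<mu> (cl (\<lambda>x. f x + g x)) = ca_functional M V \<mu> (cl f) + ca_functional M V \<mu> (cl g)"
      if "g \<in> fs V" for g
      using p[OF f] p[OF that] by (simp add: eq f that sub(2) jint_def)
  qed
qed

end

section \<open>The space of integrable functions as a robust Orlicz space\<close>

text \<open>
  No measurability is assumed here: the two norms compared below are evaluated at arbitrary sets
  \<open>X\<close>, also at those that are not classes, where \<open>rep X\<close> is an arbitrary function.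
\<close>

lemma nn_integral_cmult_ge:
  fixes h :: "'a \<Rightarrow> ennreal"
  shows "ennreal c * integral\<^sup>N Q h \<le> (\<integral>\<^sup>+x. ennreal c * h x \<partial>Q)"
  unfolding nn_integral_def[of Q h] SUP_mult_left_ennreal
proof (rule SUP_least)
  fix g assume "g \<in> {g. simple_function Q g \<and> g \<le> h}"
  then have g: "simple_function Q g" "\<And>x. g x \<le> h x" by (auto simp: le_fun_def)
  have sf: "simple_function Q (\<lambda>x. ennreal c * g x)" using g(1) by (intro simple_function_mult) auto
  have "ennreal c * integral\<^sup>S Q g = integral\<^sup>S Q (\<lambda>x. ennreal c * g x)" using g(1) by simp
  also have "\<dots> = (\<integral>\<^sup>+x. ennreal c * g x \<partial>Q)" by (rule nn_integral_eq_simple_integral[OF sf, symmetric])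
  also have "\<dots> \<le> (\<integral>\<^sup>+x. ennreal c * h x \<partial>Q)" by (intro nn_integral_mono mult_left_mono g) simp
  finally show "ennreal c * integral\<^sup>S Q g \<le> (\<integral>\<^sup>+x. ennreal c * h x \<partial>Q)" .
qed

lemma L1_norm_eq: "L1_norm Q X = Phi_norm {Q} (\<lambda>_ x. ennreal x) X"
proof -
  define a where "a = (\<integral>\<^sup>+x. ennreal \<bar>rep X x\<bar> \<partial>Q)"
  have iff: "(\<integral>\<^sup>+x. ennreal (\<bar>rep X x\<bar> / r) \<partial>Q) \<le> 1 \<longleftrightarrow> a \<le> ennreal r" if r: "0 < r" for r
  proof
    have e1: "ennreal r * ennreal (\<bar>rep X x\<bar> / r) = ennreal \<bar>rep X x\<bar>" for x
      using r by (simp flip: ennreal_mult')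
    have e2: "ennreal (1 / r) * ennreal \<bar>rep X x\<bar> = ennreal (\<bar>rep X x\<bar> / r)" for x
      using r by (simp flip: ennreal_mult')
    have e3: "ennreal r * ennreal (1 / r) = 1" using r by (simp flip: ennreal_mult')
    {
      assume "(\<integral>\<^sup>+x. ennreal (\<bar>rep X x\<bar> / r) \<partial>Q) \<le> 1"
      have "ennreal (1 / r) * a \<le> (\<integral>\<^sup>+x. ennreal (1 / r) * ennreal \<bar>rep X x\<bar> \<partial>Q)"
        unfolding a_def by (rule nn_integral_cmult_ge)
      also have "\<dots> \<le> 1" unfolding e2 by fact
      finally have "ennreal r * (ennreal (1 / r) * a) \<le> ennreal r * 1" by (intro mult_left_mono) auto
      then show "a \<le> ennreal r" using e3 by (simp flip: mult.assoc)
    }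
    assume A: "a \<le> ennreal r"
    have "ennreal r * (\<integral>\<^sup>+x. ennreal (\<bar>rep X x\<bar> / r) \<partial>Q) \<le> (\<integral>\<^sup>+x. ennreal r * ennreal (\<bar>rep X x\<bar> / r) \<partial>Q)"
      by (rule nn_integral_cmult_ge)
    also have "\<dots> \<le> ennreal r" using A by (simp add: e1 a_def)
    finally have "ennreal (1 / r) * (ennreal r * (\<integral>\<^sup>+x. ennreal (\<bar>rep X x\<bar> / r) \<partial>Q)) \<le> ennreal (1 / r) * ennreal r"
      by (intro mult_left_mono) auto
    then show "(\<integral>\<^sup>+x. ennreal (\<bar>rep X x\<bar> / r) \<partial>Q) \<le> 1" using e3 by (simp add: mult.commute[of "ennreal (1 / r)"] flip: mult.assoc)
  qed
  have "Phi_norm {Q} (\<lambda>_ x. ennreal x) X = Inf {ennreal r | r. 0 < r \<and> a \<le> ennreal r}"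
    unfolding Phi_norm_def by (rule arg_cong[of _ _ Inf]) (use iff in auto)
  also have "\<dots> = a"
  proof (rule antisym)
    show "a \<le> Inf {ennreal r | r. 0 < r \<and> a \<le> ennreal r}" by (rule Inf_greatest) auto
    show "Inf {ennreal r | r. 0 < r \<and> a \<le> ennreal r} \<le> a"
    proof (rule ennreal_le_epsilon)
      fix e :: real assume "a < \<top>" "0 < e"
      then obtain b where b: "0 \<le> b" "a = ennreal b" by (cases a) auto
      have "Inf {ennreal r | r. 0 < r \<and> a \<le> ennreal r} \<le> ennreal (b + e)"
        by (rule Inf_lower) (use b \<open>0 < e\<close> in \<open>auto intro!: exI[of _ "b + e"] ennreal_leI simp del: ennreal_plus\<close>)
      then show "Inf {ennreal r | r. 0 < r \<and> a \<le> ennreal r} \<le> a + ennreal e"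
        using b \<open>0 < e\<close> by simp
    qed
  qed
  finally show ?thesis by (simp add: L1_norm_def a_def)
qed

lemma L1_eq: "L1 M Q = L_Phi M {Q} (\<lambda>_ x. ennreal x)"
  by (simp add: L1_def L_Phi_def L1_norm_eq)

lemma orlicz_ennreal: "orlicz_function (\<lambda>x. ennreal x)"
  unfolding orlicz_function_def
proof (intro conjI allI impI)
  show "ennreal x \<le> Liminf (at x within {0..}) ennreal" for x
    unfolding le_Liminf_iff
  proof (intro allI impI)
    fix y assume "y < ennreal x"
    moreover have "(ennreal \<longlongrightarrow> ennreal x) (at x within {0..})"
      by (intro tendsto_ennrealI tendsto_ident_at)
    ultimately show "\<forall>\<^sub>F z in at x within {0..}. y < ennreal z" by (intro order_tendstoD)
  qed
  show "mono_on {0..} ennreal" by (auto intro!: mono_onI ennreal_leI)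
  show "ennreal (u * x + v * y) \<le> ennreal u * ennreal x + ennreal v * ennreal y"
    if "0 \<le> x" "0 \<le> y" "0 \<le> u" "0 \<le> v" "u + v = 1" for x y u v :: real
    using that by (simp add: ennreal_mult)
  show "\<exists>x>0. ennreal x < \<infinity>" "\<exists>x>0. 0 < ennreal x" by (auto intro: exI[of _ 1])
qed simp

context
  fixes M Q :: "'a measure"
  assumes Q: "prob_space Q" and sets_Q: "sets Q = sets M"
begin

interpretation Q: prob_space Q by (rule Q)

lemma L1_robust: "robust_orlicz M {Q} (\<lambda>_ x. ennreal x)"
  by unfold_locales (auto simp: priors_def Q sets_Q orlicz_ennreal)

interpretation L1: robust_orlicz M "{Q}" "\<lambda>_ x. ennreal x"
  by (rule L1_robust)

lemma L1_Lux:
  assumes f: "f \<in> borel_measurable M"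
  shows "L1.Lux f = (\<integral>\<^sup>+x. ennreal \<bar>f x\<bar> \<partial>Q)"
proof -
  have "AE x in Q. rep (qs_class M {Q} f) x = f x"
    using L1.rep_qs_eq[OF f] by (simp add: L1.qs_def)
  then have "(\<integral>\<^sup>+x. ennreal \<bar>rep (qs_class M {Q} f) x\<bar> \<partial>Q) = (\<integral>\<^sup>+x. ennreal \<bar>f x\<bar> \<partial>Q)"
    by (intro nn_integral_cong_AE) auto
  then show ?thesis
    using L1.Phi_norm_cl[OF f] L1_norm_eq[of Q "qs_class M {Q} f"] by (simp add: L1_norm_def)
qed

lemma L1_LF: "f \<in> L1.LF \<longleftrightarrow> f \<in> borel_measurable M \<and> integrable Q f"
  using measurable_cong_sets[OF sets_Q refl, of borel]
  by (auto simp: L1.LF_def L1_Lux integrable_iff_bounded)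

lemma L1_nn: "f \<in> L1.LF \<Longrightarrow> L1.nn f = (\<integral>x. \<bar>f x\<bar> \<partial>Q)"
  using L1_LF[of f] unfolding L1.nn_def
  by (subst L1_Lux) (auto simp: integral_eq_nn_integral L1.LF_def)

lemma L1_Linf: "robust_orlicz_Linf M {Q} (\<lambda>_ x. ennreal x)"
proof unfold_locales
  show "Linf M {Q} \<subseteq> L_Phi M {Q} (\<lambda>_ x. ennreal x)"
  proof
    fix X assume X: "X \<in> Linf M {Q}"
    then obtain f c where f: "f \<in> X" "\<And>x. x \<in> space M \<Longrightarrow> \<bar>f x\<bar> \<le> c" and X0: "X \<in> L0 M {Q}"
      by (auto simp: Linf_def)
    obtain g where g: "g \<in> borel_measurable M" "X = qs_class M {Q} g" using X0 unfolding L1.L0_eq by blast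
    then have fm: "f \<in> borel_measurable M" and eq: "X = qs_class M {Q} f"
      using f(1) L1.mem_cl_iff[OF g(1)] L1.cl_eq_iff[OF g(1), of f] by auto
    have "space Q = space M" using sets_Q by (rule sets_eq_imp_space_eq)
    moreover have "f \<in> borel_measurable Q" using fm measurable_cong_sets[OF sets_Q refl, of borel] by blast
    ultimately have "integrable Q f" using f(2) by (intro Q.integrable_const_bound[where B = c]) (auto intro: AE_I2)
    then have "f \<in> L1.LF" using fm L1_LF by blast
    then show "X \<in> L_Phi M {Q} (\<lambda>_ x. ennreal x)" unfolding eq using L1.cl_LP_iff[OF fm] by blast
  qed
qed

end

section \<open>The dual of the space of integrable functions\<close>

lemma (in signed_measure) TV_null:
  assumes N: "N \<in> sets M" and 0: "\<And>A. A \<in> sets M \<Longrightarrow> A \<subseteq> N \<Longrightarrow> \<mu> A = 0"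
  shows "total_variation M \<mu> N = 0"
proof -
  interpret minus: signed_measure M "\<lambda>A. - \<mu> A" by unfold_locales (rule neg_in_ca)
  have "pos N = 0" "minus.pos N = 0"
    using 0 by (auto intro!: antisym pos_least minus.pos_least)
  then show ?thesis by (simp add: total_variation_eq[OF N])
qed

lemma AE_le_const_if_set_integrals_le:
  fixes h :: "'a \<Rightarrow> real"
  assumes Q: "finite_measure Q" and h: "integrable Q h"
    and le: "\<And>A. A \<in> sets Q \<Longrightarrow> (LINT x:A|Q. h x) \<le> K * measure Q A"
  shows "AE x in Q. h x \<le> K"
proof -
  interpret finite_measure Q by fact
  have [measurable]: "h \<in> borel_measurable Q" using h by auto
  define A where "A = {x \<in> space Q. K < h x}"
  have A [measurable]: "A \<in> sets Q" unfolding A_def by measurable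
  have int: "integrable Q (\<lambda>x. indicator A x * (h x - K))"
    using integrable_real_mult_indicator[OF A, of "\<lambda>x. h x - K"] h by (simp add: mult.commute)
  have ih: "integrable Q (\<lambda>x. indicator A x * h x)"
    using integrable_real_mult_indicator[OF A h] by (simp add: mult.commute)
  have "(\<integral>x. indicator A x * (h x - K) \<partial>Q) = (\<integral>x. indicator A x * h x - K * indicator A x \<partial>Q)"
    by (simp add: algebra_simps)
  also have "\<dots> = (\<integral>x. indicator A x * h x \<partial>Q) - (\<integral>x. K * indicator A x \<partial>Q)"
    using ih by (intro Bochner_Integration.integral_diff) (auto simp: emeasure_finite less_top[symmetric])
  also have "\<dots> = (LINT x:A|Q. h x) - K * measure Q A"
    using sets.sets_into_space[OF A] by (simp add: set_lebesgue_integral_def Int_absorb2)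
  also have "\<dots> \<le> 0" using le[OF A] by simp
  finally have "(\<integral>x. indicator A x * (h x - K) \<partial>Q) \<le> 0" .
  moreover have nn: "AE x in Q. 0 \<le> indicator A x * (h x - K)"
    by (auto simp: A_def split: split_indicator)
  ultimately have "(\<integral>x. indicator A x * (h x - K) \<partial>Q) = 0"
    using integral_nonneg_AE[OF nn] by simp
  then have "AE x in Q. indicator A x * (h x - K) = 0"
    using integral_nonneg_eq_0_iff_AE[OF int nn] by simp
  then show ?thesis
  proof (rule AE_mp, intro AE_I2 impI)
    fix x assume "x \<in> space Q" "indicator A x * (h x - K) = 0"
    then show "h x \<le> K" by (auto simp: A_def indicator_def split: if_splits)
  qed
qed

context
  fixes M Q :: "'a measure"
  assumes Q: "prob_space Q" and sets_Q: "sets Q = sets M"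
begin

interpretation Q: prob_space Q by (rule Q)

interpretation L1: robust_orlicz_Linf M "{Q}" "\<lambda>_ x. ennreal x"
  by (rule L1_Linf[OF Q sets_Q])

lemma LP_subspace: "qs_subspace M {Q} L1.LP L1.LP"
  by (rule L1.subspaceI) (auto simp: L1.fs_LP intro: L1.LF_add L1.LF_scale)

lemma meas_Q: "(f \<in> borel_measurable Q) = (f \<in> borel_measurable M)" for f :: "'a \<Rightarrow> real"
  using measurable_cong_sets[OF sets_Q refl, of borel] by blast

lemma space_Q: "space Q = space M"
  using sets_Q by (rule sets_eq_imp_space_eq)

lemma L1_dual_obtains:
  assumes l: "l \<in> norm_dual M {Q} (L1 M Q) (L1_norm Q)"
  obtains g c where "g \<in> borel_measurable M" "\<And>x. \<bar>g x\<bar> \<le> c"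
    "\<And>f. f \<in> borel_measurable M \<Longrightarrow> integrable Q f \<Longrightarrow> l (qs_class M {Q} f) = (\<integral>x. g x * f x \<partial>Q)"
proof -
  have N_eq: "L1_norm Q = Phi_norm {Q} (\<lambda>_ x. ennreal x)" by (rule ext) (rule L1_norm_eq)
  have l': "l \<in> norm_dual M {Q} L1.LP (Phi_norm {Q} (\<lambda>_ x. ennreal x))"
    using l unfolding L1_eq N_eq .
  have LFI: "f \<in> L1.LF" if "f \<in> borel_measurable M" "integrable Q f" for f
    using that L1_LF[OF Q sets_Q] by blast
  have LFD: "f \<in> borel_measurable M" "integrable Q f" if "f \<in> L1.LF" for f
    using that L1_LF[OF Q sets_Q] by blast+
  obtain K where K: "\<And>f. f \<in> L1.LF \<Longrightarrow> \<bar>l (L1.cl f)\<bar> \<le> K * L1.nn f"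
    using l' unfolding L1.norm_dual_iff[OF LP_subspace] L1.fs_LP by blast
  interpret oc: order_continuous_functional M L1.LF "\<lambda>f. \<integral>x. \<bar>f x\<bar> \<partial>Q" "\<lambda>f. l (L1.cl f)" K
  proof
    show "f \<in> borel_measurable M" if "f \<in> L1.LF" for f using LFD[OF that] by blast
    show "f \<in> L1.LF" if "f \<in> borel_measurable M" "\<And>x. x \<in> space M \<Longrightarrow> \<bar>f x\<bar> \<le> c" for f c
      using that by (rule L1.bounded_LF)
    show "(\<lambda>x. f x + g x) \<in> L1.LF" if "f \<in> L1.LF" "g \<in> L1.LF" for f g using that by (rule L1.LF_add)
    show "(\<lambda>x. c * f x) \<in> L1.LF" if "f \<in> L1.LF" for f c using that by (rule L1.LF_scale)
    show "f \<in> L1.LF" if "g \<in> L1.LF" "f \<in> borel_measurable M" "\<And>x. x \<in> space M \<Longrightarrow> \<bar>f x\<bar> \<le> \<bar>g x\<bar>" for f g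
      using that by (intro L1.LF_solid[of g f] L1.qsI) auto
    show "(\<integral>x. \<bar>f x\<bar> \<partial>Q) \<le> (\<integral>x. \<bar>g x\<bar> \<partial>Q)"
      if "g \<in> L1.LF" "f \<in> borel_measurable M" "\<And>x. x \<in> space M \<Longrightarrow> \<bar>f x\<bar> \<le> \<bar>g x\<bar>" for f g
    proof -
      have "f \<in> L1.LF" using that by (intro L1.LF_solid[of g f] L1.qsI) auto
      then show ?thesis
        using LFD[OF that(1)] LFD[of f] that(3) by (intro integral_mono) (auto simp: space_Q)
    qed
    show "(\<lambda>n. \<integral>x. \<bar>f n x\<bar> \<partial>Q) \<longlonglongrightarrow> 0"
      if f: "\<And>n::nat. f n \<in> L1.LF" and dec: "\<And>x n. x \<in> space M \<Longrightarrow> 0 \<le> f n x \<and> f (Suc n) x \<le> f n x"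
        and lim: "\<And>x. x \<in> space M \<Longrightarrow> (\<lambda>n. f n x) \<longlonglongrightarrow> 0" for f
    proof -
      have le0: "f n x \<le> f 0 x" if "x \<in> space M" for n x
        by (induction n) (use dec[OF that] order_trans in blast)+
      have "(\<lambda>n. \<integral>x. \<bar>f n x\<bar> \<partial>Q) \<longlonglongrightarrow> (\<integral>x. 0 \<partial>Q)"
      proof (rule integral_dominated_convergence[where w = "f 0"])
        show "(\<lambda>x. \<bar>f n x\<bar>) \<in> borel_measurable Q" for n using LFD(1)[OF f, of n] by (simp add: meas_Q)
        show "integrable Q (f 0)" by (rule LFD(2)[OF f])
        show "AE x in Q. (\<lambda>n. \<bar>f n x\<bar>) \<longlonglongrightarrow> 0"
          by (rule AE_I2) (use lim tendsto_rabs_zero in \<open>auto simp: space_Q\<close>)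
        show "AE x in Q. norm \<bar>f n x\<bar> \<le> f 0 x" for n
          by (rule AE_I2) (use dec le0 in \<open>auto simp: space_Q\<close>)
      qed simp
      then show ?thesis by simp
    qed
    show "l (L1.cl (\<lambda>x. f x + g x)) = l (L1.cl f) + l (L1.cl g)" if "f \<in> L1.LF" "g \<in> L1.LF" for f g
      using l' that unfolding L1.norm_dual_iff[OF LP_subspace] L1.fs_LP by blast
    show "l (L1.cl (\<lambda>x. c * f x)) = c * l (L1.cl f)" if "f \<in> L1.LF" for c f
      using l' that unfolding L1.norm_dual_iff[OF LP_subspace] L1.fs_LP by blast
    show "\<bar>l (L1.cl f)\<bar> \<le> K * (\<integral>x. \<bar>f x\<bar> \<partial>Q)" if "f \<in> L1.LF" for f
      using K[OF that] L1_nn[OF Q sets_Q that] by simp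
  qed
  interpret signed_measure M oc.\<mu> by unfold_locales (rule oc.\<mu>_ca)
  have bd: "\<bar>oc.\<mu> A\<bar> \<le> K * measure Q A" if A: "A \<in> sets M" for A
    using oc.l_bound[OF oc.S_ind[OF A]] A sets.sets_into_space[OF A]
    by (simp add: oc.\<mu>_def space_Q Int_absorb2)
  have ac: "total_variation M oc.\<mu> N = 0" if "N \<in> sets M" "emeasure Q N = 0" for N
  proof (rule TV_null[OF that(1)])
    fix A assume A: "A \<in> sets M" "A \<subseteq> N"
    then have "emeasure Q A \<le> emeasure Q N" using that sets_Q by (intro emeasure_mono) auto
    then have "measure Q A = 0" using that(2) by (simp add: measure_def)
    then show "oc.\<mu> A = 0" using bd[OF A(1)] by simp
  qed
  obtain h where h: "h \<in> RN_class M Q oc.\<mu>"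
    using signed_integral_RN(1)[OF oc.\<mu>_ca Q.finite_measure_axioms sets_Q] ac by blast
  have RN: "(\<integral>x. f x \<partial>pos_part M oc.\<mu>) - (\<integral>x. f x \<partial>neg_part M oc.\<mu>) = (\<integral>x. f x * h x \<partial>Q)"
    if "f \<in> borel_measurable M" "integrable V f" for f
    using signed_integral_RN(2)[OF oc.\<mu>_ca Q.finite_measure_axioms sets_Q _ h that] ac by blast
  have hm [measurable]: "h \<in> borel_measurable M" and hi: "integrable Q h"
    and h\<mu>: "\<And>A. A \<in> sets M \<Longrightarrow> oc.\<mu> A = (LINT x:A|Q. h x)"
    using h by (auto simp: RN_class_def)
  have up: "AE x in Q. h x \<le> K"
  proof (rule AE_le_const_if_set_integrals_le[OF Q.finite_measure_axioms hi])
    fix A assume "A \<in> sets Q"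
    then have "A \<in> sets M" using sets_Q by blast
    then show "(LINT x:A|Q. h x) \<le> K * measure Q A" using bd[of A] h\<mu>[of A] by (simp add: abs_le_iff)
  qed
  have lo: "AE x in Q. - h x \<le> K"
  proof (rule AE_le_const_if_set_integrals_le[OF Q.finite_measure_axioms])
    show "integrable Q (\<lambda>x. - h x)" using hi by simp
    fix A assume "A \<in> sets Q"
    then have "A \<in> sets M" using sets_Q by blast
    then show "(LINT x:A|Q. - h x) \<le> K * measure Q A"
      using bd[of A] h\<mu>[of A] by (simp add: abs_le_iff set_lebesgue_integral_def)
  qed
  define g where "g x = max (min (h x) \<bar>K\<bar>) (- \<bar>K\<bar>)" for x
  have g: "g \<in> borel_measurable M" unfolding g_def[abs_def] by measurable
  have gh: "AE x in Q. g x = h x"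
    using up lo by eventually_elim (auto simp: g_def)
  show thesis
  proof (rule that[OF g, of "\<bar>K\<bar>"])
    show "\<bar>g x\<bar> \<le> \<bar>K\<bar>" for x by (auto simp: g_def)
    fix f :: "'a \<Rightarrow> real" assume f: "f \<in> borel_measurable M" "integrable Q f"
    have fL: "f \<in> L1.LF" by (rule LFI[OF f])
    have "l (L1.cl f) = (\<integral>x. f x * h x \<partial>Q)"
      using oc.representation(1,2)[OF fL] RN[OF f(1)] by simp
    also have "\<dots> = (\<integral>x. g x * f x \<partial>Q)"
      using gh f(1) g by (intro integral_cong_AE) (auto simp: meas_Q mult.commute)
    finally show "l (L1.cl f) = (\<integral>x. g x * f x \<partial>Q)" .
  qed
qed

lemma bounded_in_L1_dual:
  fixes g :: "'a \<Rightarrow> real"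
  assumes g: "g \<in> borel_measurable M" "\<And>x. x \<in> space M \<Longrightarrow> \<bar>g x\<bar> \<le> c"
  obtains l where "l \<in> norm_dual M {Q} (L1 M Q) (L1_norm Q)"
    "\<And>f. f \<in> borel_measurable M \<Longrightarrow> integrable Q f \<Longrightarrow> l (qs_class M {Q} f) = (\<integral>x. g x * f x \<partial>Q)"
proof -
  have N_eq: "L1_norm Q = Phi_norm {Q} (\<lambda>_ x. ennreal x)" by (rule ext) (rule L1_norm_eq)
  have LFD: "f \<in> borel_measurable M" "integrable Q f" if "f \<in> L1.LF" for f
    using that L1_LF[OF Q sets_Q] by blast+
  have cf: "integrable Q (\<lambda>x. c * f x)" if "f \<in> L1.LF" for f using LFD(2)[OF that] by simp
  have le: "\<bar>g x * f x\<bar> \<le> \<bar>c * f x\<bar>" if "x \<in> space M" for x f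
    using g(2)[OF that] by (simp add: abs_mult mult_right_mono)
  have gf: "integrable Q (\<lambda>x. g x * f x)" if "f \<in> L1.LF" for f :: "'a \<Rightarrow> real"
    using cf[OF that] by (rule Bochner_Integration.integrable_bound)
      (use le LFD(1)[OF that] g in \<open>auto simp: meas_Q space_Q\<close>)
  obtain l where l: "l \<in> norm_dual M {Q} L1.LP (Phi_norm {Q} (\<lambda>_ x. ennreal x))"
    "\<And>f. f \<in> L1.fs L1.LP \<Longrightarrow> l (L1.cl f) = (\<integral>x. g x * f x \<partial>Q)"
  proof (rule L1.extend_functional[OF LP_subspace, of "\<lambda>f. \<integral>x. g x * f x \<partial>Q" "\<bar>c\<bar>"])
    fix f assume "f \<in> L1.fs L1.LP"
    then have f: "f \<in> L1.LF" by (simp add: L1.fs_LP)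
    show "(\<integral>x. g x * (d * f x) \<partial>Q) = d * (\<integral>x. g x * f x \<partial>Q)" for d
      by (simp add: mult.left_commute[of _ d])
    have "\<bar>\<integral>x. g x * f x \<partial>Q\<bar> \<le> (\<integral>x. \<bar>g x * f x\<bar> \<partial>Q)" by (rule integral_abs_bound)
    also have "\<dots> \<le> (\<integral>x. \<bar>c * f x\<bar> \<partial>Q)"
      using gf[OF f] cf[OF f] le by (intro integral_mono) (auto simp: space_Q)
    also have "\<dots> = \<bar>c\<bar> * L1.nn f" by (simp add: abs_mult L1_nn[OF Q sets_Q f])
    finally show "\<bar>\<integral>x. g x * f x \<partial>Q\<bar> \<le> \<bar>c\<bar> * L1.nn f" .
    fix f' assume "f' \<in> L1.fs L1.LP"
    then have f': "f' \<in> L1.LF" by (simp add: L1.fs_LP)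
    show "(\<integral>x. g x * (f x + f' x) \<partial>Q) = (\<integral>x. g x * f x \<partial>Q) + (\<integral>x. g x * f' x \<partial>Q)"
      using gf[OF f] gf[OF f'] by (simp add: distrib_left)
  qed blast
  show thesis
  proof (rule that)
    show "l \<in> norm_dual M {Q} (L1 M Q) (L1_norm Q)" using l(1) unfolding L1_eq N_eq .
    show "l (qs_class M {Q} f) = (\<integral>x. g x * f x \<partial>Q)" if "f \<in> borel_measurable M" "integrable Q f" for f
      using that l(2)[of f] L1_LF[OF Q sets_Q, of f] by (simp add: L1.fs_LP)
  qed
qed

lemma RN_class_L1: "h \<in> RN_class M Q \<mu> \<Longrightarrow> RN_class M Q \<mu> \<in> L1 M Q"
  using RN_class_eq[OF sets_Q, of h \<mu>] L1_LF[OF Q sets_Q, of h] L1.cl_LP_iff[of h]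
  by (simp add: L1_eq RN_class_def)

lemma qs_proj_eq_iff:
  assumes "f \<in> borel_measurable M" "g \<in> borel_measurable M"
  shows "qs_class M {Q} f = qs_class M {Q} g \<longleftrightarrow> (AE x in Q. f x = g x)"
  using L1.cl_eq_iff[OF assms] by (simp add: L1.qs_def)

end

section \<open>Separable closures\<close>

locale separable_closure = robust_orlicz_Linf +
  fixes H C :: "('a \<Rightarrow> real) set set" and Pstar :: "'a measure"
  assumes H_sub: "qs_sublattice M PP LP H"
    and H_one: "cl (\<lambda>_. 1) \<in> H"
    and H_gen: "generates_sigma M PP H"
    and C_eq: "C = Phi_topology M PP \<phi> closure_of H"
    and C_sep: "separable_space (subtopology (Phi_topology M PP \<phi>) C)"
    and Pstar: "Pstar \<in> ca_prob M PP \<phi>"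
    and J_inj: "inj_on (qs_proj M Pstar) C"
begin

lemma H_subspace: "qs_subspace M PP LP H"
  using H_sub by (simp add: qs_sublattice_def)

lemma H_LP: "H \<subseteq> LP"
  by (rule subspace_fs(1)[OF H_subspace])

lemma H_abs: "f \<in> fs H \<Longrightarrow> (\<lambda>x. \<bar>f x\<bar>) \<in> fs H"
proof -
  assume f: "f \<in> fs H"
  have g: "(\<lambda>x. - 1 * f x) \<in> fs H" by (rule subspace_fs(4)[OF H_subspace f])
  have "qs_sup M PP (cl f) (cl (\<lambda>x. - 1 * f x)) \<in> H"
    using H_sub cl_in[OF f] cl_in[OF g] unfolding qs_sublattice_def by blast
  then have "cl (\<lambda>x. max (f x) (- 1 * f x)) \<in> H"
    using qs_sup_cl[OF fs_measurable[OF f] fs_measurable[OF g]] by simp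
  moreover have "(\<lambda>x. max (f x) (- 1 * f x)) = (\<lambda>x. \<bar>f x\<bar>)" by (auto simp: fun_eq_iff)
  ultimately show ?thesis using fs_measurable[OF f] by (simp add: fs_def)
qed

lemma H_C: "H \<subseteq> C"
  unfolding C_eq using closure_subset_fs[OF H_LP] fs_subset_iff[OF H_LP closure_subset_LP] by blast

sublocale closed_lattice M PP \<phi> C
proof
  show "qs_subspace M PP LP C" unfolding C_eq by (rule closure_subspace[OF H_subspace])
  show "(\<lambda>x. \<bar>f x\<bar>) \<in> fs C" if "f \<in> fs C" for f
    using that unfolding C_eq by (intro closure_abs[OF H_LP]) (auto intro: H_abs)
  show "f \<in> fs C" if "f \<in> LF" "\<And>e. 0 < e \<Longrightarrow> \<exists>g\<in>fs C. nn (\<lambda>x. f x - g x) < e" for f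
    using that unfolding C_eq by (rule closure_mem[OF H_LP])
  show "(\<lambda>_. 1) \<in> fs C" using H_one H_C by (auto simp: fs_def)
qed

lemma Pstar_prob: "prob_space Pstar" and Pstar_sets: "sets Pstar = sets M"
  and Pstar_ca_on: "measure Pstar \<in> ca_on M PP \<phi> LP"
  using Pstar by (auto simp: ca_prob_def)

sublocale Pstar: prob_space Pstar
  by (rule Pstar_prob)

lemma LP_sub: "qs_subspace M PP LP LP"
  by (rule subspaceI) (auto simp: fs_LP intro: LF_add LF_scale)

lemma V_Pstar: "variation_measure M (measure Pstar) = Pstar"
  by (rule variation_measure_measure[OF Pstar.finite_measure_axioms Pstar_sets])

lemma Pstar_qs: "measure Pstar \<in> ca_qs M PP"
  using Pstar_ca_on by (simp add: ca_on_def)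

lemma meas_Pstar: "(f \<in> borel_measurable Pstar) = (f \<in> borel_measurable M)" for f :: "'a \<Rightarrow> real"
  using measurable_cong_sets[OF Pstar_sets refl, of borel] by blast

lemma Pstar_integrable: "f \<in> LF \<Longrightarrow> integrable Pstar f"
  using Pstar_ca_on unfolding ca_on_iff[OF LP_sub] fs_LP V_Pstar by blast

lemma Pstar_AE:
  fixes f g :: "'a \<Rightarrow> real"
  shows "f \<in> borel_measurable M \<Longrightarrow> g \<in> borel_measurable M \<Longrightarrow> qs (\<lambda>x. f x = g x) \<Longrightarrow> AE x in Pstar. f x = g x"
  using ca_qs_AE[OF Pstar_qs, of f g] unfolding V_Pstar .

lemma Pstar_null: "N \<in> sets M \<Longrightarrow> (\<And>P. P \<in> PP \<Longrightarrow> emeasure P N = 0) \<Longrightarrow> emeasure Pstar N = 0"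
  using Pstar_qs total_variation_measure[OF Pstar.finite_measure_axioms Pstar_sets, of N]
  unfolding ca_qs_iff by auto

lemma Pstar_inj:
  assumes f: "f \<in> CF" and g: "g \<in> CF" and ae: "AE x in Pstar. f x = g x"
  shows "qs (\<lambda>x. f x = g x)"
proof -
  note fm = fs_measurable[OF f] and gm = fs_measurable[OF g]
  note rm = rep_cl(1)[OF fm] rep_cl(1)[OF gm]
  have "AE x in Pstar. rep (cl f) x = f x" "AE x in Pstar. rep (cl g) x = g x"
    by (intro Pstar_AE rm fm gm rep_qs_eq)+
  with ae have "AE x in Pstar. rep (cl f) x = rep (cl g) x" by eventually_elim simp
  then have "qs_proj M Pstar (cl f) = qs_proj M Pstar (cl g)"
    unfolding qs_proj_def by (subst qs_proj_eq_iff[OF Pstar_prob Pstar_sets rm])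
  then have "cl f = cl g" using J_inj cl_in[OF f] cl_in[OF g] by (auto dest: inj_onD)
  then show ?thesis using cl_eq_iff[OF fm gm] by simp
qed

abbreviation "C_sigma_complete \<equiv> dedekind_sigma_complete C (qs_le PP)"

lemma C_super_complete:
  assumes C_sigma_complete
  shows "super_dedekind_complete C (qs_le PP)"
proof (rule sigma_complete_imp_super[OF assms, of "\<lambda>f. \<integral>x. f x \<partial>Pstar"])
  have pos: "AE x in Pstar. 0 \<le> f x" if f: "f \<in> CF" and nn: "qs (\<lambda>x. 0 \<le> f x)" for f
  proof -
    have [measurable]: "f \<in> borel_measurable M" by (rule fs_measurable[OF f])
    have "qs (\<lambda>x. min (f x) 0 = 0)" using nn by (rule qs_elim) simp
    then have "AE x in Pstar. min (f x) 0 = 0" by (intro Pstar_AE) auto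
    then show ?thesis by eventually_elim (simp add: min_def split: if_splits)
  qed
  show "0 \<le> (\<integral>x. f x \<partial>Pstar)" if "f \<in> CF" "qs (\<lambda>x. 0 \<le> f x)" for f
    using pos[OF that] by (rule integral_nonneg_AE)
  show "qs (\<lambda>x. f x = 0)" if f: "f \<in> CF" "qs (\<lambda>x. 0 \<le> f x)" "(\<integral>x. f x \<partial>Pstar) \<le> 0" for f
  proof -
    have "(\<integral>x. f x \<partial>Pstar) = 0" using f(3) integral_nonneg_AE[OF pos[OF f(1,2)]] by simp
    then have "AE x in Pstar. f x = 0"
      using integral_nonneg_eq_0_iff_AE[OF Pstar_integrable[OF CF_LF[OF f(1)]] pos[OF f(1,2)]] by simp
    then show ?thesis by (rule Pstar_inj[OF f(1) CF_zero])
  qed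
qed (simp add: Pstar_integrable CF_LF)

lemma mono_complete_Linf_C: "mono_complete \<Longrightarrow> Linf M PP \<subseteq> C"
proof (rule Linf_subset[OF H_C H_gen])
  fix f :: "nat \<Rightarrow> 'a \<Rightarrow> real" and F
  assume mc: mono_complete and f: "\<And>n. f n \<in> CF" "F \<in> borel_measurable M"
    "\<And>x n. x \<in> space M \<Longrightarrow> 0 \<le> f n x \<and> f n x \<le> f (Suc n) x \<and> f n x \<le> 1"
    "\<And>x. x \<in> space M \<Longrightarrow> (\<lambda>n. f n x) \<longlonglongrightarrow> F x"
  show "F \<in> CF"
    by (rule mono_completeD(1)[where f = f and u = "\<lambda>_. 1"]) (use mc f C_one in auto)
qed

lemma C_eq_closure_Linf:
  assumes C_sigma_complete
  shows "C = Phi_topology M PP \<phi> closure_of Linf M PP"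
proof -
  have mono_complete by (rule sigma_complete_imp_mono_complete[OF C_sep assms])
  then show ?thesis by (intro closure_Linf_eq mono_complete_Linf_C)
qed

lemma C_ideal: "C = Phi_topology M PP \<phi> closure_of Linf M PP \<Longrightarrow> qs_ideal M PP LP C"
  using closure_Linf_ideal by simp

end

locale complete_closure = separable_closure +
  assumes C_complete: "dedekind_sigma_complete C (qs_le PP)"
begin

lemma C_mono_complete: mono_complete
  by (rule sigma_complete_imp_mono_complete[OF C_sep C_complete])

lemma bounded_CF: "f \<in> borel_measurable M \<Longrightarrow> (\<And>x. x \<in> space M \<Longrightarrow> \<bar>f x\<bar> \<le> c) \<Longrightarrow> f \<in> CF"
  using bounded_Linf[of f c] mono_complete_Linf_C[OF C_mono_complete] fs_subset_iff[OF Linf_LP C_LP] by blast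

lemma ind_CF: "A \<in> sets M \<Longrightarrow> (indicator A :: 'a \<Rightarrow> real) \<in> CF"
  by (rule bounded_CF[where c = 1]) (auto split: split_indicator)

lemma CF_solid: "f \<in> borel_measurable M \<Longrightarrow> g \<in> CF \<Longrightarrow> qs (\<lambda>x. \<bar>f x\<bar> \<le> \<bar>g x\<bar>) \<Longrightarrow> f \<in> CF"
  using C_ideal[OF C_eq_closure_Linf[OF C_complete]] unfolding ideal_iff by blast

lemma order_continuous:
  assumes f: "\<And>n::nat. f n \<in> CF" and dec: "\<And>x n. x \<in> space M \<Longrightarrow> 0 \<le> f n x \<and> f (Suc n) x \<le> f n x"
    and lim: "\<And>x. x \<in> space M \<Longrightarrow> (\<lambda>n. f n x) \<longlonglongrightarrow> 0"
  shows "(\<lambda>n. nn (f n)) \<longlonglongrightarrow> 0"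
proof -
  have "(\<lambda>n. nn (\<lambda>x. f 0 x - (f 0 x - f n x))) \<longlonglongrightarrow> 0"
  proof (rule mono_completeD(2)[OF C_mono_complete, where u = "f 0"])
    show "(\<lambda>x. f 0 x - f n x) \<in> CF" for n by (intro CF_diff f)
    show "(\<lambda>n. f 0 x - f n x) \<longlonglongrightarrow> f 0 x" if "x \<in> space M" for x
      using tendsto_diff[OF tendsto_const lim[OF that]] by simp
  qed (use f dec in \<open>auto intro: fs_measurable\<close>)
  then show ?thesis by simp
qed

lemma null_iff:
  assumes N: "N \<in> sets M"
  shows "emeasure Pstar N = 0 \<longleftrightarrow> (\<forall>P\<in>PP. emeasure P N = 0)"
proof
  assume 0: "emeasure Pstar N = 0"
  have "AE x in Pstar. x \<notin> N" using N 0 Pstar_sets by (intro AE_not_in) (auto simp: null_sets_def)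
  then have "AE x in Pstar. (indicator N x :: real) = 0" by eventually_elim simp
  then have z: "qs (\<lambda>x. (indicator N x :: real) = 0)" by (rule Pstar_inj[OF ind_CF[OF N] CF_zero])
  have "{x \<in> space M. \<not> (indicator N x :: real) = 0} = N"
    using sets.sets_into_space[OF N] by (auto simp: indicator_def)
  then show "\<forall>P\<in>PP. emeasure P N = 0" using qs_null[OF z] N by simp
qed (use Pstar_null[OF N] in blast)

definition meas :: "(('a \<Rightarrow> real) set \<Rightarrow> real) \<Rightarrow> 'a set \<Rightarrow> real" where
  "meas l A = (if A \<in> sets M then l (cl (indicator A)) else 0)"

abbreviation "dual \<equiv> norm_dual M PP C (Phi_norm PP \<phi>)"

lemma dual_representation:
  assumes l: "l \<in> dual"
  shows "meas l \<in> ca_on M PP \<phi> C" "ca_functional M C (meas l) = l"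
proof -
  obtain K where K: "\<And>f. f \<in> CF \<Longrightarrow> \<bar>l (cl f)\<bar> \<le> K * nn f"
    using l unfolding norm_dual_iff[OF C_sub] by blast
  have add: "\<And>f g. f \<in> CF \<Longrightarrow> g \<in> CF \<Longrightarrow> l (cl (\<lambda>x. f x + g x)) = l (cl f) + l (cl g)"
    and scale: "\<And>c f. f \<in> CF \<Longrightarrow> l (cl (\<lambda>x. c * f x)) = c * l (cl f)"
    using l unfolding norm_dual_iff[OF C_sub] by blast+
  interpret oc: order_continuous_functional M CF nn "\<lambda>f. l (cl f)" K
  proof
    show "f \<in> CF" if "g \<in> CF" "f \<in> borel_measurable M" "\<And>x. x \<in> space M \<Longrightarrow> \<bar>f x\<bar> \<le> \<bar>g x\<bar>" for f g
      using that by (intro CF_solid[of f g] qsI)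
    show "nn f \<le> nn g" if "g \<in> CF" "f \<in> borel_measurable M" "\<And>x. x \<in> space M \<Longrightarrow> \<bar>f x\<bar> \<le> \<bar>g x\<bar>" for f g
      using that by (intro nn_mono CF_LF qsI)
  qed (fact fs_measurable bounded_CF CF_add CF_scale order_continuous add scale K)+
  have m: "oc.\<mu> = meas l" by (simp add: fun_eq_iff meas_def oc.\<mu>_def)
  note rep = oc.representation[unfolded m] and ca = oc.\<mu>_ca[unfolded m]
  interpret signed_measure M "meas l" by unfold_locales (rule ca)
  have ca_qs: "meas l \<in> ca_qs M PP"
    unfolding ca_qs_iff
  proof (intro conjI ballI impI ca)
    fix N assume N: "N \<in> sets M" and null: "\<forall>P\<in>PP. emeasure P N = 0"
    show "total_variation M (meas l) N = 0"
    proof (rule TV_null[OF N])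
      fix A assume A: "A \<in> sets M" "A \<subseteq> N"
      have "qs (\<lambda>x. x \<notin> N)" using null by (intro null_qs N) auto
      then have "qs (\<lambda>x. \<bar>indicator A x :: real\<bar> = \<bar>0\<bar>)" by (rule qs_elim) (use A in \<open>auto simp: indicator_def\<close>)
      then have "nn (indicator A) = nn (\<lambda>_. 0)" by (rule nn_cong)
      then have "nn (indicator A) = 0" by simp
      then have "l (cl (indicator A)) = 0" using K[OF ind_CF[OF A(1)]] by simp
      then show "meas l A = 0" by (simp add: meas_def)
    qed
  qed
  show on: "meas l \<in> ca_on M PP \<phi> C"
    unfolding ca_on_iff[OF C_sub]
  proof (intro conjI ballI exI ca_qs)
    fix f assume f: "f \<in> CF"
    show "integrable V f" by (rule rep(1)[OF f])
    have "\<bar>\<integral>x. f x \<partial>V\<bar> \<le> (\<integral>x. \<bar>f x\<bar> \<partial>V)" by (rule integral_abs_bound)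
    also have "\<dots> \<le> 2 * \<bar>K\<bar> * nn f" by (rule rep(3)[OF f])
    finally show "\<bar>\<integral>x. f x \<partial>V\<bar> \<le> 2 * \<bar>K\<bar> * nn f" .
  qed
  show "ca_functional M C (meas l) = l"
  proof (rule extensionalityI[of _ C])
    show "ca_functional M C (meas l) \<in> extensional C" by (simp add: ca_functional_def)
    show "l \<in> extensional C" using l unfolding norm_dual_iff[OF C_sub] by blast
    fix X assume "X \<in> C"
    then obtain f where f: "f \<in> CF" "X = cl f" by (rule fs_obtain[OF C_LP])
    show "ca_functional M C (meas l) X = l X"
      using ca_functional_in_dual(2)[OF C_sub C_abs on f(1)] rep(2)[OF f(1)] f(2) by (simp add: jint_def)
  qed
qed

lemma dual_eq: "dual = ca_functional M C ` ca_on M PP \<phi> C"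
  using dual_representation ca_functional_in_dual(1)[OF C_sub C_abs] by (metis imageI image_subsetI subset_antisym subsetI)

lemma meas_ca_functional:
  assumes \<mu>: "\<mu> \<in> ca_on M PP \<phi> C"
  shows "meas (ca_functional M C \<mu>) = \<mu>"
proof -
  interpret signed_measure M \<mu>
    using \<mu> by unfold_locales (simp add: ca_on_def ca_qs_def)
  show ?thesis
  proof
    fix A
    show "meas (ca_functional M C \<mu>) A = \<mu> A"
      using ca_functional_in_dual(2)[OF C_sub C_abs \<mu> ind_CF, of A] integral_indicator_parts[of A] outside[of A]
      by (simp add: meas_def jint_def)
  qed
qed

lemma ca_on_C_eq: "ca_on M PP \<phi> C = ca_on M PP \<phi> LP"
proof (intro subset_antisym subsetI)
  fix \<mu> assume "\<mu> \<in> ca_on M PP \<phi> LP"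
  then show "\<mu> \<in> ca_on M PP \<phi> C"
    unfolding ca_on_iff[OF C_sub] ca_on_iff[OF LP_sub] fs_LP using CF_LF by blast
next
  fix \<mu> assume \<mu>: "\<mu> \<in> ca_on M PP \<phi> C"
  then have \<mu>qs: "\<mu> \<in> ca_qs M PP" and int: "\<And>f. f \<in> CF \<Longrightarrow> integrable (variation_measure M \<mu>) f"
    and "\<exists>K. \<forall>f\<in>CF. \<bar>\<integral>x. f x \<partial>variation_measure M \<mu>\<bar> \<le> K * nn f"
    unfolding ca_on_iff[OF C_sub] by blast+
  then obtain K where K: "\<And>f. f \<in> CF \<Longrightarrow> \<bar>\<integral>x. f x \<partial>variation_measure M \<mu>\<bar> \<le> K * nn f" by blast
  interpret signed_measure M \<mu> using \<mu>qs by unfold_locales (simp add: ca_qs_iff)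
  have bd: "(\<integral>\<^sup>+x. ennreal \<bar>f x\<bar> \<partial>V) \<le> ennreal (\<bar>K\<bar> * nn f)" if f: "f \<in> LF" for f
  proof -
    have [measurable]: "f \<in> borel_measurable M" by (rule LF_measurable[OF f])
    define h where "h n x = min \<bar>f x\<bar> (real n)" for n x
    have hC: "h n \<in> CF" for n
      by (rule bounded_CF[where c = "real n"]) (auto simp: h_def[abs_def])
    have "(\<integral>\<^sup>+x. ennreal \<bar>f x\<bar> \<partial>V) = (\<integral>\<^sup>+x. liminf (\<lambda>n. ennreal (h n x)) \<partial>V)"
    proof (rule nn_integral_cong)
      fix x
      obtain n0 where n0: "\<bar>f x\<bar> < real n0" using reals_Archimedean2 by blast
      have "\<forall>\<^sub>F n in sequentially. ennreal (h n x) = ennreal \<bar>f x\<bar>"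
        using eventually_ge_at_top[of n0] by eventually_elim (use n0 in \<open>auto simp: h_def\<close>)
      then have "(\<lambda>n. ennreal (h n x)) \<longlonglongrightarrow> ennreal \<bar>f x\<bar>" by (rule tendsto_eventually)
      then show "ennreal \<bar>f x\<bar> = liminf (\<lambda>n. ennreal (h n x))"
        by (simp add: lim_imp_Liminf)
    qed
    also have "\<dots> \<le> liminf (\<lambda>n. \<integral>\<^sup>+x. ennreal (h n x) \<partial>V)"
      by (rule nn_integral_liminf) (simp add: h_def[abs_def])
    also have "\<dots> \<le> limsup (\<lambda>n. \<integral>\<^sup>+x. ennreal (h n x) \<partial>V)" by (rule Liminf_le_Limsup) simp
    also have "\<dots> \<le> ennreal (\<bar>K\<bar> * nn f)"
    proof (rule Limsup_bounded, rule always_eventually, rule allI)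
      fix n
      have "(\<integral>\<^sup>+x. ennreal (h n x) \<partial>V) = ennreal (\<integral>x. h n x \<partial>V)"
        by (rule nn_integral_eq_integral[OF int[OF hC]]) (simp add: h_def)
      also have "\<dots> \<le> ennreal (\<bar>K\<bar> * nn f)"
      proof (rule ennreal_leI)
        have "nn (h n) \<le> nn f" using f by (rule nn_mono) (auto intro: qsI simp: h_def)
        then have "\<bar>K\<bar> * nn (h n) \<le> \<bar>K\<bar> * nn f" by (rule mult_left_mono) simp
        moreover have "K * nn (h n) \<le> \<bar>K\<bar> * nn (h n)" by (rule mult_right_mono) auto
        ultimately show "(\<integral>x. h n x \<partial>V) \<le> \<bar>K\<bar> * nn f" using K[OF hC, of n] by linarith
      qed
      finally show "(\<integral>\<^sup>+x. ennreal (h n x) \<partial>V) \<le> ennreal (\<bar>K\<bar> * nn f)" .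
    qed
    finally show ?thesis .
  qed
  show "\<mu> \<in> ca_on M PP \<phi> LP"
    unfolding ca_on_iff[OF LP_sub] fs_LP
  proof (intro conjI ballI exI \<mu>qs)
    fix f assume f: "f \<in> LF"
    have fm: "f \<in> borel_measurable V" using LF_measurable[OF f] by (simp add: measurable_V)
    have "(\<integral>\<^sup>+x. ennreal (norm (f x)) \<partial>V) < \<infinity>"
      using le_less_trans[OF bd[OF f] ennreal_less_top] by simp
    with fm show i: "integrable V f" by (rule integrableI_bounded)
    have "ennreal (\<integral>x. \<bar>f x\<bar> \<partial>V) = (\<integral>\<^sup>+x. ennreal \<bar>f x\<bar> \<partial>V)"
      using i by (intro nn_integral_eq_integral[symmetric]) auto
    then have "ennreal (\<integral>x. \<bar>f x\<bar> \<partial>V) \<le> ennreal (\<bar>K\<bar> * nn f)"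
      using bd[OF f] by metis
    then have "(\<integral>x. \<bar>f x\<bar> \<partial>V) \<le> \<bar>K\<bar> * nn f"
      by (subst (asm) ennreal_le_iff) auto
    moreover have "\<bar>\<integral>x. f x \<partial>V\<bar> \<le> (\<integral>x. \<bar>f x\<bar> \<partial>V)" by (rule integral_abs_bound)
    ultimately show "\<bar>\<integral>x. f x \<partial>V\<bar> \<le> \<bar>K\<bar> * nn f" by linarith
  qed
qed

lemma Pstar_ca_C: "measure Pstar \<in> ca_on M PP \<phi> C"
  using Pstar_ca_on ca_on_C_eq by simp

lemma ca_C_null:
  "\<mu> \<in> ca_on M PP \<phi> C \<Longrightarrow> N \<in> sets M \<Longrightarrow> emeasure Pstar N = 0 \<Longrightarrow> total_variation M \<mu> N = 0"
  using null_iff[of N] by (auto simp: ca_on_def ca_qs_iff)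

lemma ca_C_equiv: "equiv_meas M (ca_on M PP \<phi> C) {measure Pstar}"
  unfolding equiv_meas_def abs_cont_def SUP_eq_0_iff
  using Pstar_ca_C ca_C_null total_variation_measure[OF Pstar.finite_measure_axioms Pstar_sets] by auto

lemma PP_equiv: "equiv_meas M (measure ` PP) {measure Pstar}"
proof -
  have "total_variation M (measure P) N = emeasure P N" if "P \<in> PP" "N \<in> sets M" for P N
    using that prob_PP[OF that(1)] sets_PP[OF that(1)]
    by (intro total_variation_measure) (auto simp: prob_space_def)
  then show ?thesis
    unfolding equiv_meas_def abs_cont_def SUP_eq_0_iff
    using null_iff total_variation_measure[OF Pstar.finite_measure_axioms Pstar_sets] by auto
qed

end

context complete_closure
begin

abbreviation "dball \<equiv> {l \<in> dual. \<forall>f\<in>CF. \<bar>l (cl f)\<bar> \<le> nn f}"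

lemma ca_ball_eq: "ca_ball M PP \<phi> C = meas ` dball"
proof (intro subset_antisym subsetI)
  fix \<mu> assume "\<mu> \<in> ca_ball M PP \<phi> C"
  then have \<mu>: "\<mu> \<in> ca_on M PP \<phi> C" and n: "dual_norm C (Phi_norm PP \<phi>) (ca_functional M C \<mu>) \<le> 1"
    by (auto simp: ca_ball_def)
  have d: "ca_functional M C \<mu> \<in> dual" by (rule ca_functional_in_dual(1)[OF C_sub C_abs \<mu>])
  then have "ca_functional M C \<mu> \<in> dball" using n dual_norm_le_1[OF C_sub d] by simp
  then show "\<mu> \<in> meas ` dball" 
    by (rule image_eqI[rotated]) (rule meas_ca_functional[OF \<mu>, symmetric])
next
  fix \<mu> assume "\<mu> \<in> meas ` dball"
  then obtain l where l: "l \<in> dual" "\<forall>f\<in>CF. \<bar>l (cl f)\<bar> \<le> nn f" "\<mu> = meas l" by blast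
  then show "\<mu> \<in> ca_ball M PP \<phi> C"
    using dual_representation[OF l(1)] dual_norm_le_1[OF C_sub l(1)] by (simp add: ca_ball_def)
qed

text \<open>Banach-Alaoglu, by Tychonoff's theorem.\<close>

lemma dball_compact: "compactin (product_topology (\<lambda>_. euclideanreal) C) dball"
proof -
  let ?T = "product_topology (\<lambda>_. euclideanreal) C"
  define b where "b X = nn (rep X)" for X
  define Z where "Z = (\<lambda>(f, g, c). {l \<in> topspace ?T. l (cl (\<lambda>x. f x + c * g x)) - l (cl f) - c * l (cl g) \<in> {0::real}})"
  have lin_C: "cl (\<lambda>x. f x + c * g x) \<in> C" if "f \<in> CF" "g \<in> CF" for f g c
    by (intro cl_in CF_add CF_scale that)
  have closed: "closedin ?T (\<Inter>i\<in>CF \<times> CF \<times> UNIV. Z i)"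
  proof (rule closedin_INT)
    show "CF \<times> CF \<times> (UNIV :: real set) \<noteq> {}" using CF_zero by auto
    fix i :: "('a \<Rightarrow> real) \<times> ('a \<Rightarrow> real) \<times> real" assume "i \<in> CF \<times> CF \<times> UNIV"
    then obtain f g c where i: "i = (f, g, c)" "f \<in> CF" "g \<in> CF" by auto
    have pr: "continuous_map ?T euclideanreal (\<lambda>l. l X)" if "X \<in> C" for X
      using continuous_map_product_projection[OF that, of "\<lambda>_. euclideanreal"] by simp
    have "continuous_map ?T euclideanreal (\<lambda>l. l (cl (\<lambda>x. f x + c * g x)) - l (cl f) - c * l (cl g))"
      by (intro continuous_map_diff continuous_map_real_mult_left pr lin_C cl_in i)
    then show "closedin ?T (Z i)"
      unfolding Z_def i(1) prod.case by (rule closedin_continuous_map_preimage) simp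
  qed
  have box: "compactin ?T (PiE C (\<lambda>X. {- b X..b X}))"
    unfolding compactin_PiE by (auto simp: compactin_euclidean_iff)
  have bf: "b (cl f) = nn f" if f: "f \<in> CF" for f
    unfolding b_def by (rule nn_cong, rule qs_elim[OF rep_qs_eq[OF fs_measurable[OF f]]]) simp
  have "dball = (\<Inter>i\<in>CF \<times> CF \<times> UNIV. Z i) \<inter> PiE C (\<lambda>X. {- b X..b X})"
  proof (intro subset_antisym subsetI)
    fix l assume "l \<in> dball"
    then have l: "l \<in> extensional C"
      "\<And>f g. f \<in> CF \<Longrightarrow> g \<in> CF \<Longrightarrow> l (cl (\<lambda>x. f x + g x)) = l (cl f) + l (cl g)"
      "\<And>c f. f \<in> CF \<Longrightarrow> l (cl (\<lambda>x. c * f x)) = c * l (cl f)"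
      "\<And>f. f \<in> CF \<Longrightarrow> \<bar>l (cl f)\<bar> \<le> nn f"
      unfolding norm_dual_iff[OF C_sub] by blast+
    have "l X \<in> {- b X..b X}" if X: "X \<in> C" for X
    proof -
      obtain f where f: "f \<in> CF" "X = cl f" using X by (rule fs_obtain[OF C_LP])
      show ?thesis using l(4)[OF f(1)] bf[OF f(1)] f(2) by auto
    qed
    moreover have "l \<in> Z i" if "i \<in> CF \<times> CF \<times> UNIV" for i
      using that l(1) l(2)[OF _ CF_scale] l(3) by (auto simp: Z_def PiE_def)
    ultimately show "l \<in> (\<Inter>i\<in>CF \<times> CF \<times> UNIV. Z i) \<inter> PiE C (\<lambda>X. {- b X..b X})"
      using l(1) by (auto simp: PiE_def)
  next
    fix l assume L: "l \<in> (\<Inter>i\<in>CF \<times> CF \<times> UNIV. Z i) \<inter> PiE C (\<lambda>X. {- b X..b X})"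
    have lin: "l (cl (\<lambda>x. f x + c * g x)) = l (cl f) + c * l (cl g)" if "f \<in> CF" "g \<in> CF" for f g c
    proof -
      have "l \<in> Z (f, g, c)" using L that by blast
      then show ?thesis by (simp add: Z_def)
    qed
    have 0: "l (cl (\<lambda>_. 0)) = 0" using lin[OF CF_zero CF_zero, of 1] by simp
    have bd: "\<bar>l (cl f)\<bar> \<le> nn f" if f: "f \<in> CF" for f
      using L cl_in[OF f] bf[OF f] by (auto simp: PiE_def Pi_def abs_le_iff)
    have "l \<in> dual"
      unfolding norm_dual_iff[OF C_sub]
    proof (intro conjI ballI allI exI)
      show "l \<in> extensional C" using L by (simp add: PiE_def)
      fix f assume f: "f \<in> CF"
      show "\<bar>l (cl f)\<bar> \<le> 1 * nn f" using bd[OF f] by simp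
      show "l (cl (\<lambda>x. c * f x)) = c * l (cl f)" for c using lin[OF CF_zero f, of c] 0 by simp
      show "l (cl (\<lambda>x. f x + g x)) = l (cl f) + l (cl g)" if "g \<in> CF" for g
        using lin[OF f that, of 1] by simp
    qed
    with bd show "l \<in> dball" by simp
  qed
  then show ?thesis using closed_Int_compactin[OF closed box] by simp
qed

lemma RN_meas:
  assumes l: "l \<in> dual"
  obtains h where "h \<in> RN_class M Pstar (meas l)"
    "\<And>f. f \<in> CF \<Longrightarrow> l (cl f) = (\<integral>x. f x * h x \<partial>Pstar)"
proof -
  note on = dual_representation(1)[OF l]
  then have ca: "meas l \<in> ca M" by (simp add: ca_on_def ca_qs_def)
  note RN = signed_integral_RN[OF ca Pstar.finite_measure_axioms Pstar_sets]
  obtain h where h: "h \<in> RN_class M Pstar (meas l)" using RN(1) ca_C_null[OF on] by blast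
  show thesis
  proof (rule that[OF h])
    fix f assume f: "f \<in> CF"
    have "integrable (variation_measure M (meas l)) f" using on f unfolding ca_on_iff[OF C_sub] by blast
    then have "jint (meas l) f = (\<integral>x. f x * h x \<partial>Pstar)"
      unfolding jint_def using RN(2)[OF _ h fs_measurable[OF f]] ca_C_null[OF on] by blast
    then show "l (cl f) = (\<integral>x. f x * h x \<partial>Pstar)"
      using ca_functional_in_dual(2)[OF C_sub C_abs on f] dual_representation(2)[OF l] by simp
  qed
qed

lemma ca_ball_weakly_compact: "weakly_compact_L1 M Pstar (RN_class M Pstar ` ca_ball M PP \<phi> C)"
proof -
  let ?T = "product_topology (\<lambda>_. euclideanreal) C"
  let ?W = "weak_topology M {Pstar} (L1 M Pstar) (L1_norm Pstar)"
  let ?D = "norm_dual M {Pstar} (L1 M Pstar) (L1_norm Pstar)"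
  let ?\<Theta> = "\<lambda>l. RN_class M Pstar (meas l)"
  have top: "topspace (subtopology ?T dball) = dball"
    using compactin_subset_topspace[OF dball_compact] by auto
  have \<Theta>_L1: "?\<Theta> l \<in> L1 M Pstar" if l: "l \<in> dual" for l
  proof -
    obtain h where "h \<in> RN_class M Pstar (meas l)" using RN_meas[OF l] by blast
    then show ?thesis by (rule RN_class_L1[OF Pstar_prob Pstar_sets])
  qed
  have "continuous_map (subtopology ?T dball) ?W ?\<Theta>"
    unfolding weak_topology_def
  proof (rule continuous_on_generated_topo)
    fix W assume "W \<in> {{X \<in> L1 M Pstar. k X \<in> U} | k U. k \<in> ?D \<and> open U}"
    then obtain k U where k: "k \<in> ?D" "open U" and W: "W = {X \<in> L1 M Pstar. k X \<in> U}" by blast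
    obtain g c where g: "g \<in> borel_measurable M" "\<And>x. \<bar>g x\<bar> \<le> c"
      "\<And>f. f \<in> borel_measurable M \<Longrightarrow> integrable Pstar f \<Longrightarrow> k (qs_class M {Pstar} f) = (\<integral>x. g x * f x \<partial>Pstar)"
      using L1_dual_obtains[OF Pstar_prob Pstar_sets k(1)] by metis
    have gC: "g \<in> CF" using g(1,2) by (rule bounded_CF)
    have eq: "k (?\<Theta> l) = l (cl g)" if l: "l \<in> dual" for l
    proof -
      obtain h where h: "h \<in> RN_class M Pstar (meas l)" "l (cl g) = (\<integral>x. g x * h x \<partial>Pstar)"
        using RN_meas[OF l] gC by metis
      have "h \<in> borel_measurable M" "integrable Pstar h" using h(1) by (auto simp: RN_class_def)
      then show ?thesis using g(3) h RN_class_eq[OF Pstar_sets h(1)] by simp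
    qed
    have "?\<Theta> -` W \<inter> topspace (subtopology ?T dball) = {l \<in> topspace ?T. l (cl g) \<in> U} \<inter> dball"
      unfolding top using eq \<Theta>_L1 compactin_subset_topspace[OF dball_compact] by (auto simp: W)
    moreover have "openin ?T {l \<in> topspace ?T. l (cl g) \<in> U}"
      using openin_continuous_map_preimage[OF continuous_map_product_projection[OF cl_in[OF gC], of "\<lambda>_. euclideanreal"], of U] k(2)
      by simp
    ultimately show "openin (subtopology ?T dball) (?\<Theta> -` W \<inter> topspace (subtopology ?T dball))"
      by (auto simp: openin_subtopology)
  next
    obtain k where "k \<in> ?D" by (rule bounded_in_L1_dual[OF Pstar_prob Pstar_sets, of "\<lambda>_. 0" 0]) auto
    then have "L1 M Pstar \<in> {{X \<in> L1 M Pstar. k X \<in> U} | k U. k \<in> ?D \<and> open U}"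
      by (intro CollectI exI[of _ k] exI[of _ UNIV]) auto
    then show "?\<Theta> ` topspace (subtopology ?T dball) \<subseteq> \<Union> {{X \<in> L1 M Pstar. k X \<in> U} | k U. k \<in> ?D \<and> open U}"
      unfolding top using \<Theta>_L1 by blast
  qed
  moreover have "compactin (subtopology ?T dball) dball"
    using dball_compact by (simp add: compactin_subtopology)
  ultimately have "compactin ?W (?\<Theta> ` dball)" by (rule image_compactin[rotated])
  then show ?thesis
    unfolding weakly_compact_L1_def ca_ball_eq image_image .
qed

lemma densities_uniformly_integrable:
  assumes x0: "0 < x0" and inf: "0 < (INF P\<in>PP. \<phi> P x0)"
  shows "uniformly_integrable M Pstar ((\<lambda>P. RN_class M Pstar (measure P)) ` PP)"
proof -
  obtain c where c: "0 < c" "ennreal c \<le> (INF P\<in>PP. \<phi> P x0)"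
    using inf by (cases "INF P\<in>PP. \<phi> P x0") (auto intro: that[of 1])
  have c\<phi>: "ennreal c \<le> \<phi> P x0" if "P \<in> PP" for P
    using c(2) that by (auto simp: le_INF_iff)
  define \<kappa> where "\<kappa> = x0 + x0 / c"
  have \<kappa>: "0 < \<kappa>" using x0 c by (simp add: \<kappa>_def add_pos_pos)
  have lin: "ennreal x \<le> ennreal x0 + ennreal (x0 / c) * \<phi> P x" if P: "P \<in> PP" and x: "0 \<le> x" for P x
  proof (cases "x \<le> x0")
    case True
    then show ?thesis by (intro add_increasing2) (auto intro: ennreal_leI)
  next
    case False
    then have x: "0 < x" using x0 by simp
    have "ennreal c \<le> \<phi> P (x0 / x * x)" using c\<phi>[OF P] x by simp
    also have "\<dots> \<le> ennreal (x0 / x) * \<phi> P x" using P x x0 False by (intro phi_scale) auto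
    finally have "ennreal (x / c) * ennreal c \<le> ennreal (x / c) * (ennreal (x0 / x) * \<phi> P x)"
      by (rule mult_left_mono) simp
    moreover have "ennreal (x / c) * ennreal c = ennreal x"
      using c x by (simp flip: ennreal_mult')
    moreover have "ennreal (x / c) * (ennreal (x0 / x) * \<phi> P x) = ennreal (x0 / c) * \<phi> P x"
      using c x x0 by (simp flip: mult.assoc ennreal_mult')
    ultimately show ?thesis by (simp add: add_increasing)
  qed
  have PA: "measure P A \<le> \<kappa> * nn (indicator A)" if P: "P \<in> PP" and A: "A \<in> sets M" for P A
  proof -
    interpret P: prob_space P by (rule prob_PP[OF P])
    have AP: "A \<in> sets P" using A sets_PP[OF P] by simp
    have "measure P A / \<kappa> \<le> r" if r: "nn (indicator A) < r" for r
    proof -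
      have adm: "adm (indicator A) r" by (rule nn_adm[OF CF_LF[OF ind_CF[OF A]] r])
      then have r0: "0 < r" by (simp add: adm_def)
      have m: "(\<lambda>x. \<phi> P (\<bar>indicator A x\<bar> / r)) \<in> borel_measurable P"
        using P A r0 by (intro phi_measurable) auto
      have "ennreal (1 / r) * emeasure P A = (\<integral>\<^sup>+x. ennreal (1 / r) * indicator A x \<partial>P)"
        using AP by (simp add: nn_integral_cmult_indicator)
      also have "\<dots> = (\<integral>\<^sup>+x. ennreal (\<bar>indicator A x\<bar> / r) \<partial>P)"
        by (intro nn_integral_cong) (auto split: split_indicator)
      also have "\<dots> \<le> (\<integral>\<^sup>+x. ennreal x0 + ennreal (x0 / c) * \<phi> P (\<bar>indicator A x\<bar> / r) \<partial>P)"
        using P r0 by (intro nn_integral_mono lin) auto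
      also have "\<dots> = ennreal x0 + ennreal (x0 / c) * (\<integral>\<^sup>+x. \<phi> P (\<bar>indicator A x\<bar> / r) \<partial>P)"
        using m by (simp add: nn_integral_add nn_integral_cmult P.emeasure_space_1)
      also have "\<dots> \<le> ennreal x0 + ennreal (x0 / c) * 1"
        using adm P by (intro add_left_mono mult_left_mono) (auto simp: adm_def)
      also have "\<dots> = ennreal \<kappa>" using x0 c by (simp add: \<kappa>_def)
      finally have "ennreal (1 / r) * ennreal (measure P A) \<le> ennreal \<kappa>"
        unfolding P.emeasure_eq_measure .
      moreover have "ennreal (1 / r) * ennreal (measure P A) = ennreal (1 / r * measure P A)"
        using r0 by (intro ennreal_mult[symmetric]) auto
      ultimately have "ennreal (1 / r * measure P A) \<le> ennreal \<kappa>" by metis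
      then have "1 / r * measure P A \<le> \<kappa>" using \<kappa> by (subst (asm) ennreal_le_iff) auto
      then show ?thesis using r0 \<kappa> by (simp add: field_simps)
    qed
    then have "measure P A / \<kappa> \<le> nn (indicator A)" by (rule dense_ge)
    then show ?thesis using \<kappa> by (simp add: field_simps)
  qed
  define \<rho> where "\<rho> P = rep (RN_class M Pstar (measure P))" for P
  have RN: "\<rho> P \<in> RN_class M Pstar (measure P)" if P: "P \<in> PP" for P
  proof -
    have fin: "finite_measure P" using prob_PP[OF P] by (simp add: prob_space_def)
    have "\<exists>h. h \<in> RN_class M Pstar (measure P)"
    proof (rule signed_integral_RN(1)[OF measure_in_ca[OF fin sets_PP[OF P]] Pstar.finite_measure_axioms Pstar_sets])
      fix N assume "N \<in> sets M" "emeasure Pstar N = 0"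
      then show "total_variation M (measure P) N = 0"
        using P null_iff total_variation_measure[OF fin sets_PP[OF P]] by simp
    qed
    then show ?thesis unfolding \<rho>_def rep_def by (rule someI_ex)
  qed
  have \<rho>m: "\<rho> P \<in> borel_measurable M" and \<rho>i: "integrable Pstar (\<rho> P)"
    and \<rho>P: "\<And>A. A \<in> sets M \<Longrightarrow> measure P A = (LINT x:A|Pstar. \<rho> P x)" if "P \<in> PP" for P
    using RN[OF that] by (auto simp: RN_class_def)
  have \<rho>0: "AE x in Pstar. 0 \<le> \<rho> P x" if P: "P \<in> PP" for P
  proof -
    have "AE x in Pstar. - \<rho> P x \<le> 0"
    proof (rule AE_le_const_if_set_integrals_le[OF Pstar.finite_measure_axioms])
      show "integrable Pstar (\<lambda>x. - \<rho> P x)" using \<rho>i[OF P] by simp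
      fix A assume "A \<in> sets Pstar"
      then have "A \<in> sets M" using Pstar_sets by blast
      then have "0 \<le> (LINT x:A|Pstar. \<rho> P x)" using \<rho>P[OF P, of A] by (metis measure_nonneg)
      then show "(LINT x:A|Pstar. - \<rho> P x) \<le> 0 * measure Pstar A" by (simp add: set_lebesgue_integral_def)
    qed
    then show ?thesis by eventually_elim simp
  qed
  define E where "E P t = {x \<in> space M. t < \<bar>\<rho> P x\<bar>}" for P t
  have E [measurable]: "E P t \<in> sets M" if "P \<in> PP" for P t
    using \<rho>m[OF that] unfolding E_def by measurable
  have tail: "(\<integral>\<^sup>+x. ennreal (\<bar>\<rho> P x\<bar> * indicat_real {t<..} \<bar>\<rho> P x\<bar>) \<partial>Pstar) = ennreal (measure P (E P t))"
    if P: "P \<in> PP" for P t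
  proof -
    have i: "integrable Pstar (\<lambda>x. indicator (E P t) x * \<rho> P x)"
      using integrable_real_mult_indicator[OF _ \<rho>i[OF P], of "E P t"] E[OF P] Pstar_sets by (simp add: mult.commute)
    have "(\<integral>\<^sup>+x. ennreal (\<bar>\<rho> P x\<bar> * indicat_real {t<..} \<bar>\<rho> P x\<bar>) \<partial>Pstar) = (\<integral>\<^sup>+x. ennreal (indicator (E P t) x * \<rho> P x) \<partial>Pstar)"
    proof (rule nn_integral_cong_AE, use \<rho>0[OF P] in \<open>rule AE_mp\<close>, intro AE_I2 impI)
      fix x assume "x \<in> space Pstar" "0 \<le> \<rho> P x"
      then show "ennreal (\<bar>\<rho> P x\<bar> * indicat_real {t<..} \<bar>\<rho> P x\<bar>) = ennreal (indicator (E P t) x * \<rho> P x)"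
        by (auto simp: E_def space_Q[OF Pstar_prob Pstar_sets] split: split_indicator)
    qed
    also have "\<dots> = ennreal (\<integral>x. indicator (E P t) x * \<rho> P x \<partial>Pstar)"
      by (rule nn_integral_eq_integral[OF i]) (use \<rho>0[OF P] in \<open>auto split: split_indicator\<close>)
    also have "(\<integral>x. indicator (E P t) x * \<rho> P x \<partial>Pstar) = measure P (E P t)"
      using \<rho>P[OF P E[OF P]] by (simp add: set_lebesgue_integral_def)
    finally show ?thesis .
  qed
  have Markov: "t * measure Pstar (E P t) \<le> 1" if P: "P \<in> PP" and t: "0 \<le> t" for P t
  proof -
    interpret P: prob_space P by (rule prob_PP[OF P])
    have ES: "E P t \<in> sets Pstar" using E[OF P] Pstar_sets by simp
    have i: "integrable Pstar (\<lambda>x. indicator (E P t) x * \<rho> P x)"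
      using integrable_real_mult_indicator[OF ES \<rho>i[OF P]] by (simp add: mult.commute)
    have "t * measure Pstar (E P t) = (\<integral>x. t * indicator (E P t) x \<partial>Pstar)"
      using sets.sets_into_space[OF ES] by (simp add: Int_absorb2)
    also have "\<dots> \<le> (\<integral>x. indicator (E P t) x * \<rho> P x \<partial>Pstar)"
    proof (rule integral_mono_AE[OF _ i])
      show "integrable Pstar (\<lambda>x. t * indicator (E P t) x)"
        using ES by (simp add: Pstar.emeasure_finite less_top[symmetric])
      show "AE x in Pstar. t * indicator (E P t) x \<le> indicator (E P t) x * \<rho> P x"
        using \<rho>0[OF P] by eventually_elim (auto simp: E_def split: split_indicator)
    qed
    also have "\<dots> = measure P (E P t)"
      using \<rho>P[OF P E[OF P]] by (simp add: set_lebesgue_integral_def)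
    also have "\<dots> \<le> 1" by simp
    finally show ?thesis .
  qed
  have key: "\<exists>n. \<forall>P\<in>PP. measure P (E P (2 ^ n)) < e" if e: "0 < e" for e :: real
  proof (rule ccontr)
    assume "\<nexists>n. \<forall>P\<in>PP. measure P (E P (2 ^ n)) < e"
    then have "\<forall>n. \<exists>P\<in>PP. e \<le> measure P (E P (2 ^ n))" by (auto simp: not_less)
    then obtain p where p: "\<And>n. p n \<in> PP" "\<And>n. e \<le> measure (p n) (E (p n) (2 ^ n))" by metis
    define A where "A n = E (p n) (2 ^ n)" for n
    have A [measurable]: "A n \<in> sets M" for n unfolding A_def by (rule E[OF p(1)])
    have QA: "measure Pstar (A n) \<le> (1 / 2) ^ n" for n
      using Markov[OF p(1)[of n], of "2 ^ n"] by (simp add: A_def field_simps power_one_over)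
    have "summable (\<lambda>n. measure Pstar (A n))"
      by (rule summable_comparison_test'[OF summable_geometric[of "1 / 2 :: real"], of 0]) (use QA in auto)
    then have "AE x in Pstar. eventually (\<lambda>n. x \<in> space Pstar - A n) sequentially"
      using Pstar_sets by (intro borel_cantelli_AE1) (auto simp: Pstar.emeasure_finite less_top[symmetric])
    then have ae: "AE x in Pstar. \<not> (\<forall>n. \<exists>k\<ge>n. x \<in> A k)"
      by (rule AE_mp) (auto intro!: AE_I2 simp: eventually_sequentially)
    define N where "N = {x \<in> space M. \<forall>n. \<exists>k\<ge>n. x \<in> A k}"
    have N [measurable]: "N \<in> sets M" unfolding N_def by measurable
    have "emeasure Pstar N = 0"
      using ae AE_iff_measurable[of N Pstar "\<lambda>x. \<not> (\<forall>n. \<exists>k\<ge>n. x \<in> A k)"] N Pstar_sets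
      by (simp add: N_def space_Q[OF Pstar_prob Pstar_sets])
    then have Nnull: "emeasure P N = 0" if "P \<in> PP" for P using null_iff[OF N] that by blast
    define B where "B n = (\<Union>k\<in>{n..}. A k) - N" for n
    have B [measurable]: "B n \<in> sets M" for n unfolding B_def by measurable
    have "(\<lambda>n. nn (indicator (B n))) \<longlonglongrightarrow> 0"
    proof (rule order_continuous[OF ind_CF[OF B]])
      show "0 \<le> (indicator (B n) x :: real) \<and> (indicator (B (Suc n)) x :: real) \<le> indicator (B n) x" for x n
        by (auto simp: B_def split: split_indicator intro: Suc_leD)
      fix x assume x: "x \<in> space M"
      have "\<exists>n. \<forall>k\<ge>n. x \<notin> B k"
      proof (cases "x \<in> N")
        case False
        then obtain n where "\<forall>k\<ge>n. x \<notin> A k" using x by (auto simp: N_def)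
        then have "\<forall>k\<ge>n. x \<notin> B k" by (auto simp: B_def)
        then show ?thesis by blast
      qed (auto simp: B_def)
      then have "\<forall>\<^sub>F n in sequentially. (indicator (B n) x :: real) = 0"
        by (auto simp: eventually_sequentially indicator_def)
      then show "(\<lambda>n. indicator (B n) x :: real) \<longlonglongrightarrow> 0" by (rule tendsto_eventually)
    qed
    then have lim: "(\<lambda>n. \<kappa> * nn (indicator (B n))) \<longlonglongrightarrow> 0" by (rule tendsto_mult_right_zero)
    have "e \<le> \<kappa> * nn (indicator (B n))" for n
    proof -
      interpret P: prob_space "p n" by (rule prob_PP[OF p(1)])
      have s: "A n \<in> sets (p n)" "B n \<in> sets (p n)" "N \<in> sets (p n)" using A B N sets_PP[OF p(1)] by auto
      have "measure (p n) (A n) \<le> measure (p n) (B n \<union> N)"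
      proof (rule P.finite_measure_mono)
        show "B n \<union> N \<in> sets (p n)" using s by (intro sets.Un)
      qed (auto simp: B_def)
      also have "\<dots> \<le> measure (p n) (B n) + measure (p n) N"
        using s by (intro measure_Un_le)
      also have "measure (p n) N = 0" using Nnull[OF p(1)] by (simp add: measure_def)
      finally show ?thesis using p(2)[of n] PA[OF p(1) B, of n n] by (simp add: A_def)
    qed
    then have "e \<le> 0" using lim by (intro LIMSEQ_le_const[OF lim]) auto
    with e show False by simp
  qed
  show ?thesis
    unfolding uniformly_integrable_def
  proof (intro conjI)
    show "(\<lambda>P. RN_class M Pstar (measure P)) ` PP \<subseteq> L1 M Pstar"
      using RN RN_class_L1[OF Pstar_prob Pstar_sets] by blast
    have G: "(SUP X\<in>(\<lambda>P. RN_class M Pstar (measure P)) ` PP. \<integral>\<^sup>+x. ennreal (\<bar>rep X x\<bar> * indicat_real {t<..} \<bar>rep X x\<bar>) \<partial>Pstar)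
        = (SUP P\<in>PP. ennreal (measure P (E P t)))" for t
      unfolding image_image SUP_image comp_def using tail by (intro SUP_cong refl) (simp add: \<rho>_def)
    show "((\<lambda>t. SUP X\<in>(\<lambda>P. RN_class M Pstar (measure P)) ` PP.
        \<integral>\<^sup>+x. ennreal (\<bar>rep X x\<bar> * indicat_real {t<..} \<bar>rep X x\<bar>) \<partial>Pstar) \<longlongrightarrow> 0) at_top"
      unfolding G
    proof (rule order_tendstoI)
      fix a :: ennreal assume "0 < a"
      then obtain e where e: "0 < e" "ennreal e < a"
        by (metis dense ennreal_cases ennreal_less_zero_iff less_top linorder_not_less order.strict_trans top_greatest)
      obtain n where n: "\<And>P. P \<in> PP \<Longrightarrow> measure P (E P (2 ^ n)) < e" using key[OF e(1)] by blast
      show "\<forall>\<^sub>F t in at_top. (SUP P\<in>PP. ennreal (measure P (E P t))) < a"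
        using eventually_ge_at_top[of "2 ^ n"]
      proof eventually_elim
        case (elim t)
        have "(SUP P\<in>PP. ennreal (measure P (E P t))) \<le> ennreal e"
        proof (rule SUP_least)
          fix P assume P: "P \<in> PP"
          interpret P: prob_space P by (rule prob_PP[OF P])
          have "measure P (E P t) \<le> measure P (E P (2 ^ n))"
            using E[OF P] sets_PP[OF P] elim by (intro P.finite_measure_mono) (auto simp: E_def)
          then show "ennreal (measure P (E P t)) \<le> ennreal e" using n[OF P] by (intro ennreal_leI) simp
        qed
        with e(2) show ?case by simp
      qed
    qed simp
  qed
qed

end

context separable_closure
begin

context
  assumes dual: "norm_dual M PP C (Phi_norm PP \<phi>) = ca_functional M C ` ca_on M PP \<phi> C"
    and equiv: "equiv_meas M (ca_on M PP \<phi> C) {measure Pstar}"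
    and compact: "weakly_compact_L1 M Pstar (RN_class M Pstar ` ca_ball M PP \<phi> C)"
begin

lemma represent:
  assumes add: "\<And>f g. f \<in> CF \<Longrightarrow> g \<in> CF \<Longrightarrow> l (\<lambda>x. f x + g x) = l f + l g"
    and scale: "\<And>c f. f \<in> CF \<Longrightarrow> l (\<lambda>x. c * f x) = c * l f"
    and bd: "\<And>f. f \<in> CF \<Longrightarrow> \<bar>l f\<bar> \<le> nn f"
  shows "\<exists>\<mu>\<in>ca_ball M PP \<phi> C. \<exists>h\<in>RN_class M Pstar \<mu>.
    \<forall>f\<in>CF. integrable Pstar (\<lambda>x. f x * h x) \<and> l f = (\<integral>x. f x * h x \<partial>Pstar)"
proof -
  obtain L where L: "L \<in> norm_dual M PP C (Phi_norm PP \<phi>)" "\<And>f. f \<in> CF \<Longrightarrow> L (cl f) = l f"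
    by (rule extend_functional[OF C_sub, of l 1]) (use add scale bd in auto)
  obtain \<mu> where \<mu>: "\<mu> \<in> ca_on M PP \<phi> C" "L = ca_functional M C \<mu>" using L(1) dual by auto
  have ball: "\<mu> \<in> ca_ball M PP \<phi> C"
    using \<mu> dual_norm_le_1[OF C_sub L(1)] L(2) bd by (simp add: ca_ball_def)
  have \<mu>ca: "\<mu> \<in> ca M" using \<mu>(1) by (simp add: ca_on_def ca_qs_def)
  have ac: "total_variation M \<mu> N = 0" if "N \<in> sets M" "emeasure Pstar N = 0" for N
    using equiv that \<mu>(1) total_variation_measure[OF Pstar.finite_measure_axioms Pstar_sets]
    unfolding equiv_meas_def abs_cont_def SUP_eq_0_iff by auto
  note RN = signed_integral_RN[OF \<mu>ca Pstar.finite_measure_axioms Pstar_sets]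
  obtain h where h: "h \<in> RN_class M Pstar \<mu>" using RN(1) ac by blast
  show ?thesis
  proof (intro bexI[OF _ ball] bexI[OF _ h] ballI)
    fix f assume f: "f \<in> CF"
    have "integrable (variation_measure M \<mu>) f" using \<mu>(1) f unfolding ca_on_iff[OF C_sub] by blast
    then have "integrable Pstar (\<lambda>x. f x * h x) \<and> jint \<mu> f = (\<integral>x. f x * h x \<partial>Pstar)"
      unfolding jint_def using RN(2)[OF _ h fs_measurable[OF f]] ac by blast
    then show "integrable Pstar (\<lambda>x. f x * h x) \<and> l f = (\<integral>x. f x * h x \<partial>Pstar)"
      using ca_functional_in_dual(2)[OF C_sub C_abs \<mu>(1) f] L(2)[OF f] \<mu>(2) by simp
  qed
qed

interpretation CF: function_space CF
  by unfold_locales (auto intro: CF_zero CF_add CF_scale)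

lemma norming_positive:
  assumes Y: "Y \<in> CF" and Y0: "\<And>x. x \<in> space M \<Longrightarrow> 0 \<le> Y x"
  shows "\<exists>\<mu>\<in>ca_ball M PP \<phi> C. \<exists>h\<in>RN_class M Pstar \<mu>.
    (\<forall>f\<in>CF. (\<forall>x\<in>space M. 0 \<le> f x) \<longrightarrow> 0 \<le> (\<integral>x. f x * h x \<partial>Pstar)) \<and>
    nn Y = (\<integral>x. Y x * h x \<partial>Pstar)"
proof -
  define p where "p f = nn (\<lambda>x. max (f x) 0)" for f
  have pC: "(\<lambda>x. max (f x) 0) \<in> CF" if "f \<in> CF" for f using that CF_zero by (rule CF_max)
  have "CF.sublinear p"
    unfolding CF.sublinear_def
  proof (intro conjI ballI allI impI)
    fix f g assume f: "f \<in> CF" and g: "g \<in> CF"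
    have "p (\<lambda>x. f x + g x) \<le> nn (\<lambda>x. max (f x) 0 + max (g x) 0)"
      unfolding p_def by (intro nn_mono CF_LF CF_add pC f g qsI) auto
    also have "\<dots> \<le> p f + p g" unfolding p_def by (intro LF_add CF_LF pC f g)
    finally show "p (\<lambda>x. f x + g x) \<le> p f + p g" .
  next
    fix c :: real and f assume c: "0 < c" and f: "f \<in> CF"
    have "(\<lambda>x. max (c * f x) 0) = (\<lambda>x. c * max (f x) 0)"
      using c by (auto simp: fun_eq_iff max_def zero_le_mult_iff mult_le_0_iff)
    then show "p (\<lambda>x. c * f x) \<le> c * p f" unfolding p_def using nn_scale[OF CF_LF[OF pC[OF f]], of c] c by simp
  qed
  from CF.Hahn_Banach[OF this Y]
  obtain l where L: "(\<forall>f\<in>CF. \<forall>g\<in>CF. l (\<lambda>x. f x + g x) = l f + l g) \<and>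
    (\<forall>c. \<forall>f\<in>CF. l (\<lambda>x. c * f x) = c * l f) \<and> (\<forall>f\<in>CF. l f \<le> p f) \<and> l Y = p Y" ..
  have l: "\<And>f g. f \<in> CF \<Longrightarrow> g \<in> CF \<Longrightarrow> l (\<lambda>x. f x + g x) = l f + l g"
    "\<And>c f. f \<in> CF \<Longrightarrow> l (\<lambda>x. c * f x) = c * l f" "\<And>f. f \<in> CF \<Longrightarrow> l f \<le> p f" "l Y = p Y"
    using L by blast+
  have p_le: "p f \<le> nn f" if "f \<in> CF" for f
    unfolding p_def by (intro nn_mono CF_LF that qsI) auto
  have neg: "- l f \<le> p (\<lambda>x. - f x)" if "f \<in> CF" for f
    using l(2)[OF that, of "-1"] l(3)[OF CF_scale[OF that, of "-1"]] by simp
  have "\<bar>l f\<bar> \<le> nn f" if f: "f \<in> CF" for f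
  proof -
    have "p (\<lambda>x. - f x) \<le> nn f"
      using p_le[OF CF_scale[OF f, of "-1"]] nn_scale[OF CF_LF[OF f], of "-1"] by simp
    then show ?thesis using neg[OF f] l(3)[OF f] p_le[OF f] by linarith
  qed
  from represent[OF l(1,2) this]
  obtain \<mu> h where h: "\<mu> \<in> ca_ball M PP \<phi> C" "h \<in> RN_class M Pstar \<mu>"
    "\<forall>f\<in>CF. integrable Pstar (\<lambda>x. f x * h x) \<and> l f = (\<integral>x. f x * h x \<partial>Pstar)"
    by blast
  have "0 \<le> (\<integral>x. f x * h x \<partial>Pstar)" if f: "f \<in> CF" "\<And>x. x \<in> space M \<Longrightarrow> 0 \<le> f x" for f
  proof -
    have "p (\<lambda>x. - f x) = nn (\<lambda>_. 0)"
      unfolding p_def by (rule nn_cong) (use f(2) in \<open>auto intro!: qsI\<close>)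
    then show ?thesis using neg[OF f(1)] h(3)[rule_format, OF f(1)] by simp
  qed
  moreover have "nn Y = (\<integral>x. Y x * h x \<partial>Pstar)"
  proof -
    have "p Y = nn Y" unfolding p_def by (rule nn_cong) (use Y0 in \<open>auto intro!: qsI\<close>)
    then show ?thesis using l(4) h(3)[rule_format, OF Y] by simp
  qed
  ultimately show ?thesis by (intro bexI[OF _ h(1)] bexI[OF _ h(2)]) blast
qed

text \<open>
  The sets of densities \<open>h\<close> with \<open>\<integral> (F - X n) h < e\<close> form an open cover of the weakly compact set of
  densities. As \<open>n \<mapsto> \<integral> (F - X n) h\<close> decreases for a density \<open>h\<close> that is positive on \<open>C\<close>, a finite
  subcover gives Dini's uniform convergence, and such densities compute the norm of positive elements.
\<close>

lemma Dini:
  assumes X: "\<And>n::nat. X n \<in> CF" and F: "F \<in> borel_measurable M"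
    and b: "\<And>x n. x \<in> space M \<Longrightarrow> 0 \<le> X n x \<and> X n x \<le> X (Suc n) x \<and> X n x \<le> 1"
    and lim: "\<And>x. x \<in> space M \<Longrightarrow> (\<lambda>n. X n x) \<longlonglongrightarrow> F x"
    and e: "0 < e"
  shows "\<exists>N. \<forall>m\<ge>N. nn (\<lambda>x. X m x - X N x) \<le> e"
proof -
  let ?K = "RN_class M Pstar ` ca_ball M PP \<phi> C"
  let ?D = "norm_dual M {Pstar} (L1 M Pstar) (L1_norm Pstar)"
  note Xm [measurable] = fs_measurable[OF X] and F [measurable]
  have mono: "X n x \<le> X m x" if "x \<in> space M" "n \<le> m" for n m x
    using lift_Suc_mono_le[of "\<lambda>n. X n x", OF _ that(2)] b[OF that(1)] by blast
  have F1: "X n x \<le> F x \<and> F x \<le> 1" if "x \<in> space M" for n x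
    using LIMSEQ_le_const[OF lim[OF that], of "X n x"] LIMSEQ_le_const2[OF lim[OF that], of 1]
      mono[OF that, of n] b[OF that] by blast
  have hI: "h \<in> borel_measurable M" "integrable Pstar h" if "h \<in> RN_class M Pstar \<mu>" for h \<mu>
    using that by (auto simp: RN_class_def)
  have bI: "integrable Pstar (\<lambda>x. g x * h x)"
    if "g \<in> borel_measurable M" "\<And>x. x \<in> space M \<Longrightarrow> \<bar>g x\<bar> \<le> 1" "h \<in> borel_measurable M" "integrable Pstar h" for g h :: "'a \<Rightarrow> real"
    using that(4)
  proof (rule Bochner_Integration.integrable_bound)
    show "(\<lambda>x. g x * h x) \<in> borel_measurable Pstar" using that by (simp add: meas_Pstar)
    show "AE x in Pstar. norm (g x * h x) \<le> norm (h x)"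
      using that(2) by (intro AE_I2) (auto simp: abs_mult space_Q[OF Pstar_prob Pstar_sets] intro: mult_left_le_one_le)
  qed
  have F_X: "\<bar>F x - X n x\<bar> \<le> 1" if "x \<in> space M" for x n
    using F1[OF that, of n] b[OF that, of n] by (auto simp: abs_le_iff)
  have FXI: "integrable Pstar (\<lambda>x. (F x - X n x) * h x)" if "h \<in> RN_class M Pstar \<mu>" for h \<mu> n
    using hI[OF that] F_X by (intro bI) auto
  have to0: "(\<lambda>n. \<integral>x. (F x - X n x) * h x \<partial>Pstar) \<longlonglongrightarrow> 0" if h: "h \<in> RN_class M Pstar \<mu>" for h \<mu>
  proof -
    have "(\<lambda>n. \<integral>x. (F x - X n x) * h x \<partial>Pstar) \<longlonglongrightarrow> (\<integral>x. 0 \<partial>Pstar)"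
    proof (rule integral_dominated_convergence[where w = "\<lambda>x. \<bar>h x\<bar>"])
      show "(\<lambda>x. (F x - X n x) * h x) \<in> borel_measurable Pstar" for n
        using FXI[OF h] by (rule borel_measurable_integrable)
      show "integrable Pstar (\<lambda>x. \<bar>h x\<bar>)" using hI(2)[OF h] by simp
      show "AE x in Pstar. (\<lambda>n. (F x - X n x) * h x) \<longlonglongrightarrow> 0"
      proof (rule AE_I2)
        fix x assume "x \<in> space Pstar"
        then have "x \<in> space M" by (simp add: space_Q[OF Pstar_prob Pstar_sets])
        then have "(\<lambda>n. F x - X n x) \<longlonglongrightarrow> F x - F x" by (intro tendsto_intros lim)
        then show "(\<lambda>n. (F x - X n x) * h x) \<longlonglongrightarrow> 0" by (intro tendsto_mult_left_zero) simp
      qed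
      show "AE x in Pstar. norm ((F x - X n x) * h x) \<le> \<bar>h x\<bar>" for n
        using F_X by (intro AE_I2) (auto simp: abs_mult space_Q[OF Pstar_prob Pstar_sets] intro: mult_left_le_one_le)
    qed simp
    then show ?thesis by simp
  qed
  have "\<exists>k\<in>?D. \<forall>f. f \<in> borel_measurable M \<longrightarrow> integrable Pstar f \<longrightarrow>
      k (qs_class M {Pstar} f) = (\<integral>x. (F x - X n x) * f x \<partial>Pstar)" for n
  proof (rule bounded_in_L1_dual[OF Pstar_prob Pstar_sets, of "\<lambda>x. F x - X n x" 1])
    show "(\<lambda>x. F x - X n x) \<in> borel_measurable M" by measurable
    show "\<bar>F x - X n x\<bar> \<le> 1" if "x \<in> space M" for x by (rule F_X[OF that])
  qed blast
  then obtain k where k: "\<And>n. k n \<in> ?D" "\<And>n f. f \<in> borel_measurable M \<Longrightarrow> integrable Pstar f \<Longrightarrow>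
      k n (qs_class M {Pstar} f) = (\<integral>x. (F x - X n x) * f x \<partial>Pstar)" by metis
  have kRN: "k n (RN_class M Pstar \<mu>) = (\<integral>x. (F x - X n x) * h x \<partial>Pstar)" if h: "h \<in> RN_class M Pstar \<mu>" for n h \<mu>
    using k(2)[OF hI[OF h]] RN_class_eq[OF Pstar_sets h] by simp
  define U where "U n = {Z \<in> L1 M Pstar. k n Z \<in> {..<e}}" for n
  have ex_h: "\<exists>h. h \<in> RN_class M Pstar \<mu>" if "\<mu> \<in> ca_ball M PP \<phi> C" for \<mu>
  proof -
    have \<mu>: "\<mu> \<in> ca_on M PP \<phi> C" using that by (simp add: ca_ball_def)
    then have ca: "\<mu> \<in> ca M" by (simp add: ca_on_def ca_qs_def)
    show ?thesis
    proof (rule signed_integral_RN(1)[OF ca Pstar.finite_measure_axioms Pstar_sets])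
      show "total_variation M \<mu> N = 0" if "N \<in> sets M" "emeasure Pstar N = 0" for N
        using equiv that \<mu> total_variation_measure[OF Pstar.finite_measure_axioms Pstar_sets]
        unfolding equiv_meas_def abs_cont_def SUP_eq_0_iff by auto
    qed
  qed
  have "?K \<subseteq> \<Union> (range U)"
  proof
    fix Z assume "Z \<in> ?K"
    then obtain \<mu> where \<mu>: "\<mu> \<in> ca_ball M PP \<phi> C" "Z = RN_class M Pstar \<mu>" by blast
    obtain h where h: "h \<in> RN_class M Pstar \<mu>" using ex_h[OF \<mu>(1)] ..
    obtain n where "\<bar>\<integral>x. (F x - X n x) * h x \<partial>Pstar\<bar> < e"
      using LIMSEQ_D[OF to0[OF h] e] by auto
    then have "Z \<in> U n"
      using kRN[OF h, of n] RN_class_L1[OF Pstar_prob Pstar_sets h] by (simp add: U_def \<mu>(2))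
    then show "Z \<in> \<Union> (range U)" by blast
  qed
  moreover have "openin (weak_topology M {Pstar} (L1 M Pstar) (L1_norm Pstar)) (U n)" for n
    unfolding weak_topology_def
    by (rule topology_generated_by_Basis) (use k(1) in \<open>auto simp: U_def intro!: exI[of _ "k n"] exI[of _ "{..<e}"]\<close>)
  ultimately obtain \<F> where "finite \<F>" "\<F> \<subseteq> range U" "?K \<subseteq> \<Union>\<F>"
    using compactinD[OF compact[unfolded weakly_compact_L1_def], of "range U"] by blast
  then obtain I where I: "finite I" "?K \<subseteq> \<Union> (U ` I)" by (metis finite_subset_image)
  define N where "N = Max (insert 0 I)"
  have IN: "n \<le> N" if "n \<in> I" for n unfolding N_def using I(1) that by (intro Max_ge) auto
  have "nn (\<lambda>x. X m x - X N x) \<le> e" if m: "N \<le> m" for m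
  proof -
    define Y where "Y x = X m x - X N x" for x
    have Y: "Y \<in> CF" "\<And>x. x \<in> space M \<Longrightarrow> 0 \<le> Y x"
      using mono[OF _ m] by (auto simp: Y_def[abs_def] intro: CF_diff X)
    obtain \<mu> h where \<mu>: "\<mu> \<in> ca_ball M PP \<phi> C" and h: "h \<in> RN_class M Pstar \<mu>"
      and pos: "\<forall>f\<in>CF. (\<forall>x\<in>space M. 0 \<le> f x) \<longrightarrow> 0 \<le> (\<integral>x. f x * h x \<partial>Pstar)"
      and nY: "nn Y = (\<integral>x. Y x * h x \<partial>Pstar)"
      using norming_positive[OF Y] by blast
    define G where "G n = (\<integral>x. (F x - X n x) * h x \<partial>Pstar)" for n
    have diff: "G n - G j = (\<integral>x. (X j x - X n x) * h x \<partial>Pstar)" for n j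
    proof -
      have "G n - G j = (\<integral>x. (F x - X n x) * h x - (F x - X j x) * h x \<partial>Pstar)"
        unfolding G_def by (rule Bochner_Integration.integral_diff[OF FXI[OF h] FXI[OF h], symmetric])
      then show ?thesis by (simp add: algebra_simps)
    qed
    have anti: "G j \<le> G n" if "n \<le> j" for n j
    proof -
      have "0 \<le> (\<integral>x. (X j x - X n x) * h x \<partial>Pstar)"
        using mono[OF _ that] by (intro pos[rule_format] CF_diff X) simp
      then show ?thesis using diff[of n j] by linarith
    qed
    have "G \<longlonglongrightarrow> 0" unfolding G_def by (rule to0[OF h])
    then have Gm: "0 \<le> G m" by (rule LIMSEQ_le_const2) (use anti in blast)
    have "RN_class M Pstar \<mu> \<in> \<Union> (U ` I)" using I(2) \<mu> by blast
    then obtain n where n: "n \<in> I" "G n < e" using kRN[OF h] by (auto simp: U_def G_def)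
    have "nn Y = G N - G m" unfolding nY diff by (simp add: Y_def)
    also have "\<dots> \<le> G n" using Gm anti[OF IN[OF n(1)]] by linarith
    finally show ?thesis using n(2) by (simp add: Y_def[abs_def])
  qed
  then show ?thesis by blast
qed

lemma dual_imp_C_eq_closure_Linf: "C = Phi_topology M PP \<phi> closure_of Linf M PP" (is "C = ?D")
proof -
  have LC: "Linf M PP \<subseteq> C"
  proof (rule Linf_subset[OF H_C H_gen])
    fix f :: "nat \<Rightarrow> 'a \<Rightarrow> real" and F
    assume f: "\<And>n. f n \<in> CF" "F \<in> borel_measurable M"
      "\<And>x n. x \<in> space M \<Longrightarrow> 0 \<le> f n x \<and> f n x \<le> f (Suc n) x \<and> f n x \<le> 1"
      "\<And>x. x \<in> space M \<Longrightarrow> (\<lambda>n. f n x) \<longlonglongrightarrow> F x"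
    show "F \<in> CF"
      by (rule Cauchy_limit(1)[of f F, OF f(1,2)]) (use f(3,4) Dini[OF f] in blast)+
  qed
  have DL: "?D \<subseteq> LP" by (rule closure_subset_LP)
  have fsLC: "fs (Linf M PP) \<subseteq> CF" using LC fs_subset_iff[OF Linf_LP C_LP] by blast
  have DC: "fs ?D \<subseteq> CF"
  proof
    fix f assume "f \<in> fs ?D"
    then have "f \<in> LF" "\<And>e. 0 < e \<Longrightarrow> \<exists>g\<in>fs (Linf M PP). nn (\<lambda>x. f x - g x) < e"
      using fs_closure_iff[OF Linf_LP] by blast+
    then show "f \<in> CF" using fsLC by (intro C_closed) blast+
  qed
  note D_sub = subspace_fs(2-4)[OF closure_subspace[OF Linf_subspace]]
  have ind_D: "(indicator A :: 'a \<Rightarrow> real) \<in> fs ?D" if "A \<in> sets M" for A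
    using bounded_Linf[of "indicator A" 1] that closure_subset_fs[OF Linf_LP] by (auto split: split_indicator)
  have "CF \<subseteq> fs ?D"
  proof (rule ccontr)
    assume "\<not> CF \<subseteq> fs ?D"
    then obtain f where f: "f \<in> CF" "f \<notin> fs ?D" by blast
    have "\<exists>e>0. \<forall>d\<in>fs ?D. e \<le> nn (\<lambda>x. f x - d x)"
    proof (rule ccontr)
      assume "\<not> ?thesis"
      then have "\<And>e. 0 < e \<Longrightarrow> \<exists>d\<in>fs ?D. nn (\<lambda>x. f x - d x) < e" by (auto simp: not_le)
      then show False using closure_mem[OF Linf_LP CF_LF[OF f(1)]] f(2) by blast
    qed
    then obtain e where e: "0 < e" "\<And>d. d \<in> fs ?D \<Longrightarrow> e \<le> nn (\<lambda>x. f x - d x)" by blast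
    define p where "p g = (INF d\<in>fs ?D. nn (\<lambda>x. g x - d x))" for g
    have D0: "fs ?D \<noteq> {}" using D_sub(1) by blast
    have p_le: "p g \<le> nn (\<lambda>x. g x - d x)" if "d \<in> fs ?D" for g d
      unfolding p_def using that by (intro cINF_lower bdd_belowI2[of _ 0]) auto
    have p_ge: "c \<le> p g" if "\<And>d. d \<in> fs ?D \<Longrightarrow> c \<le> nn (\<lambda>x. g x - d x)" for c g
      unfolding p_def using D0 that by (intro cINF_greatest)
    have "CF.sublinear p"
      unfolding CF.sublinear_def
    proof (intro conjI ballI allI impI)
      fix g h assume g: "g \<in> CF" and h: "h \<in> CF"
      have "p (\<lambda>x. g x + h x) - nn (\<lambda>x. h x - d' x) \<le> p g" if d': "d' \<in> fs ?D" for d'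
      proof (rule p_ge)
        fix d assume d: "d \<in> fs ?D"
        have "p (\<lambda>x. g x + h x) \<le> nn (\<lambda>x. (g x + h x) - (d x + d' x))"
          by (intro p_le D_sub d d')
        also have "\<dots> = nn (\<lambda>x. (g x - d x) + (h x - d' x))" by (simp add: algebra_simps)
        also have "\<dots> \<le> nn (\<lambda>x. g x - d x) + nn (\<lambda>x. h x - d' x)"
          using g h d d' DC by (intro LF_add CF_LF CF_diff) auto
        finally show "p (\<lambda>x. g x + h x) - nn (\<lambda>x. h x - d' x) \<le> nn (\<lambda>x. g x - d x)" by simp
      qed
      then have "p (\<lambda>x. g x + h x) - p g \<le> p h" by (intro p_ge) (simp add: algebra_simps)
      then show "p (\<lambda>x. g x + h x) \<le> p g + p h" by simp
    next
      fix c :: real and g assume c: "0 < c" and g: "g \<in> CF"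
      have "p (\<lambda>x. c * g x) / c \<le> p g"
      proof (rule p_ge)
        fix d assume d: "d \<in> fs ?D"
        have "p (\<lambda>x. c * g x) \<le> nn (\<lambda>x. c * g x - c * d x)" by (intro p_le D_sub d)
        also have "\<dots> = nn (\<lambda>x. c * (g x - d x))" by (simp add: algebra_simps)
        also have "\<dots> = c * nn (\<lambda>x. g x - d x)"
          using g d DC c by (subst nn_scale) (auto intro: CF_LF CF_diff)
        finally show "p (\<lambda>x. c * g x) / c \<le> nn (\<lambda>x. g x - d x)" using c by (simp add: field_simps)
      qed
      then show "p (\<lambda>x. c * g x) \<le> c * p g" using c by (simp add: field_simps)
    qed
    from CF.Hahn_Banach[OF this f(1)]
    obtain l where L: "(\<forall>f\<in>CF. \<forall>g\<in>CF. l (\<lambda>x. f x + g x) = l f + l g) \<and>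
      (\<forall>c. \<forall>f\<in>CF. l (\<lambda>x. c * f x) = c * l f) \<and> (\<forall>f\<in>CF. l f \<le> p f) \<and> l f = p f" ..
    have l: "\<And>f g. f \<in> CF \<Longrightarrow> g \<in> CF \<Longrightarrow> l (\<lambda>x. f x + g x) = l f + l g"
      "\<And>c f. f \<in> CF \<Longrightarrow> l (\<lambda>x. c * f x) = c * l f" "\<And>f. f \<in> CF \<Longrightarrow> l f \<le> p f" "l f = p f"
      using L by blast+
    have p_nn: "p g \<le> nn g" for g using p_le[OF D_sub(1), of g] by simp
    have neg: "- l g \<le> p (\<lambda>x. - 1 * g x)" if "g \<in> CF" for g
      using l(2)[OF that, of "-1"] l(3)[OF CF_scale[OF that, of "-1"]] by simp
    have "\<bar>l g\<bar> \<le> nn g" if g: "g \<in> CF" for g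
      using neg[OF g] p_nn[of "\<lambda>x. - 1 * g x"] nn_scale[OF CF_LF[OF g], of "-1"] l(3)[OF g] p_nn[of g] by simp
    from represent[OF l(1,2) this]
    obtain \<mu> h where h: "h \<in> RN_class M Pstar \<mu>"
      "\<forall>f\<in>CF. integrable Pstar (\<lambda>x. f x * h x) \<and> l f = (\<integral>x. f x * h x \<partial>Pstar)"
      by blast
    have p0: "p d \<le> 0" if "d \<in> fs ?D" for d using p_le[OF that, of d] by simp
    have "l (indicator A) = 0" if A: "A \<in> sets M" for A
      using l(3)[of "indicator A"] neg[of "indicator A"] p0[OF ind_D[OF A]] p0[OF D_sub(3)[OF ind_D[OF A], of "-1"]]
        ind_D[OF A] DC by fastforce
    then have "(LINT x:A|Pstar. h x) = (LINT x:A|Pstar. 0)" if "A \<in> sets Pstar" for A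
      using h(2)[rule_format, of "indicator A"] ind_D[of A] DC that Pstar_sets by (auto simp: set_lebesgue_integral_def)
    then have ae: "AE x in Pstar. h x = 0"
      using h(1) by (intro density_unique_real) (auto simp: RN_class_def)
    have "l f = (\<integral>x. f x * h x \<partial>Pstar)" using h(2)[rule_format, OF f(1)] by simp
    also have "\<dots> = 0" by (rule integral_eq_zero_AE) (use ae in auto)
    finally have "p f = 0" using l(4) by simp
    moreover have "e \<le> p f" by (rule p_ge[OF e(2)])
    ultimately show False using e(1) by simp
  qed
  with DC show ?thesis using fs_eq_iff[OF C_LP DL] by blast
qed

end

end

theorem theorem4p7:
  fixes M Pstar :: "'a measure"
    and PP :: "'a measure set"
    and \<phi> :: "'a measure \<Rightarrow> real \<Rightarrow> ennreal"
    and H C :: "('a \<Rightarrow> real) set set"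
  assumes "priors M PP"
    and "\<And>P. P \<in> PP \<Longrightarrow> orlicz_function (\<phi> P)"
    and "Linf M PP \<subseteq> L_Phi M PP \<phi>"
    and "qs_sublattice M PP (L_Phi M PP \<phi>) H"
    and "qs_class M PP (\<lambda>_. 1) \<in> H"
    and "generates_sigma M PP H"
    and C_def: "C = Phi_topology M PP \<phi> closure_of H"
    and "separable_space (subtopology (Phi_topology M PP \<phi>) C)"
    and "Pstar \<in> ca_prob M PP \<phi>"
    and "inj_on (qs_proj M Pstar) C"
  defines "s1 \<equiv> dedekind_sigma_complete C (qs_le PP)"
    and "s2 \<equiv> super_dedekind_complete C (qs_le PP)"
    and "s3 \<equiv> C = Phi_topology M PP \<phi> closure_of Linf M PP"
    and "s4 \<equiv> qs_ideal M PP (L_Phi M PP \<phi>) C"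
    and "s5 \<equiv> norm_dual M PP C (Phi_norm PP \<phi>) = ca_functional M C ` ca_on M PP \<phi> C \<and>
              ca_on M PP \<phi> C = ca_on M PP \<phi> (L_Phi M PP \<phi>) \<and>
              equiv_meas M (ca_on M PP \<phi> C) {measure Pstar} \<and>
              weakly_compact_L1 M Pstar (RN_class M Pstar ` ca_ball M PP \<phi> C)"
    and "s6 \<equiv> equiv_meas M (measure ` PP) {measure Pstar}"
    and "s7 \<equiv> (\<exists>x0>0. 0 < (INF P\<in>PP. \<phi> P x0)) \<longrightarrow>
              uniformly_integrable M Pstar ((\<lambda>P. RN_class M Pstar (measure P)) ` PP)"
  shows "(s1 \<longleftrightarrow> s2) \<and> (s1 \<longleftrightarrow> s3) \<and> (s1 \<longleftrightarrow> s4) \<and> (s1 \<longleftrightarrow> s5) \<and> (s1 \<longrightarrow> s6 \<and> s7)"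
proof -
  interpret separable_closure M PP \<phi> H C Pstar
    by unfold_locales (fact assms(1-10))+
  have 12: "s2" if "s1" using that unfolding s1_def s2_def by (rule C_super_complete)
  have 21: "s1" if "s2"
    using that unfolding s1_def s2_def super_dedekind_complete_def dedekind_complete_def dedekind_sigma_complete_def
    by blast
  have 13: "s3" if "s1" using that unfolding s1_def s3_def by (rule C_eq_closure_Linf)
  have 34: "s4" if "s3" using that unfolding s3_def s4_def by (rule C_ideal)
  have 41: "s1" if "s4" using that unfolding s1_def s4_def by (rule ideal_imp_sigma_complete)
  have 1567: "s5 \<and> s6 \<and> s7" if "s1"
  proof -
    interpret complete_closure M PP \<phi> H C Pstar
      by unfold_locales (use that in \<open>simp add: s1_def\<close>)
    show ?thesis
      unfolding s5_def s6_def s7_def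
      using dual_eq ca_on_C_eq ca_C_equiv ca_ball_weakly_compact PP_equiv densities_uniformly_integrable by blast
  qed
  have 53: "s3" if "s5" using that unfolding s3_def s5_def by (elim conjE) (rule dual_imp_C_eq_closure_Linf)
  show ?thesis using 12 21 13 34 41 1567 53 by blast
qed

end
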